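(* Let $M=G/K$ be a connected compact homogeneous space with $G$ a compact Lie group and $K\subset G$ the isotropy subgroup, let $Q$ be a bi-invariant (i.e. $\operatorname{Ad}(G)$-invariant) inner product on $\mathfrak{g}$, let $\mathfrak{g}=\mathfrak{k}\oplus\mathfrak{p}$ be the $Q$-orthogonal reductive decomposition, and let $\mathfrak{p}=\mathfrak{p}_1\oplus\dots\oplus\mathfrak{p}_r$ be a $Q$-orthogonal decomposition. Assume that the subspaces $\mathfrak{p}_k$ are all $\operatorname{Ad}(H)$-invariant, $\operatorname{Ad}(H)$-irreducible and pairwise inequivalent (as $\operatorname{Ad}(H)$-representations) for some intermediate subgroup $K\subset H\subset N_G(K)$, where $N_G(K)$ is the normalizer of $K$ in $G$. Then, for any metric $g=x_1Q|_{\mathfrak{p}_1}+\dots+x_rQ|_{\mathfrak{p}_r}$ (with $x_1,\dots,x_r>0$), the entries of the matrix of $\operatorname{L}_{\mathfrak{p}}=\operatorname{L}_{\mathfrak{p}}(g)$, restricted to $\operatorname{sym}(\mathfrak{p})^H$, with respect to the orthonormal basis $\left\{\frac{1}{\sqrt{d_1}}I_1,\dots,\frac{1}{\sqrt{d_r}}I_r\right\}$ of $\operatorname{sym}(\mathfrak{p})^H$ are given by $$ [\operatorname{L}_{\mathfrak{p}}]_{kk}=\frac{1}{d_k}\sum_{i,j\neq k}\frac{x_k}{x_ix_j}[ijk]+\frac{1}{d_k}\sum_{i\neq k}\frac{x_i}{x_k^2}[ikk],\qquad\forall k=1,\dots,r, $$ and $$ [\operatorname{L}_{\mathfrak{p}}]_{km}=\frac{1}{\sqrt{d_k}\sqrt{d_m}}\sum_{i}\frac{x_i^2-x_k^2-x_m^2}{x_ix_kx_m}[ikm],\qquad\forall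 k\neq m. $$ Here all summation indices range over $\{1,\dots,r\}$ subject to the indicated restrictions ($i,j$ range independently, both different from $k$, in the first sum).
   Context: Setting. $M$ is a compact connected manifold with a fixed almost-effective transitive action of a compact Lie group $G$; $K$ is the isotropy subgroup at a point $o\in M$, so $M=G/K$. $\mathfrak{g},\mathfrak{k}$ are the Lie algebras of $G,K$. The reductive complement $\mathfrak{p}$ is identified with $T_oM$, and a $G$-invariant metric $g$ is identified with the $\operatorname{Ad}(K)$-invariant inner product $\langle\cdot,\cdot\rangle:=g_o$ on $\mathfrak{p}$. For $K\subset H\subset N_G(K)$, $\operatorname{Ad}(H)$ preserves $\mathfrak{k}$ and hence $\mathfrak{p}$. Structural constants. $d_k:=\dim\mathfrak{p}_k$, and $$[ijk]:=\sum_{\alpha,\beta,\gamma}Q([e^i_\alpha,e^j_\beta],e^k_\gamma)^2,$$ where $\{e^i_\alpha\},\{e^j_\beta\},\{e^k_\gamma\}$ are $Q$-orthonormal bases of $\mathfrak{p}_i,\mathfrak{p}_j,\mathfrak{p}_k$, respectively. The number $[ijk]$ is invariant under permutations of $i,j,k$. Spaces and basis. $\operatorname{sym}(\mathfrak{p}):=\{A:\mathfrak{p}\to\mathfrak{p}\ \text{linear}: A^t=A\}$ (transpose with respect to $\langle\cdot,\cdot\rangle$) and $\operatorname{sym}(\mathfrak{p})^H:=\{A\in\operatorname{sym}(\mathfrak{p}):[\operatorname{Ad}(H),A]=0\}$, the maps commuting with $\operatorname{Ad}(h)|_{\mathfrak{p}}$ for all $h\in H$. The inner product on $\mathfrak{gl}(\mathfrak{p})$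 is $\langle A,B\rangle:=\operatorname{tr}AB^t$. $I_k\in\operatorname{sym}(\mathfrak{p})$ is the map that is the identity on $\mathfrak{p}_k$ and $0$ on $\mathfrak{p}_i$ for $i\neq k$. The operator $\operatorname{L}_{\mathfrak{p}}$. Let $\mu$ be the Lie bracket of $\mathfrak{g}$ and $\mu_{\mathfrak{p}}:=\operatorname{pr}_{\mathfrak{p}}\circ\mu|_{\mathfrak{p}\times\mathfrak{p}}:\mathfrak{p}\times\mathfrak{p}\to\mathfrak{p}$, with $\operatorname{pr}_{\mathfrak{p}}:\mathfrak{g}\to\mathfrak{p}$ the projection relative to $\mathfrak{g}=\mathfrak{k}\oplus\mathfrak{p}$. Thus $\mu_{\mathfrak{p}}\in\Lambda^2\mathfrak{p}^*\otimes\mathfrak{p}$, a space endowed with the inner product $\langle\lambda,\nu\rangle:=\sum_{i,j}\langle\lambda(X_i,X_j),\nu(X_i,X_j)\rangle$ for any $\langle\cdot,\cdot\rangle$-orthonormal basis $\{X_i\}$ of $\mathfrak{p}$. The representation $\theta$ of $\mathfrak{gl}(\mathfrak{p})$ on $\Lambda^2\mathfrak{p}^*\otimes\mathfrak{p}$ is $$\theta(A)\lambda:=A\lambda(\cdot,\cdot)-\lambda(A\cdot,\cdot)-\lambda(\cdot,A\cdot).$$ The moment map value $\operatorname{M}_{\mu_{\mathfrak{p}}}\in\operatorname{sym}(\mathfrak{p})$ is defined by $\langle\operatorname{M}_{\mu_{\mathfrak{p}}},A\rangle=\frac14\langle\theta(A)\mu_{\mathfrak{p}},\mu_{\mathfrak{p}}\rangle$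 for all $A\in\mathfrak{gl}(\mathfrak{p})$. Then $\operatorname{L}_{\mathfrak{p}}=\operatorname{L}_{\mathfrak{p}}(g):\operatorname{sym}(\mathfrak{p})\to\operatorname{sym}(\mathfrak{p})$ is the self-adjoint operator defined by $$\langle\operatorname{L}_{\mathfrak{p}}A,B\rangle=\tfrac12\langle\theta(A)\mu_{\mathfrak{p}},\theta(B)\mu_{\mathfrak{p}}\rangle+2\operatorname{tr}\operatorname{M}_{\mu_{\mathfrak{p}}}AB,\qquad\forall A,B\in\operatorname{sym}(\mathfrak{p}).$$ (It corresponds to the Lichnerowicz Laplacian of $g$ on $G$-invariant symmetric $2$-tensors.) For a $G$-invariant metric $g$ which is in addition $\operatorname{Ad}(H)$-invariant, as is the case for the metrics in the claim, $\operatorname{L}_{\mathfrak{p}}$ leaves $\operatorname{sym}(\mathfrak{p})^H$ invariant. *)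

theory Defs
  imports "HOL-Analysis.Analysis" "HOL-Algebra.Group_Action"
begin

section \<open>Smooth manifolds\<close>

primrec Ck_on :: "nat \<Rightarrow> ('a::euclidean_space \<Rightarrow> 'b::euclidean_space) \<Rightarrow> 'a set \<Rightarrow> bool" where
  "Ck_on 0 f S \<longleftrightarrow> continuous_on S f"
| "Ck_on (Suc n) f S \<longleftrightarrow>
     (\<forall>x\<in>S. f differentiable at x) \<and>
     (\<forall>v. Ck_on n (\<lambda>x. frechet_derivative f (at x) v) S)"

text \<open>Only used for open sets, where the unrestricted filter \<^term>\<open>at x\<close> is the right one.\<close>

definition smooth_on :: "('a::euclidean_space \<Rightarrow> 'b::euclidean_space) \<Rightarrow> 'a set \<Rightarrow> bool" where
  "smooth_on f S \<longleftrightarrow> (\<forall>n. Ck_on n f S)"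

type_synonym ('m, 'e) atlas = "('m set \<times> ('m \<Rightarrow> 'e)) set"

definition is_chart :: "'m topology \<Rightarrow> 'm set \<Rightarrow> ('m \<Rightarrow> 'e::euclidean_space) \<Rightarrow> bool" where
  "is_chart T U \<phi> \<longleftrightarrow>
     openin T U \<and> open (\<phi> ` U) \<and>
     homeomorphic_map (subtopology T U) (top_of_set (\<phi> ` U)) \<phi>"

definition smooth_manifold :: "'m topology \<Rightarrow> ('m, 'e::euclidean_space) atlas \<Rightarrow> bool" where
  "smooth_manifold T A \<longleftrightarrow>
     Hausdorff_space T \<and> second_countable T \<and>
     (\<forall>(U, \<phi>)\<in>A. is_chart T U \<phi>) \<and>
     (\<Union>(U, \<phi>)\<in>A. U) = topspace T \<and>
     (\<forall>(U, \<phi>)\<in>A. \<forall>(V, \<psi>)\<in>A. smooth_on (\<lambda>u. \<psi> (inv_into U \<phi> u)) (\<phi> ` (U \<inter> V)))"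

definition prod_atlas ::
  "('m, 'e::euclidean_space) atlas \<Rightarrow> ('n, 'f::euclidean_space) atlas \<Rightarrow> ('m \<times> 'n, 'e \<times> 'f) atlas" where
  "prod_atlas A B = {(U \<times> V, map_prod \<phi> \<psi>) | U \<phi> V \<psi>. (U, \<phi>) \<in> A \<and> (V, \<psi>) \<in> B}"

definition smooth_map ::
  "'m topology \<Rightarrow> ('m, 'e::euclidean_space) atlas \<Rightarrow> 'n topology \<Rightarrow> ('n, 'f::euclidean_space) atlas \<Rightarrow>
   ('m \<Rightarrow> 'n) \<Rightarrow> bool" where
  "smooth_map S A T B f \<longleftrightarrow>
     continuous_map S T f \<and>
     (\<forall>(U, \<phi>)\<in>A. \<forall>(V, \<psi>)\<in>B.
        smooth_on (\<lambda>u. \<psi> (f (inv_into U \<phi> u))) (\<phi> ` {x \<in> U. f x \<in> V}))"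


section \<open>Lie groups and their Lie algebras\<close>

definition lie_group :: "'g monoid \<Rightarrow> 'g topology \<Rightarrow> ('g, 'e::euclidean_space) atlas \<Rightarrow> bool" where
  "lie_group G T A \<longleftrightarrow>
     group G \<and> topspace T = carrier G \<and> smooth_manifold T A \<and>
     smooth_map (prod_topology T T) (prod_atlas A A) T A (\<lambda>(x, y). x \<otimes>\<^bsub>G\<^esub> y) \<and>
     smooth_map T A T A (\<lambda>x. inv\<^bsub>G\<^esub> x)"

text \<open>
  Let \<open>(U, \<phi>)\<close> be a chart of a Lie group \<open>G\<close> with the identity in \<open>U\<close>. The differential of \<open>\<phi>\<close> at
  the identity identifies the tangent space there, i.e. the Lie algebra of \<open>G\<close>, with the model
  space \<open>'e\<close>; the norm and inner product of the type \<open>'e\<close> play no geometric role. Under this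
  identification \<open>Ad_map\<close> is the differential at the identity of conjugation by \<open>g\<close>,
  \<open>left_inv_field X\<close> is the left-invariant vector field with value \<open>X\<close> at the identity (in the
  coordinates \<open>u\<close> of \<open>\<phi>\<close>), and \<open>lie_bracket X Y\<close> is the value at the identity of the vector field
  commutator, which in coordinates is \<open>[V, W] = DW V - DV W\<close>.
\<close>

definition Ad_map :: "'g monoid \<Rightarrow> 'g set \<Rightarrow> ('g \<Rightarrow> 'e::euclidean_space) \<Rightarrow> 'g \<Rightarrow> 'e \<Rightarrow> 'e" where
  "Ad_map G U \<phi> g =
     frechet_derivative (\<lambda>v. \<phi> (g \<otimes>\<^bsub>G\<^esub> inv_into U \<phi> v \<otimes>\<^bsub>G\<^esub> inv\<^bsub>G\<^esub> g)) (at (\<phi> \<one>\<^bsub>G\<^esub>))"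

definition left_inv_field ::
  "'g monoid \<Rightarrow> 'g set \<Rightarrow> ('g \<Rightarrow> 'e::euclidean_space) \<Rightarrow> 'e \<Rightarrow> 'e \<Rightarrow> 'e" where
  "left_inv_field G U \<phi> X u =
     frechet_derivative (\<lambda>v. \<phi> (inv_into U \<phi> u \<otimes>\<^bsub>G\<^esub> inv_into U \<phi> v)) (at (\<phi> \<one>\<^bsub>G\<^esub>)) X"

definition lie_bracket ::
  "'g monoid \<Rightarrow> 'g set \<Rightarrow> ('g \<Rightarrow> 'e::euclidean_space) \<Rightarrow> 'e \<Rightarrow> 'e \<Rightarrow> 'e" where
  "lie_bracket G U \<phi> X Y =
     frechet_derivative (left_inv_field G U \<phi> Y) (at (\<phi> \<one>\<^bsub>G\<^esub>)) X -
     frechet_derivative (left_inv_field G U \<phi> X) (at (\<phi> \<one>\<^bsub>G\<^esub>)) Y"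

text \<open>
  The Lie algebra of a closed subgroup \<open>K\<close>, as the tangent space of \<open>K\<close> at the identity: velocities of
  curves in \<open>K\<close> through the identity. As \<open>K\<close> is an embedded submanifold, differentiability of
  the curve at the parameter \<open>0\<close> gives the same tangent vectors as smoothness does.
\<close>

definition subgroup_lie_algebra ::
  "'g monoid \<Rightarrow> 'g set \<Rightarrow> ('g \<Rightarrow> 'e::euclidean_space) \<Rightarrow> 'g set \<Rightarrow> 'e set" where
  "subgroup_lie_algebra G U \<phi> K =
     {X. \<exists>\<gamma>::real \<Rightarrow> 'g. \<gamma> 0 = \<one>\<^bsub>G\<^esub> \<and> (\<forall>t. \<gamma> t \<in> K \<inter> U) \<and>
           ((\<lambda>t. \<phi> (\<gamma> t)) has_vector_derivative X) (at 0)}"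

definition smooth_transitive_action ::
  "'g monoid \<Rightarrow> 'g topology \<Rightarrow> ('g, 'e::euclidean_space) atlas \<Rightarrow>
   'm topology \<Rightarrow> ('m, 'f::euclidean_space) atlas \<Rightarrow> ('g \<Rightarrow> 'm \<Rightarrow> 'm) \<Rightarrow> bool" where
  "smooth_transitive_action G TG AG TM AM act \<longleftrightarrow>
     transitive_action G (topspace TM) act \<and>
     smooth_map (prod_topology TG TM) (prod_atlas AG AM) TM AM (\<lambda>(g, p). act g p)"

text \<open>Almost effective: the kernel of the action is discrete.\<close>

definition almost_effective :: "'g monoid \<Rightarrow> 'g topology \<Rightarrow> 'm topology \<Rightarrow> ('g \<Rightarrow> 'm \<Rightarrow> 'm) \<Rightarrow> bool" where
  "almost_effective G TG TM act \<longleftrightarrow>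
     (let N = {g \<in> carrier G. \<forall>p\<in>topspace TM. act g p = p}
      in subtopology TG N = discrete_topology N)"


section \<open>Linear algebra\<close>

definition inner_product :: "('e::real_vector \<Rightarrow> 'e \<Rightarrow> real) \<Rightarrow> bool" where
  "inner_product Q \<longleftrightarrow>
     (\<forall>Y. linear (\<lambda>X. Q X Y)) \<and> (\<forall>X Y. Q X Y = Q Y X) \<and> (\<forall>X. X \<noteq> 0 \<longrightarrow> Q X X > 0)"

definition orthonormal_basis :: "('v::real_vector \<Rightarrow> 'v \<Rightarrow> real) \<Rightarrow> 'v set \<Rightarrow> 'v set \<Rightarrow> bool" where
  "orthonormal_basis ip V B \<longleftrightarrow>
     independent B \<and> span B = V \<and> (\<forall>x\<in>B. \<forall>y\<in>B. ip x y = (if x = y then 1 else 0))"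

definition orthogonal_decomposition ::
  "('e::real_vector \<Rightarrow> 'e \<Rightarrow> real) \<Rightarrow> 'e set \<Rightarrow> nat \<Rightarrow> (nat \<Rightarrow> 'e set) \<Rightarrow> bool" where
  "orthogonal_decomposition Q V r P \<longleftrightarrow>
     (\<forall>k\<in>{1..r}. subspace (P k)) \<and>
     span (\<Union>k\<in>{1..r}. P k) = V \<and>
     (\<forall>i\<in>{1..r}. \<forall>j\<in>{1..r}. i \<noteq> j \<longrightarrow> (\<forall>X\<in>P i. \<forall>Y\<in>P j. Q X Y = 0))"

definition proj_along :: "'e::real_vector set \<Rightarrow> 'e set \<Rightarrow> 'e \<Rightarrow> 'e" where
  "proj_along V W X = (THE Y. Y \<in> V \<and> X - Y \<in> W)"

definition trace_on :: "'e::euclidean_space set \<Rightarrow> ('e \<Rightarrow> 'e) \<Rightarrow> real" where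
  "trace_on V f = (let B = (SOME B. independent B \<and> span B = V) in \<Sum>b\<in>B. representation B (f b) b)"

definition invariant_under :: "('h \<Rightarrow> 'e \<Rightarrow> 'e) \<Rightarrow> 'h set \<Rightarrow> 'e set \<Rightarrow> bool" where
  "invariant_under \<rho> H V \<longleftrightarrow> (\<forall>h\<in>H. \<forall>X\<in>V. \<rho> h X \<in> V)"

definition irreducible_under :: "('h \<Rightarrow> 'e::real_vector \<Rightarrow> 'e) \<Rightarrow> 'h set \<Rightarrow> 'e set \<Rightarrow> bool" where
  "irreducible_under \<rho> H V \<longleftrightarrow>
     V \<noteq> {0} \<and> (\<forall>W. subspace W \<and> W \<subseteq> V \<and> invariant_under \<rho> H W \<longrightarrow> W = {0} \<or> W = V)"

definition equivalent_under :: "('h \<Rightarrow> 'e::real_vector \<Rightarrow> 'e) \<Rightarrow> 'h set \<Rightarrow> 'e set \<Rightarrow> 'e set \<Rightarrow> bool" where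
  "equivalent_under \<rho> H V W \<longleftrightarrow>
     (\<exists>T. linear T \<and> bij_betw T V W \<and> (\<forall>h\<in>H. \<forall>X\<in>V. T (\<rho> h X) = \<rho> h (T X)))"


section \<open>Endomorphisms of the reductive complement\<close>

text \<open>
  Throughout, the model space is \<open>\<kk> \<oplus> \<pp>\<close>. An endomorphism of \<open>\<pp>\<close> is represented by its unique
  extension to the whole space vanishing on \<open>\<kk>\<close>, so that \<open>gl(\<pp>)\<close> is a linear subspace of the
  vector space of all endomorphisms. The parameter \<open>ip\<close> is an inner product
  on \<open>\<pp>\<close>; its values off \<open>\<pp>\<close> are irrelevant.
\<close>

definition gl_on :: "'e::euclidean_space set \<Rightarrow> 'e set \<Rightarrow> ('e \<Rightarrow>\<^sub>L 'e) set" where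
  "gl_on \<kk> \<pp> = {A :: 'e \<Rightarrow>\<^sub>L 'e. (\<forall>X. A X \<in> \<pp>) \<and> (\<forall>X\<in>\<kk>. A X = 0)}"

definition transp_on ::
  "'e::euclidean_space set \<Rightarrow> 'e set \<Rightarrow> ('e \<Rightarrow> 'e \<Rightarrow> real) \<Rightarrow> ('e \<Rightarrow>\<^sub>L 'e) \<Rightarrow> ('e \<Rightarrow>\<^sub>L 'e)" where
  "transp_on \<kk> \<pp> ip A = (THE B :: 'e \<Rightarrow>\<^sub>L 'e. B \<in> gl_on \<kk> \<pp> \<and> (\<forall>X\<in>\<pp>. \<forall>Y\<in>\<pp>. ip (A X) Y = ip X (B Y)))"

definition sym_on :: "'e::euclidean_space set \<Rightarrow> 'e set \<Rightarrow> ('e \<Rightarrow> 'e \<Rightarrow> real) \<Rightarrow> ('e \<Rightarrow>\<^sub>L 'e) set" where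
  "sym_on \<kk> \<pp> ip = {A \<in> gl_on \<kk> \<pp>. transp_on \<kk> \<pp> ip A = A}"

definition sym_inv_on ::
  "'e::euclidean_space set \<Rightarrow> 'e set \<Rightarrow> ('e \<Rightarrow> 'e \<Rightarrow> real) \<Rightarrow> ('h \<Rightarrow> 'e \<Rightarrow> 'e) \<Rightarrow> 'h set \<Rightarrow> ('e \<Rightarrow>\<^sub>L 'e) set" where
  "sym_inv_on \<kk> \<pp> ip \<rho> H = {A \<in> sym_on \<kk> \<pp> ip. \<forall>h\<in>H. \<forall>X\<in>\<pp>. \<rho> h (A X) = A (\<rho> h X)}"

definition gl_inner ::
  "'e::euclidean_space set \<Rightarrow> 'e set \<Rightarrow> ('e \<Rightarrow> 'e \<Rightarrow> real) \<Rightarrow> ('e \<Rightarrow>\<^sub>L 'e) \<Rightarrow> ('e \<Rightarrow>\<^sub>L 'e) \<Rightarrow> real" where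
  "gl_inner \<kk> \<pp> ip A B = trace_on \<pp> (A o\<^sub>L transp_on \<kk> \<pp> ip B)"

definition block_id ::
  "'e::euclidean_space set \<Rightarrow> 'e set \<Rightarrow> nat \<Rightarrow> (nat \<Rightarrow> 'e set) \<Rightarrow> nat \<Rightarrow> ('e \<Rightarrow>\<^sub>L 'e)" where
  "block_id \<kk> \<pp> r P k =
     (THE A :: 'e \<Rightarrow>\<^sub>L 'e. A \<in> gl_on \<kk> \<pp> \<and> (\<forall>X\<in>P k. A X = X) \<and>
             (\<forall>i\<in>{1..r}. i \<noteq> k \<longrightarrow> (\<forall>X\<in>P i. A X = 0)))"

text \<open>The inner product \<open>x\<^sub>1 Q|\<pp>\<^sub>1 + \<dots> + x\<^sub>r Q|\<pp>\<^sub>r\<close> on \<open>\<pp>\<close>.\<close>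

definition diag_metric ::
  "'e::euclidean_space set \<Rightarrow> 'e set \<Rightarrow> nat \<Rightarrow> (nat \<Rightarrow> 'e set) \<Rightarrow> ('e \<Rightarrow> 'e \<Rightarrow> real) \<Rightarrow> (nat \<Rightarrow> real) \<Rightarrow>
   'e \<Rightarrow> 'e \<Rightarrow> real" where
  "diag_metric \<kk> \<pp> r P Q x X Y =
     (\<Sum>k=1..r. x k * Q (block_id \<kk> \<pp> r P k X) (block_id \<kk> \<pp> r P k Y))"


section \<open>The operator \<open>L\<^sub>\<pp>\<close>\<close>

definition tensor_inner ::
  "'e::euclidean_space set \<Rightarrow> ('e \<Rightarrow> 'e \<Rightarrow> real) \<Rightarrow> ('e \<Rightarrow> 'e \<Rightarrow> 'e) \<Rightarrow> ('e \<Rightarrow> 'e \<Rightarrow> 'e) \<Rightarrow> real" where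
  "tensor_inner \<pp> ip \<eta> \<nu> =
     (let B = (SOME B. orthonormal_basis ip \<pp> B) in \<Sum>X\<in>B. \<Sum>Y\<in>B. ip (\<eta> X Y) (\<nu> X Y))"

definition gl_theta :: "('e::euclidean_space \<Rightarrow>\<^sub>L 'e) \<Rightarrow> ('e \<Rightarrow> 'e \<Rightarrow> 'e) \<Rightarrow> 'e \<Rightarrow> 'e \<Rightarrow> 'e" where
  "gl_theta A \<eta> X Y = A (\<eta> X Y) - \<eta> (A X) Y - \<eta> X (A Y)"

definition moment_map ::
  "'e::euclidean_space set \<Rightarrow> 'e set \<Rightarrow> ('e \<Rightarrow> 'e \<Rightarrow> real) \<Rightarrow> ('e \<Rightarrow> 'e \<Rightarrow> 'e) \<Rightarrow> ('e \<Rightarrow>\<^sub>L 'e)" where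
  "moment_map \<kk> \<pp> ip \<mu> =
     (THE M. M \<in> sym_on \<kk> \<pp> ip \<and>
        (\<forall>A\<in>gl_on \<kk> \<pp>. gl_inner \<kk> \<pp> ip M A = 1/4 * tensor_inner \<pp> ip (gl_theta A \<mu>) \<mu>))"

definition L_op ::
  "'e::euclidean_space set \<Rightarrow> 'e set \<Rightarrow> ('e \<Rightarrow> 'e \<Rightarrow> real) \<Rightarrow> ('e \<Rightarrow> 'e \<Rightarrow> 'e) \<Rightarrow>
   ('e \<Rightarrow>\<^sub>L 'e) \<Rightarrow> ('e \<Rightarrow>\<^sub>L 'e)" where
  "L_op \<kk> \<pp> ip \<mu> A =
     (THE C. C \<in> sym_on \<kk> \<pp> ip \<and>
        (\<forall>B\<in>sym_on \<kk> \<pp> ip.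
           gl_inner \<kk> \<pp> ip C B =
             1/2 * tensor_inner \<pp> ip (gl_theta A \<mu>) (gl_theta B \<mu>) +
             2 * trace_on \<pp> (moment_map \<kk> \<pp> ip \<mu> o\<^sub>L A o\<^sub>L B)))"

text \<open>
  Entry \<open>(k, m)\<close> of the matrix, with respect to a basis \<open>b 1, \<dots>, b r\<close>, of an operator \<open>F\<close>: the
  coefficient of \<open>b k\<close> in \<open>F (b m)\<close>.
\<close>

definition op_matrix :: "nat \<Rightarrow> (nat \<Rightarrow> 'v::real_vector) \<Rightarrow> ('v \<Rightarrow> 'v) \<Rightarrow> nat \<Rightarrow> nat \<Rightarrow> real" where
  "op_matrix r b F k m = representation (b ` {1..r}) (F (b m)) (b k)"

definition struct_const ::
  "('e \<Rightarrow> 'e \<Rightarrow> real) \<Rightarrow> ('e \<Rightarrow> 'e \<Rightarrow> 'e) \<Rightarrow> (nat \<Rightarrow> 'e set) \<Rightarrow> nat \<Rightarrow> nat \<Rightarrow> nat \<Rightarrow> real" where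
  "struct_const Q br E i j k = (\<Sum>X\<in>E i. \<Sum>Y\<in>E j. \<Sum>Z\<in>E k. (Q (br X Y) Z)\<^sup>2)"

end

theory Submission
  imports Defs
begin

text \<open>
  In a chart \<open>\<phi>\<close> around the identity, \<open>Ad(\<phi>\<^sup>-\<^sup>1 u) Y\<close> is differentiable in \<open>u\<close> at the identity with
  derivative \<open>X \<mapsto> [X, Y]\<close>. Differentiating \<open>Q(Ad Y, Ad Z) = Q(Y, Z)\<close> makes \<open>Q([X, Y], Z)\<close> totally
  skew, so that \<open>[ijk]\<close> is symmetric, and differentiating \<open>Ad(h g h\<^sup>-\<^sup>1) Ad(h) = Ad(h) Ad(g)\<close> in \<open>g\<close>
  makes \<open>Ad(h)\<close> a bracket automorphism, so that \<open>L\<^sub>\<pp>\<close> preserves \<open>sym(\<pp>)\<^sup>H\<close>. By Schur's lemma for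
  symmetric maps, \<open>sym(\<pp>)\<^sup>H\<close> is spanned by the \<open>I\<^sub>k\<close>. On the part of \<open>\<mu>\<^sub>\<pp>\<close> mapping
  \<open>\<pp>\<^sub>a \<times> \<pp>\<^sub>b\<close> to \<open>\<pp>\<^sub>c\<close>, whose squared norm is \<open>x\<^sub>c [abc] / (x\<^sub>a x\<^sub>b)\<close>, the operator \<open>\<theta>(I\<^sub>k)\<close> acts as
  the scalar \<open>t\<^sub>k = \<delta>\<^sub>c\<^sub>k - \<delta>\<^sub>a\<^sub>k - \<delta>\<^sub>b\<^sub>k\<close>. Hence \<open>\<langle>L\<^sub>\<pp> I\<^sub>m, I\<^sub>k\<rangle>\<close> is the sum over \<open>(a, b, c)\<close> of
  these squared norms with weight \<open>t\<^sub>k t\<^sub>m / 2\<close> if \<open>k \<noteq> m\<close>, and \<open>t\<^sub>k (t\<^sub>k + 1) / 2\<close> if \<open>k = m\<close>.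
\<close>

section \<open>Second derivatives\<close>

text \<open>The main obstacle is regularity. \<open>Ad\<close> is defined separately for each group
  element, as a derivative at \<open>e\<close>, so its dependence on that element has to be
  recovered. The invariance of \<open>Q\<close> bounds \<open>Ad\<close> uniformly; in the chart the
  bound gives continuity at \<open>e\<close>, continuity gives differentiability, and the symmetry
  of second derivatives identifies the result with the bracket. The second obstacle is that
  transpose, moment map and \<open>L_op\<close> are definite descriptions, while traces and tensor
  norms use chosen bases. A Riesz theorem on symmetric maps supplies existence, independence of the
  basis makes the values computable, and together they give equivariance under \<open>Ad h\<close>.
  In the final count the diagonal weight has two sources: t^2/2 from the \<theta> term and t/2 from
  the moment map, because \<open>I k\<close> is idempotent. The value t(t + 1)/2 is 1 for t = 1 and
  t = -2 and 0 for t = 0 and t = -1, which singles out the two sums of the diagonal entry.\<close>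

lemma second_difference_mvt:
  fixes f :: "'a::euclidean_space \<Rightarrow> 'b::euclidean_space"
  assumes h: "0 < h"
    and S: "\<And>s t. \<lbrakk>0 \<le> s; s \<le> h; 0 \<le> t; t \<le> h\<rbrakk> \<Longrightarrow> z + s *\<^sub>R v + t *\<^sub>R w \<in> S"
    and f: "\<And>x. x \<in> S \<Longrightarrow> f differentiable at x"
    and Df: "\<And>x. x \<in> S \<Longrightarrow> (\<lambda>x. frechet_derivative f (at x) v) differentiable at x"
  shows "\<exists>\<xi> \<eta>. 0 < \<xi> \<and> \<xi> < h \<and> 0 < \<eta> \<and> \<eta> < h \<and>
     (f (z + h *\<^sub>R v + h *\<^sub>R w) - f (z + h *\<^sub>R v) - f (z + h *\<^sub>R w) + f z) \<bullet> c =
     h * h * (frechet_derivative (\<lambda>x. frechet_derivative f (at x) v)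
       (at (z + \<xi> *\<^sub>R v + \<eta> *\<^sub>R w)) w \<bullet> c)"
proof -
  \<comment> \<open>Pairing with \<open>c\<close> makes the functions scalar, as the mean value
    theorem fails for vector values.\<close>
  have D1: "((\<lambda>s. f (z + s *\<^sub>R v + t *\<^sub>R w) \<bullet> c) has_real_derivative
      frechet_derivative f (at (z + s *\<^sub>R v + t *\<^sub>R w)) v \<bullet> c) (at s)"
    if "0 \<le> s" "s \<le> h" "0 \<le> t" "t \<le> h" for s t
  proof -
    have d: "(f has_derivative frechet_derivative f (at (z + s *\<^sub>R v + t *\<^sub>R w))) (at (z + s *\<^sub>R v + t *\<^sub>R w))"
      using f S that frechet_derivative_works by blast
    interpret linear "frechet_derivative f (at (z + s *\<^sub>R v + t *\<^sub>R w))"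
      using d has_derivative_linear by blast
    have "((\<lambda>s. f (z + s *\<^sub>R v + t *\<^sub>R w)) has_derivative
       (\<lambda>r. frechet_derivative f (at (z + s *\<^sub>R v + t *\<^sub>R w)) (r *\<^sub>R v))) (at s)"
      by (rule has_derivative_compose[where f="\<lambda>s. z + s *\<^sub>R v + t *\<^sub>R w", OF _ d])
        (auto intro!: derivative_eq_intros)
    then have "((\<lambda>s. f (z + s *\<^sub>R v + t *\<^sub>R w) \<bullet> c) has_derivative
       (\<lambda>r. frechet_derivative f (at (z + s *\<^sub>R v + t *\<^sub>R w)) (r *\<^sub>R v) \<bullet> c)) (at s)"
      by (rule has_derivative_inner_left)
    then show ?thesis
      by (simp add: has_field_derivative_def scale mult_commute_abs)
  qed
  have D2: "((\<lambda>t. frechet_derivative f (at (z + s *\<^sub>R v + t *\<^sub>R w)) v \<bullet> c) has_real_derivative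
      frechet_derivative (\<lambda>x. frechet_derivative f (at x) v) (at (z + s *\<^sub>R v + t *\<^sub>R w)) w \<bullet> c) (at t)"
    if "0 \<le> s" "s \<le> h" "0 \<le> t" "t \<le> h" for s t
  proof -
    let ?g = "\<lambda>x. frechet_derivative f (at x) v"
    have d: "(?g has_derivative frechet_derivative ?g (at (z + s *\<^sub>R v + t *\<^sub>R w))) (at (z + s *\<^sub>R v + t *\<^sub>R w))"
      using Df S that frechet_derivative_works by blast
    interpret linear "frechet_derivative ?g (at (z + s *\<^sub>R v + t *\<^sub>R w))"
      using d has_derivative_linear by blast
    have "((\<lambda>t. ?g (z + s *\<^sub>R v + t *\<^sub>R w)) has_derivative
       (\<lambda>r. frechet_derivative ?g (at (z + s *\<^sub>R v + t *\<^sub>R w)) (r *\<^sub>R w))) (at t)"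
      by (rule has_derivative_compose[where f="\<lambda>t. z + s *\<^sub>R v + t *\<^sub>R w", OF _ d])
        (auto intro!: derivative_eq_intros)
    then have "((\<lambda>t. ?g (z + s *\<^sub>R v + t *\<^sub>R w) \<bullet> c) has_derivative
       (\<lambda>r. frechet_derivative ?g (at (z + s *\<^sub>R v + t *\<^sub>R w)) (r *\<^sub>R w) \<bullet> c)) (at t)"
      by (rule has_derivative_inner_left)
    then show ?thesis
      by (simp add: has_field_derivative_def scale mult_commute_abs)
  qed
  \<comment> \<open>The function of \<open>s\<close> is the difference of the values on the two
    sides \<open>t = h\<close> and \<open>t = 0\<close>. The zero multiples are kept so that both
    ends match \<open>D1\<close>.\<close>
  have "\<exists>\<xi>. 0 < \<xi> \<and> \<xi> < h \<and>
     (f (z + h *\<^sub>R v + h *\<^sub>R w) \<bullet> c - f (z + h *\<^sub>R v + 0 *\<^sub>R w) \<bullet> c) -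
       (f (z + 0 *\<^sub>R v + h *\<^sub>R w) \<bullet> c - f (z + 0 *\<^sub>R v + 0 *\<^sub>R w) \<bullet> c) =
     (h - 0) * (frechet_derivative f (at (z + \<xi> *\<^sub>R v + h *\<^sub>R w)) v \<bullet> c
       - frechet_derivative f (at (z + \<xi> *\<^sub>R v + 0 *\<^sub>R w)) v \<bullet> c)"
    by (rule MVT2[OF h]) (use h in \<open>auto intro!: DERIV_diff D1 simp del: scaleR_zero_left\<close>)
  then obtain \<xi> where \<xi>: "0 < \<xi>" "\<xi> < h" and e1: 
     "(f (z + h *\<^sub>R v + h *\<^sub>R w) \<bullet> c - f (z + h *\<^sub>R v + 0 *\<^sub>R w) \<bullet> c) -
       (f (z + 0 *\<^sub>R v + h *\<^sub>R w) \<bullet> c - f (z + 0 *\<^sub>R v + 0 *\<^sub>R w) \<bullet> c) =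
     (h - 0) * (frechet_derivative f (at (z + \<xi> *\<^sub>R v + h *\<^sub>R w)) v \<bullet> c
       - frechet_derivative f (at (z + \<xi> *\<^sub>R v + 0 *\<^sub>R w)) v \<bullet> c)"
    by blast
  have "\<exists>\<eta>. 0 < \<eta> \<and> \<eta> < h \<and>
     frechet_derivative f (at (z + \<xi> *\<^sub>R v + h *\<^sub>R w)) v \<bullet> c
       - frechet_derivative f (at (z + \<xi> *\<^sub>R v + 0 *\<^sub>R w)) v \<bullet> c =
     (h - 0) * (frechet_derivative (\<lambda>x. frechet_derivative f (at x) v)
       (at (z + \<xi> *\<^sub>R v + \<eta> *\<^sub>R w)) w \<bullet> c)"
    by (rule MVT2[OF h]) (use h \<xi> in \<open>auto intro!: D2\<close>)
  then obtain \<eta> where "0 < \<eta>" "\<eta> < h"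
     "frechet_derivative f (at (z + \<xi> *\<^sub>R v + h *\<^sub>R w)) v \<bullet> c
       - frechet_derivative f (at (z + \<xi> *\<^sub>R v + 0 *\<^sub>R w)) v \<bullet> c =
     (h - 0) * (frechet_derivative (\<lambda>x. frechet_derivative f (at x) v)
       (at (z + \<xi> *\<^sub>R v + \<eta> *\<^sub>R w)) w \<bullet> c)"
    by blast
  with \<xi> e1 show ?thesis
    by (intro exI[of _ \<xi>] exI[of _ \<eta>]) (simp add: inner_diff_left inner_add_left)
qed

text \<open>The second difference over the parallelogram spanned by \<open>h v\<close> and
  \<open>h w\<close> does not depend on the order of \<open>v\<close> and \<open>w\<close>. Divided
  by the square of \<open>h\<close> and paired with \<open>c\<close>, it is a nearby value of either
  mixed derivative, so continuity forces agreement. One small \<open>h\<close>, set against an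
  assumed gap, does the work of a limit.\<close>

lemma mixed_derivatives_commute:
  fixes f :: "'a::euclidean_space \<Rightarrow> 'b::euclidean_space"
  assumes S: "open S" "z \<in> S" and f: "Ck_on 2 f S"
  shows "frechet_derivative (\<lambda>x. frechet_derivative f (at x) v) (at z) w =
    frechet_derivative (\<lambda>x. frechet_derivative f (at x) w) (at z) v"
proof -
  let ?D = "\<lambda>v w x. frechet_derivative (\<lambda>x. frechet_derivative f (at x) v) (at x) w"
  have f1: "f differentiable at x" and f2: "(\<lambda>x. frechet_derivative f (at x) v) differentiable at x"
    and f3: "continuous_on S (?D v w)" if "x \<in> S" for x v w
    using f that by (auto simp: numeral_2_eq_2)
  have aux: "\<lbrakk>a = b; \<bar>a - p\<bar> < \<bar>p - q\<bar> / 2; \<bar>b - q\<bar> < \<bar>p - q\<bar> / 2\<rbrakk> \<Longrightarrow> False" for a b p q :: real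
    by (smt (verit) field_sum_of_halves)
  have "?D v w z \<bullet> c = ?D w v z \<bullet> c" for c
  proof (rule ccontr)
    assume ne: "?D v w z \<bullet> c \<noteq> ?D w v z \<bullet> c"
    have cont: "isCont (\<lambda>x. ?D v w x \<bullet> c) z" "isCont (\<lambda>x. ?D w v x \<bullet> c) z"
      using f3 S by (auto simp: continuous_on_eq_continuous_at intro!: continuous_intros)
    define e where "e = \<bar>?D v w z \<bullet> c - ?D w v z \<bullet> c\<bar> / 2"
    have e: "e > 0" using ne by (simp add: e_def)
    obtain \<delta> where d0: "\<delta> > 0" "ball z \<delta> \<subseteq> S"
      using S open_contains_ball by blast
    obtain d1 where d1: "d1 > 0" "\<And>x. dist x z < d1 \<Longrightarrow> \<bar>?D v w x \<bullet> c - ?D v w z \<bullet> c\<bar> < e"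
      using cont(1) e unfolding continuous_at_eps_delta by (auto simp: dist_real_def)
    obtain d2 where d2: "d2 > 0" "\<And>x. dist x z < d2 \<Longrightarrow> \<bar>?D w v x \<bullet> c - ?D w v z \<bullet> c\<bar> < e"
      using cont(2) e unfolding continuous_at_eps_delta by (auto simp: dist_real_def)
    define d where "d = min \<delta> (min d1 d2)"
    have d: "d > 0" using d0 d1 d2 by (simp add: d_def)
    \<comment> \<open>With this \<open>h\<close> the whole parallelogram lies within
      \<open>d\<close> of \<open>z\<close>; the summand 1 keeps the denominator positive when
      \<open>v = w = 0\<close>.\<close>
    define h where "h = d / (2 * (norm v + norm w + 1))"
    have h: "h > 0" unfolding h_def using d by (intro divide_pos_pos mult_pos_pos add_nonneg_pos) auto
    have hd: "h * norm v + h * norm w < d"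
    proof -
      have "h * norm v + h * norm w \<le> h * (norm v + norm w + 1)" using h by (simp add: algebra_simps)
      also have "\<dots> = d / 2"
      proof -
        have "norm v + norm w + 1 > 0" by (intro add_nonneg_pos) auto
        then show ?thesis unfolding h_def by (simp add: field_simps)
      qed
      finally show ?thesis using d by simp
    qed
    have near: "dist (z + s *\<^sub>R v + t *\<^sub>R w) z < d" if "0 \<le> s" "s \<le> h" "0 \<le> t" "t \<le> h" for s t
    proof -
      have "norm (s *\<^sub>R v + t *\<^sub>R w) \<le> s * norm v + t * norm w"
        by (rule norm_triangle_le) (use that in auto)
      also have "\<dots> \<le> h * norm v + h * norm w"
        using that by (intro add_mono mult_right_mono) auto
      finally show ?thesis using hd by (simp add: dist_norm add.assoc)
    qed
    have inS: "z + s *\<^sub>R v + t *\<^sub>R w \<in> S" if "0 \<le> s" "s \<le> h" "0 \<le> t" "t \<le> h" for s t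
      using near[OF that] d0 unfolding d_def by (auto simp: dist_commute)
    obtain s t where st: "0 < s" "s < h" "0 < t" "t < h" and
      1: "(f (z + h *\<^sub>R v + h *\<^sub>R w) - f (z + h *\<^sub>R v) - f (z + h *\<^sub>R w) + f z) \<bullet> c =
        h * h * (?D v w (z + s *\<^sub>R v + t *\<^sub>R w) \<bullet> c)"
      using second_difference_mvt[OF h inS f1 f2] by blast
    have inS': "z + s *\<^sub>R w + t *\<^sub>R v \<in> S" if "0 \<le> s" "s \<le> h" "0 \<le> t" "t \<le> h" for s t
      using inS[OF that(3,4) that(1,2)] by (simp add: ac_simps)
    obtain s' t' where st': "0 < s'" "s' < h" "0 < t'" "t' < h" and
      2: "(f (z + h *\<^sub>R w + h *\<^sub>R v) - f (z + h *\<^sub>R w) - f (z + h *\<^sub>R v) + f z) \<bullet> c =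
        h * h * (?D w v (z + s' *\<^sub>R w + t' *\<^sub>R v) \<bullet> c)"
      using second_difference_mvt[OF h inS' f1 f2] by blast
    have "h * h * (?D v w (z + s *\<^sub>R v + t *\<^sub>R w) \<bullet> c) = h * h * (?D w v (z + s' *\<^sub>R w + t' *\<^sub>R v) \<bullet> c)"
      unfolding 1[symmetric] 2[symmetric] by (simp add: algebra_simps)
    then have "?D v w (z + s *\<^sub>R v + t *\<^sub>R w) \<bullet> c = ?D w v (z + s' *\<^sub>R w + t' *\<^sub>R v) \<bullet> c"
      using h by simp
    moreover have "\<bar>?D v w (z + s *\<^sub>R v + t *\<^sub>R w) \<bullet> c - ?D v w z \<bullet> c\<bar> < e"
      by (rule d1) (use near[of s t] st in \<open>auto simp: d_def\<close>)
    moreover have "\<bar>?D w v (z + s' *\<^sub>R w + t' *\<^sub>R v) \<bullet> c - ?D w v z \<bullet> c\<bar> < e"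
      by (rule d2) (use near[of t' s'] st' in \<open>auto simp: d_def ac_simps\<close>)
    ultimately show False using aux unfolding e_def by blast
  qed
  then show ?thesis by (rule euclidean_eqI)
qed

text \<open>A product rule in which the scalar factor is only continuous: \<open>f x\<close> is of
  order \<open>norm (x - z)\<close>, so \<open>(s x - s z) *\<^sub>R f x\<close> is of smaller
  order. It is needed for the coordinates of \<open>Ad\<close>, at a stage where only their
  continuity is known.\<close>

lemma has_derivative_scaleR_vanishing:
  fixes s :: "'a::euclidean_space \<Rightarrow> real" and f :: "'a \<Rightarrow> 'b::euclidean_space"
  assumes s: "isCont s z" and f: "(f has_derivative f') (at z)" and z: "f z = 0"
  shows "((\<lambda>x. s x *\<^sub>R f x) has_derivative (\<lambda>y. s z *\<^sub>R f' y)) (at z)"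
proof -
  obtain C where C: "C > 0" and lin: "\<forall>\<^sub>F x in at z. norm (f x) \<le> C * norm (x - z)"
  proof -
    interpret bounded_linear f' using f has_derivative_bounded_linear by blast
    obtain B where B: "\<And>x. norm (f' x) \<le> norm x * B" "B > 0" using pos_bounded by blast
    have "\<exists>d>0. \<forall>y. norm (y - z) < d \<longrightarrow> norm (f y - f z - f' (y - z)) \<le> 1 * norm (y - z)"
      using f[unfolded has_derivative_at_alt] zero_less_one by blast
    then obtain d where d: "d > 0"
      "\<And>y. norm (y - z) < d \<Longrightarrow> norm (f y - f z - f' (y - z)) \<le> 1 * norm (y - z)" by blast
    have "norm (f y) \<le> (B + 1) * norm (y - z)" if "norm (y - z) < d" for y
    proof -
      have "norm (f y) \<le> norm (f y - f z - f' (y - z)) + norm (f' (y - z))"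
        using norm_triangle_sub[of "f y" "f' (y - z)"] z by (simp add: add.commute)
      also have "\<dots> \<le> (B + 1) * norm (y - z)" using d(2)[OF that] B(1)[of "y - z"] by (simp add: algebra_simps)
      finally show ?thesis .
    qed
    then have "\<forall>\<^sub>F x in at z. norm (f x) \<le> (B + 1) * norm (x - z)"
      unfolding eventually_at using d(1) by (auto simp: dist_norm)
    then show thesis using B(2) that[of "B + 1"] by simp
  qed
  have "((\<lambda>x. (s x - s z) *\<^sub>R f x) has_derivative (\<lambda>y. 0)) (at z)"
    unfolding has_derivative_at2
  proof (intro conjI)
    show "bounded_linear (\<lambda>y::'a. 0::'b)" by simp
    have "((\<lambda>y. \<bar>s y - s z\<bar> * C) \<longlongrightarrow> \<bar>s z - s z\<bar> * C) (at z)"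
      using s unfolding isCont_def by (intro tendsto_intros)
    then have lim: "((\<lambda>y. \<bar>s y - s z\<bar> * C) \<longlongrightarrow> 0) (at z)" by simp
    show "((\<lambda>y. (1 / norm (y - z)) *\<^sub>R ((s y - s z) *\<^sub>R f y - ((s z - s z) *\<^sub>R f z + 0))) \<longlongrightarrow> 0) (at z)"
    proof (rule Lim_null_comparison[OF _ lim])
      show "\<forall>\<^sub>F y in at z. norm ((1 / norm (y - z)) *\<^sub>R ((s y - s z) *\<^sub>R f y - ((s z - s z) *\<^sub>R f z + 0))) \<le> \<bar>s y - s z\<bar> * C"
        using lin
      proof (eventually_elim)
        case (elim y)
        show ?case
        proof (cases "y = z")
          case False
          have "\<bar>s y - s z\<bar> * norm (f y) \<le> \<bar>s y - s z\<bar> * (C * norm (y - z))"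
            using elim by (intro mult_left_mono) auto
          then show ?thesis using False by (simp add: divide_simps mult_ac z del: scaleR_left_diff_distrib)
        qed (use C in auto)
      qed
    qed
  qed
  moreover have "((\<lambda>x. s z *\<^sub>R f x) has_derivative (\<lambda>y. s z *\<^sub>R f' y)) (at z)"
    using f by (rule has_derivative_scaleR_right)
  ultimately have "((\<lambda>x. (s x - s z) *\<^sub>R f x + s z *\<^sub>R f x) has_derivative (\<lambda>y. 0 + s z *\<^sub>R f' y)) (at z)"
    by (rule has_derivative_add)
  then show ?thesis by (simp add: scaleR_diff_left)
qed

lemma has_derivative_eventually_eq:
  assumes "(f has_derivative D) (at x)" "\<forall>\<^sub>F y in nhds x. f y = g y"
  shows "(g has_derivative D) (at x)"
  using assms by (auto simp: eventually_nhds_conv_at intro: has_derivative_transform_eventually)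

section \<open>The adjoint representation in a chart\<close>

lemma is_chartD:
  assumes "is_chart T U \<phi>"
  shows "openin T U" "inj_on \<phi> U" "open (\<phi> ` U)"
    "openin T W \<Longrightarrow> W \<subseteq> U \<Longrightarrow> open (\<phi> ` W)"
proof -
  show U: "openin T U" and V: "open (\<phi> ` U)" using assms by (auto simp: is_chart_def)
  have h: "homeomorphic_map (subtopology T U) (top_of_set (\<phi> ` U)) \<phi>"
    using assms by (auto simp: is_chart_def)
  have "U \<subseteq> topspace T" using U openin_subset by blast
  with homeomorphic_imp_injective_map[OF h] show "inj_on \<phi> U"
    by (simp add: Int_absorb1)
  assume W: "openin T W" "W \<subseteq> U"
  then have "openin (subtopology T U) W" using U openin_open_subtopology by blast
  then have "openin (top_of_set (\<phi> ` U)) (\<phi> ` W)"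
    using homeomorphic_imp_open_map[OF h] unfolding open_map_def by blast
  then show "open (\<phi> ` W)" using V openin_open_eq by blast
qed

lemma open_map_prod_chart_image:
  assumes "is_chart S U \<phi>" "is_chart T V \<psi>" and Z: "openin (prod_topology S T) Z" "Z \<subseteq> U \<times> V"
  shows "open (map_prod \<phi> \<psi> ` Z)"
  unfolding open_prod_def
proof
  fix z assume "z \<in> map_prod \<phi> \<psi> ` Z"
  then obtain p q where pq: "(p, q) \<in> Z" "z = (\<phi> p, \<psi> q)" by auto
  obtain O1 O2 where O: "openin S O1" "openin T O2" "p \<in> O1" "q \<in> O2" "O1 \<times> O2 \<subseteq> Z"
    using Z(1) pq(1) unfolding openin_prod_topology_alt by metis
  then have "O1 \<times> O2 \<subseteq> U \<times> V" using Z(2) by blast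
  with O have "O1 \<subseteq> U" "O2 \<subseteq> V" by blast+
  with O have "open (\<phi> ` O1)" "open (\<psi> ` O2)" using is_chartD assms by blast+
  moreover have "z \<in> \<phi> ` O1 \<times> \<psi> ` O2" using O pq by auto
  moreover have "\<phi> ` O1 \<times> \<psi> ` O2 \<subseteq> map_prod \<phi> \<psi> ` Z" using O(5) by force
  ultimately show "\<exists>A B. open A \<and> open B \<and> z \<in> A \<times> B \<and> A \<times> B \<subseteq> map_prod \<phi> \<psi> ` Z"
    by blast
qed

lemma smooth_onD:
  assumes "smooth_on f S" "x \<in> S"
  shows "f differentiable at x" "(\<lambda>x. frechet_derivative f (at x) v) differentiable at x"
    "Ck_on 2 f S"
proof -
  have c: "Ck_on 1 f S" "Ck_on 2 f S" using assms by (auto simp: smooth_on_def)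
  then show "f differentiable at x" "(\<lambda>x. frechet_derivative f (at x) v) differentiable at x" "Ck_on 2 f S"
    using assms(2) by (auto simp: numeral_2_eq_2)
qed

lemma lie_group_mult_in_charts:
  assumes G: "lie_group G T A"
    and c: "(U1, \<phi>1) \<in> A" "(U2, \<phi>2) \<in> A" "(U3, \<phi>3) \<in> A"
    and g: "g \<in> U1" and h: "h \<in> U2" and gh: "g \<otimes>\<^bsub>G\<^esub> h \<in> U3"
  obtains m W where "open W" "(\<phi>1 g, \<phi>2 h) \<in> W" "smooth_on m W"
    "W = {(\<phi>1 a, \<phi>2 b) | a b. a \<in> U1 \<and> b \<in> U2 \<and> a \<otimes>\<^bsub>G\<^esub> b \<in> U3}"
    "\<And>a b. a \<in> U1 \<Longrightarrow> b \<in> U2 \<Longrightarrow> m (\<phi>1 a, \<phi>2 b) = \<phi>3 (a \<otimes>\<^bsub>G\<^esub> b)"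
proof -
  let ?\<mu> = "\<lambda>(x, y). x \<otimes>\<^bsub>G\<^esub> y"
  have sm: "smooth_map (prod_topology T T) (prod_atlas A A) T A ?\<mu>"
    and ch: "is_chart T U1 \<phi>1" "is_chart T U2 \<phi>2" "is_chart T U3 \<phi>3"
    using G c unfolding lie_group_def smooth_manifold_def by auto
  have "(U1 \<times> U2, map_prod \<phi>1 \<phi>2) \<in> prod_atlas A A"
    using c unfolding prod_atlas_def by blast
  with sm c(3) have s: "smooth_on (\<lambda>u. \<phi>3 (?\<mu> (inv_into (U1 \<times> U2) (map_prod \<phi>1 \<phi>2) u)))
     (map_prod \<phi>1 \<phi>2 ` {x \<in> U1 \<times> U2. ?\<mu> x \<in> U3})" (is "smooth_on ?m ?W")
    unfolding smooth_map_def by blast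
  have o: "openin (prod_topology T T) {x \<in> U1 \<times> U2. ?\<mu> x \<in> U3}"
  proof -
    have "openin (prod_topology T T) {x \<in> topspace (prod_topology T T). ?\<mu> x \<in> U3}"
      using sm is_chartD(1)[OF ch(3)] unfolding smooth_map_def
      by (intro openin_continuous_map_preimage) auto
    moreover have "openin (prod_topology T T) (U1 \<times> U2)"
      using is_chartD(1) ch openin_prod_Times_iff by blast
    ultimately have "openin (prod_topology T T)
       ((U1 \<times> U2) \<inter> {x \<in> topspace (prod_topology T T). ?\<mu> x \<in> U3})" by (rule openin_Int[rotated])
    moreover have "(U1 \<times> U2) \<inter> {x \<in> topspace (prod_topology T T). ?\<mu> x \<in> U3} =
        {x \<in> U1 \<times> U2. ?\<mu> x \<in> U3}"
      using is_chartD(1)[OF ch(1)] is_chartD(1)[OF ch(2)] openin_subset by fastforce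
    ultimately show ?thesis by simp
  qed
  have inj: "inj_on (map_prod \<phi>1 \<phi>2) (U1 \<times> U2)"
    using is_chartD(2)[OF ch(1)] is_chartD(2)[OF ch(2)] by (rule map_prod_inj_on)
  show thesis
  proof
    show "open ?W" by (rule open_map_prod_chart_image[OF ch(1,2) o]) auto
    show "smooth_on ?m ?W" by (rule s)
    show "?W = {(\<phi>1 a, \<phi>2 b) | a b. a \<in> U1 \<and> b \<in> U2 \<and> a \<otimes>\<^bsub>G\<^esub> b \<in> U3}" by force
    show "(\<phi>1 g, \<phi>2 h) \<in> ?W" using g h gh by force
    show "?m (\<phi>1 a, \<phi>2 b) = \<phi>3 (a \<otimes>\<^bsub>G\<^esub> b)" if "a \<in> U1" "b \<in> U2" for a b
      using inv_into_f_f[OF inj, of "(a, b)"] that by simp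
  qed
qed

section \<open>Conjugation, \<open>Ad\<close> and tangent spaces of subgroups in a chart around the
  identity\<close>

locale lie_group_chart =
  fixes G :: "'g monoid" and T :: "'g topology" and A :: "('g, 'e::euclidean_space) atlas"
    and U :: "'g set" and \<phi> :: "'g \<Rightarrow> 'e"
  assumes lie: "lie_group G T A" and chart: "(U, \<phi>) \<in> A" and one_in: "\<one>\<^bsub>G\<^esub> \<in> U"
begin

sublocale group G using lie by (simp add: lie_group_def)

abbreviation "\<psi> \<equiv> inv_into U \<phi>"
abbreviation "e \<equiv> \<phi> \<one>\<^bsub>G\<^esub>"

definition conj_chart :: "'g \<Rightarrow> 'e \<Rightarrow> 'e" where
  "conj_chart g v = \<phi> (g \<otimes>\<^bsub>G\<^esub> \<psi> v \<otimes>\<^bsub>G\<^esub> inv\<^bsub>G\<^esub> g)"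

lemma is_chart: "is_chart T U \<phi>"
  using lie chart by (auto simp: lie_group_def smooth_manifold_def)

lemma topspace: "topspace T = carrier G"
  using lie by (simp add: lie_group_def)

lemma U_carrier: "g \<in> U \<Longrightarrow> g \<in> carrier G"
  using is_chartD(1)[OF is_chart] openin_subset topspace by blast

lemma \<psi>_\<phi> [simp]: "g \<in> U \<Longrightarrow> \<psi> (\<phi> g) = g"
  using is_chartD(2)[OF is_chart] by simp

lemma \<phi>_\<psi> [simp]: "u \<in> \<phi> ` U \<Longrightarrow> \<phi> (\<psi> u) = u"
  by (rule f_inv_into_f)

lemma \<psi>_in [simp]: "u \<in> \<phi> ` U \<Longrightarrow> \<psi> u \<in> U"
  by (rule inv_into_into)

lemma e_in [simp]: "e \<in> \<phi> ` U" using one_in by blast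

lemma \<psi>_e [simp]: "\<psi> e = \<one>\<^bsub>G\<^esub>" using one_in by simp

lemma conj_chart_e [simp]: "g \<in> carrier G \<Longrightarrow> conj_chart g e = e"
  by (simp add: conj_chart_def)

lemma continuous_map_mult:
  "continuous_map (prod_topology T T) T (\<lambda>(x, y). x \<otimes>\<^bsub>G\<^esub> y)"
  using lie by (simp add: lie_group_def smooth_map_def)

lemma continuous_map_mult2:
  assumes "continuous_map X T f" "continuous_map X T g"
  shows "continuous_map X T (\<lambda>x. f x \<otimes>\<^bsub>G\<^esub> g x)"
proof -
  have "continuous_map X (prod_topology T T) (\<lambda>x. (f x, g x))"
    using assms by (simp add: continuous_map_pairedI)
  from continuous_map_compose[OF this continuous_map_mult] show ?thesis by (simp add: o_def)
qed

lemma eventually_chart: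
  assumes f: "continuous_map T T f" "f \<one>\<^bsub>G\<^esub> \<in> V" and V: "openin T V"
  shows "\<forall>\<^sub>F v in nhds e. v \<in> \<phi> ` U \<and> f (\<psi> v) \<in> V"
proof -
  let ?S = "U \<inter> {x \<in> topspace T. f x \<in> V}"
  have "openin T ?S"
    using f V is_chartD(1)[OF is_chart] by (intro openin_Int openin_continuous_map_preimage)
  then have "open (\<phi> ` ?S)" using is_chartD(4)[OF is_chart] by blast
  moreover have "e \<in> \<phi> ` ?S" using one_in f topspace by auto
  ultimately have "\<forall>\<^sub>F v in nhds e. v \<in> \<phi> ` ?S" by (rule eventually_nhds_in_open)
  then show ?thesis by (rule eventually_mono) auto
qed

lemma eventually_conj_chart:
  assumes "g \<in> carrier G"
  shows "\<forall>\<^sub>F v in nhds e. v \<in> \<phi> ` U \<and> g \<otimes>\<^bsub>G\<^esub> \<psi> v \<otimes>\<^bsub>G\<^esub> inv\<^bsub>G\<^esub> g \<in> U"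
  using assms one_in topspace
  by (intro eventually_chart continuous_map_mult2 is_chartD(1)[OF is_chart]) (auto simp: continuous_map_const)

lemma obtain_chart:
  assumes "g \<in> carrier G"
  obtains V \<phi>' where "(V, \<phi>') \<in> A" "g \<in> V"
proof -
  have "(\<Union>(U, \<phi>)\<in>A. U) = carrier G"
    using lie topspace by (simp add: lie_group_def smooth_manifold_def)
  with assms show thesis using that by blast
qed

text \<open>Neither \<open>g\<close> nor its inverse need lie in \<open>U\<close>, so conjugation is
  factored into two multiplications, through a chart at \<open>g\<close> and a chart at the inverse
  of \<open>g\<close>.\<close>

lemma conj_chart_differentiable:
  assumes g: "g \<in> carrier G"
  shows "conj_chart g differentiable at e"
proof -
  obtain V1 \<phi>1 where V1: "(V1, \<phi>1) \<in> A" "g \<in> V1" using obtain_chart g by blast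
  obtain V2 \<phi>2 where V2: "(V2, \<phi>2) \<in> A" "inv\<^bsub>G\<^esub> g \<in> V2" using obtain_chart g inv_closed by blast
  obtain m W where W: "open W" "(\<phi>1 g, e) \<in> W" "smooth_on m W"
    "\<And>a b. a \<in> V1 \<Longrightarrow> b \<in> U \<Longrightarrow> m (\<phi>1 a, \<phi> b) = \<phi>1 (a \<otimes>\<^bsub>G\<^esub> b)"
    by (rule lie_group_mult_in_charts[OF lie V1(1) chart V1(1) V1(2) one_in])
       (use g V1 in auto)
  obtain m' W' where W': "open W'" "(\<phi>1 g, \<phi>2 (inv\<^bsub>G\<^esub> g)) \<in> W'" "smooth_on m' W'"
    "\<And>a b. a \<in> V1 \<Longrightarrow> b \<in> V2 \<Longrightarrow> m' (\<phi>1 a, \<phi>2 b) = \<phi> (a \<otimes>\<^bsub>G\<^esub> b)"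
    by (rule lie_group_mult_in_charts[OF lie V1(1) V2(1) chart V1(2) V2(2)])
       (use g one_in in auto)
  have d: "m differentiable at (\<phi>1 g, e)" "m' differentiable at (\<phi>1 g, \<phi>2 (inv\<^bsub>G\<^esub> g))"
    using W W' smooth_onD(1) by blast+
  have m1: "m (\<phi>1 g, e) = \<phi>1 g" using W(4)[OF V1(2) one_in] g by simp
  have "(\<lambda>v. m (\<phi>1 g, v)) differentiable at e"
    by (rule differentiable_compose[of m "\<lambda>v. (\<phi>1 g, v)"])
       (use d in \<open>auto intro!: differentiable_Pair\<close>)
  then have "(\<lambda>v. m' (m (\<phi>1 g, v), \<phi>2 (inv\<^bsub>G\<^esub> g))) differentiable at e"
    using d(2) m1
    by (intro differentiable_compose[of m' "\<lambda>v. (m (\<phi>1 g, v), \<phi>2 (inv\<^bsub>G\<^esub> g))"] differentiable_Pair) auto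
  then obtain D where D: "((\<lambda>v. m' (m (\<phi>1 g, v), \<phi>2 (inv\<^bsub>G\<^esub> g))) has_derivative D) (at e)"
    by (auto simp: differentiable_def)
  have "openin T V1"
    using V1 lie is_chartD(1) by (fastforce simp: lie_group_def smooth_manifold_def)
  then have "\<forall>\<^sub>F v in nhds e. v \<in> \<phi> ` U \<and> g \<otimes>\<^bsub>G\<^esub> \<psi> v \<in> V1"
    using g V1 topspace by (intro eventually_chart continuous_map_mult2) (auto simp: continuous_map_const)
  then have "\<forall>\<^sub>F v in nhds e. m' (m (\<phi>1 g, v), \<phi>2 (inv\<^bsub>G\<^esub> g)) = conj_chart g v"
  proof (rule eventually_mono)
    fix v assume v: "v \<in> \<phi> ` U \<and> g \<otimes>\<^bsub>G\<^esub> \<psi> v \<in> V1"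
    then have "m (\<phi>1 g, v) = \<phi>1 (g \<otimes>\<^bsub>G\<^esub> \<psi> v)" using W(4)[OF V1(2), of "\<psi> v"] by simp
    then show "m' (m (\<phi>1 g, v), \<phi>2 (inv\<^bsub>G\<^esub> g)) = conj_chart g v"
      using W'(4)[OF _ V2(2)] v by (simp add: conj_chart_def)
  qed
  then have ev: "\<forall>\<^sub>F v in at e within UNIV. m' (m (\<phi>1 g, v), \<phi>2 (inv\<^bsub>G\<^esub> g)) = conj_chart g v"
    and eq: "m' (m (\<phi>1 g, e), \<phi>2 (inv\<^bsub>G\<^esub> g)) = conj_chart g e"
    by (auto simp: eventually_nhds_conv_at)
  have "(conj_chart g has_derivative D) (at e)"
    by (rule has_derivative_transform_eventually[OF D ev eq]) simp
  then show ?thesis by (auto simp: differentiable_def)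
qed

abbreviation "Ad \<equiv> Ad_map G U \<phi>"
abbreviation "br \<equiv> lie_bracket G U \<phi>"

lemma Ad_eq: "Ad g = frechet_derivative (conj_chart g) (at e)"
  unfolding Ad_map_def conj_chart_def ..

lemma Ad_has_derivative: "g \<in> carrier G \<Longrightarrow> (conj_chart g has_derivative Ad g) (at e)"
  using conj_chart_differentiable Ad_eq frechet_derivative_works by metis

text \<open>The composition law for \<open>conj_chart\<close> is available only near
  \<open>e\<close>, where conjugation by \<open>h\<close> stays inside the chart; the chain rule
  needs no more.\<close>

lemma Ad_mult:
  assumes g: "g \<in> carrier G" and h: "h \<in> carrier G"
  shows "Ad (g \<otimes>\<^bsub>G\<^esub> h) Y = Ad g (Ad h Y)"
proof -
  have "((\<lambda>v. conj_chart g (conj_chart h v)) has_derivative (\<lambda>Y. Ad g (Ad h Y))) (at e)"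
    by (rule has_derivative_compose[of "conj_chart h", OF Ad_has_derivative[OF h]])
       (simp add: h Ad_has_derivative[OF g])
  moreover have "\<forall>\<^sub>F v in nhds e. conj_chart g (conj_chart h v) = conj_chart (g \<otimes>\<^bsub>G\<^esub> h) v"
    using eventually_conj_chart[OF h]
  proof (rule eventually_mono)
    fix v assume v: "v \<in> \<phi> ` U \<and> h \<otimes>\<^bsub>G\<^esub> \<psi> v \<otimes>\<^bsub>G\<^esub> inv\<^bsub>G\<^esub> h \<in> U"
    then have "\<psi> v \<in> carrier G" using U_carrier by simp
    then show "conj_chart g (conj_chart h v) = conj_chart (g \<otimes>\<^bsub>G\<^esub> h) v"
      using v g h by (simp add: conj_chart_def inv_mult_group m_assoc)
  qed
  ultimately have "(conj_chart (g \<otimes>\<^bsub>G\<^esub> h) has_derivative (\<lambda>Y. Ad g (Ad h Y))) (at e)"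
    by (rule has_derivative_eventually_eq)
  with Ad_has_derivative[of "g \<otimes>\<^bsub>G\<^esub> h"] g h show ?thesis
    using has_derivative_unique by (metis m_closed)
qed

lemma Ad_one: "Ad \<one>\<^bsub>G\<^esub> Y = Y"
proof -
  have "\<forall>\<^sub>F v in nhds e. v = conj_chart \<one>\<^bsub>G\<^esub> v"
    using eventually_conj_chart[OF one_closed]
  proof (rule eventually_mono)
    fix v assume v: "v \<in> \<phi> ` U \<and> \<one>\<^bsub>G\<^esub> \<otimes>\<^bsub>G\<^esub> \<psi> v \<otimes>\<^bsub>G\<^esub> inv\<^bsub>G\<^esub> \<one>\<^bsub>G\<^esub> \<in> U"
    then have "\<psi> v \<in> carrier G" using U_carrier \<psi>_in by blast
    then show "v = conj_chart \<one>\<^bsub>G\<^esub> v" using v by (simp add: conj_chart_def)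
  qed
  with has_derivative_ident have "(conj_chart \<one>\<^bsub>G\<^esub> has_derivative (\<lambda>x. x)) (at e)"
    by (rule has_derivative_eventually_eq)
  from has_derivative_unique[OF this Ad_has_derivative[OF one_closed]] show ?thesis
    by (simp add: fun_eq_iff)
qed

lemma obtain_mult:
  obtains m W where "open W" "smooth_on m W"
    "\<And>u. u \<in> \<phi> ` U \<Longrightarrow> (u, e) \<in> W" "\<And>u. u \<in> \<phi> ` U \<Longrightarrow> (e, u) \<in> W"
    "\<And>u. u \<in> \<phi> ` U \<Longrightarrow> m (u, e) = u" "\<And>u. u \<in> \<phi> ` U \<Longrightarrow> m (e, u) = u"
    "\<And>a b. a \<in> U \<Longrightarrow> b \<in> U \<Longrightarrow> (\<phi> a, \<phi> b) \<in> W \<longleftrightarrow> a \<otimes>\<^bsub>G\<^esub> b \<in> U"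
    "\<And>a b. a \<in> U \<Longrightarrow> b \<in> U \<Longrightarrow> m (\<phi> a, \<phi> b) = \<phi> (a \<otimes>\<^bsub>G\<^esub> b)"
    "\<And>z. z \<in> W \<Longrightarrow> (m has_derivative frechet_derivative m (at z)) (at z)"
    "\<And>z v. z \<in> W \<Longrightarrow> ((\<lambda>z. frechet_derivative m (at z) v) has_derivative
        frechet_derivative (\<lambda>z. frechet_derivative m (at z) v) (at z)) (at z)"
proof -
  have gh: "\<one>\<^bsub>G\<^esub> \<otimes>\<^bsub>G\<^esub> \<one>\<^bsub>G\<^esub> \<in> U" using one_in by simp
  have inj: "\<phi> a = \<phi> b \<longleftrightarrow> a = b" if "a \<in> U" "b \<in> U" for a b
    using that is_chartD(2)[OF is_chart] by (auto dest: inj_onD)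
  obtain m W where W: "open W" "(e, e) \<in> W" "smooth_on m W"
    "W = {(\<phi> a, \<phi> b) | a b. a \<in> U \<and> b \<in> U \<and> a \<otimes>\<^bsub>G\<^esub> b \<in> U}"
    "\<And>a b. a \<in> U \<Longrightarrow> b \<in> U \<Longrightarrow> m (\<phi> a, \<phi> b) = \<phi> (a \<otimes>\<^bsub>G\<^esub> b)"
    by (rule lie_group_mult_in_charts[OF lie chart chart chart one_in one_in gh]) blast
  show thesis
  proof (rule that[OF W(1,3) _ _ _ _ _ W(5)])
    show "(u, e) \<in> W" "(e, u) \<in> W" "m (u, e) = u" "m (e, u) = u" if "u \<in> \<phi> ` U" for u
    proof -
      have "\<psi> u \<in> U" "\<phi> (\<psi> u) = u" "\<psi> u \<in> carrier G" using that U_carrier by auto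
      moreover from this have "(\<phi> (\<psi> u), e) \<in> W" "(e, \<phi> (\<psi> u)) \<in> W"
        unfolding W(4) using one_in by (fastforce simp del: \<phi>_\<psi>)+
      ultimately show "(u, e) \<in> W" "(e, u) \<in> W" "m (u, e) = u" "m (e, u) = u"
        using one_in W(5)[of "\<psi> u" "\<one>\<^bsub>G\<^esub>"] W(5)[of "\<one>\<^bsub>G\<^esub>" "\<psi> u"] by auto
    qed
    show "(\<phi> a, \<phi> b) \<in> W \<longleftrightarrow> a \<otimes>\<^bsub>G\<^esub> b \<in> U" if "a \<in> U" "b \<in> U" for a b
      using that inj unfolding W(4) by auto
    show "(m has_derivative frechet_derivative m (at z)) (at z)"
      "((\<lambda>z. frechet_derivative m (at z) v) has_derivative
        frechet_derivative (\<lambda>z. frechet_derivative m (at z) v) (at z)) (at z)" if "z \<in> W" for z v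
      using smooth_onD(1,2)[OF W(3) that] frechet_derivative_works by blast+
  qed
qed

lemma eventually_in_chart: "\<forall>\<^sub>F v in nhds e. v \<in> \<phi> ` U"
  using is_chartD(3)[OF is_chart] by (intro eventually_nhds_in_open) auto

text \<open>Since \<open>e\<close> is a two-sided unit, \<open>m\<close> is the identity along both
  axes, and a linear map on the product is determined by its values on the axes.\<close>

lemma mult_derivative_e:
  assumes "\<And>u. u \<in> \<phi> ` U \<Longrightarrow> m (u, e) = u" "\<And>u. u \<in> \<phi> ` U \<Longrightarrow> m (e, u) = u"
    and D: "(m has_derivative D) (at (e, e))"
  shows "D (X, Y) = X + Y"
proof -
  interpret linear D using D by (rule has_derivative_linear)
  have "((\<lambda>u. m (u, e)) has_derivative (\<lambda>X. D (X, 0))) (at e)"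
    by (rule has_derivative_compose[of "\<lambda>u. (u, e)", OF _ D]) (auto intro!: derivative_eq_intros)
  moreover have "\<forall>\<^sub>F u in nhds e. m (u, e) = u"
    using eventually_in_chart by (rule eventually_mono) (rule assms)
  ultimately have "((\<lambda>u. u) has_derivative (\<lambda>X. D (X, 0))) (at e)"
    by (rule has_derivative_eventually_eq)
  then have 1: "D (X, 0) = X" using has_derivative_unique has_derivative_ident by metis
  have "((\<lambda>u. m (e, u)) has_derivative (\<lambda>X. D (0, X))) (at e)"
    by (rule has_derivative_compose[of "\<lambda>u. (e, u)", OF _ D]) (auto intro!: derivative_eq_intros)
  moreover have "\<forall>\<^sub>F u in nhds e. m (e, u) = u"
    using eventually_in_chart by (rule eventually_mono) (rule assms)
  ultimately have "((\<lambda>u. u) has_derivative (\<lambda>X. D (0, X))) (at e)"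
    by (rule has_derivative_eventually_eq)
  then have 2: "D (0, Y) = Y" using has_derivative_unique has_derivative_ident by metis
  show ?thesis using add[of "(X, 0)" "(0, Y)"] 1 2 by simp
qed

text \<open>Multiples come from rescaling the parameter of a curve. Sums come from the pointwise
  product of two curves, whose velocity is given by \<open>mult_derivative_e\<close>.\<close>

lemma subgroup_lie_algebra_subspace:
  assumes K: "subgroup K G"
  shows "subspace (subgroup_lie_algebra G U \<phi> K)"
  unfolding subspace_def
proof (intro conjI ballI allI)
  interpret K: subgroup K G by (rule K)
  show "0 \<in> subgroup_lie_algebra G U \<phi> K"
    unfolding subgroup_lie_algebra_def using one_in
    by (auto intro!: exI[of _ "\<lambda>_. \<one>\<^bsub>G\<^esub>"] has_vector_derivative_const)
  fix X assume X: "X \<in> subgroup_lie_algebra G U \<phi> K"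
  then obtain \<gamma> where \<gamma>: "\<gamma> 0 = \<one>\<^bsub>G\<^esub>" "\<And>t::real. \<gamma> t \<in> K \<inter> U"
    "((\<lambda>t. \<phi> (\<gamma> t)) has_derivative (\<lambda>h. h *\<^sub>R X)) (at 0)"
    unfolding subgroup_lie_algebra_def has_vector_derivative_def by blast
  show "c *\<^sub>R X \<in> subgroup_lie_algebra G U \<phi> K" for c
  proof -
    have "((\<lambda>t. \<phi> (\<gamma> (c * t))) has_derivative (\<lambda>h. (c * h) *\<^sub>R X)) (at 0)"
      by (rule has_derivative_compose[of "\<lambda>t. c * t" _ _ _ "\<lambda>t. \<phi> (\<gamma> t)"])
         (use \<gamma>(3) in \<open>auto intro!: derivative_eq_intros\<close>)
    then show ?thesis
      unfolding subgroup_lie_algebra_def has_vector_derivative_def using \<gamma>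
      by (auto intro!: exI[of _ "\<lambda>t. \<gamma> (c * t)"] simp: mult.commute)
  qed
  fix Y assume Y: "Y \<in> subgroup_lie_algebra G U \<phi> K"
  then obtain \<delta> where \<delta>: "\<delta> 0 = \<one>\<^bsub>G\<^esub>" "\<And>t::real. \<delta> t \<in> K \<inter> U"
    "((\<lambda>t. \<phi> (\<delta> t)) has_derivative (\<lambda>h. h *\<^sub>R Y)) (at 0)"
    unfolding subgroup_lie_algebra_def has_vector_derivative_def by blast
  obtain m W where m: "open W" "smooth_on m W"
    "\<And>u. u \<in> \<phi> ` U \<Longrightarrow> (u, e) \<in> W"
    "\<And>u. u \<in> \<phi> ` U \<Longrightarrow> m (u, e) = u" "\<And>u. u \<in> \<phi> ` U \<Longrightarrow> m (e, u) = u"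
    "\<And>a b. a \<in> U \<Longrightarrow> b \<in> U \<Longrightarrow> m (\<phi> a, \<phi> b) = \<phi> (a \<otimes>\<^bsub>G\<^esub> b)"
    "\<And>z. z \<in> W \<Longrightarrow> (m has_derivative frechet_derivative m (at z)) (at z)"
    "\<And>a b. a \<in> U \<Longrightarrow> b \<in> U \<Longrightarrow> (\<phi> a, \<phi> b) \<in> W \<longleftrightarrow> a \<otimes>\<^bsub>G\<^esub> b \<in> U"
    by (rule obtain_mult) blast
  let ?D = "frechet_derivative m (at (e, e))"
  have D: "(m has_derivative ?D) (at (e, e))" using m(3,7) by simp
  have "((\<lambda>t. m (\<phi> (\<gamma> t), \<phi> (\<delta> t))) has_derivative (\<lambda>h. ?D (h *\<^sub>R X, h *\<^sub>R Y))) (at 0)"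
    by (rule has_derivative_compose[of "\<lambda>t. (\<phi> (\<gamma> t), \<phi> (\<delta> t))" _ _ _ m])
       (use \<gamma> \<delta> D in \<open>auto intro!: has_derivative_Pair\<close>)
  then have d: "((\<lambda>t. m (\<phi> (\<gamma> t), \<phi> (\<delta> t))) has_derivative (\<lambda>h. h *\<^sub>R (X + Y))) (at 0)"
    by (simp add: mult_derivative_e[OF m(4,5) D] scaleR_add_right)
  \<comment> \<open>The tangent space is defined by curves that stay in \<open>U\<close> for all
    parameters, but the product of two such curves may leave it. Resetting it to the identity there
    leaves the velocity at 0 unchanged, since by continuity the product stays in \<open>U\<close>
    near 0.\<close>
  define \<eta> where "\<eta> t = (if \<gamma> t \<otimes>\<^bsub>G\<^esub> \<delta> t \<in> U then \<gamma> t \<otimes>\<^bsub>G\<^esub> \<delta> t else \<one>\<^bsub>G\<^esub>)" for t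
  have "isCont (\<lambda>t. (\<phi> (\<gamma> t), \<phi> (\<delta> t))) 0"
    using has_derivative_continuous[OF \<gamma>(3)] has_derivative_continuous[OF \<delta>(3)] by (intro continuous_Pair)
  then have "((\<lambda>t. (\<phi> (\<gamma> t), \<phi> (\<delta> t))) \<longlongrightarrow> (e, e)) (nhds 0)"
    using tendsto_at_iff_tendsto_nhds[of "\<lambda>t. (\<phi> (\<gamma> t), \<phi> (\<delta> t))" 0] \<gamma>(1) \<delta>(1)
    by (simp add: isCont_def)
  then have "\<forall>\<^sub>F t in nhds 0. (\<phi> (\<gamma> t), \<phi> (\<delta> t)) \<in> W"
    by (rule topological_tendstoD) (use m(1,3) in auto)
  then have "\<forall>\<^sub>F t in nhds 0. m (\<phi> (\<gamma> t), \<phi> (\<delta> t)) = \<phi> (\<eta> t)"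
    by (rule eventually_mono) (use \<gamma>(2) \<delta>(2) m(6,8) in \<open>auto simp: \<eta>_def\<close>)
  with d have "((\<lambda>t. \<phi> (\<eta> t)) has_derivative (\<lambda>h. h *\<^sub>R (X + Y))) (at 0)"
    by (rule has_derivative_eventually_eq)
  moreover have "\<eta> 0 = \<one>\<^bsub>G\<^esub>" "\<And>t. \<eta> t \<in> K \<inter> U"
    using \<gamma> \<delta> one_in by (auto simp: \<eta>_def)
  ultimately show "X + Y \<in> subgroup_lie_algebra G U \<phi> K"
    unfolding subgroup_lie_algebra_def has_vector_derivative_def by blast
qed

end

section \<open>Bi-invariant inner products and the derivative of \<open>Ad\<close>\<close>

lemma inner_product_bilinear: "inner_product Q \<Longrightarrow> bilinear Q"
  unfolding inner_product_def bilinear_def by (auto simp: linear_iff)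

text \<open>On the compact Euclidean unit sphere \<open>Q X X\<close> attains a positive minimum; by
  homogeneity its reciprocal can serve as \<open>c\<close>.\<close>

lemma inner_product_bounds_norm:
  fixes Q :: "'e::euclidean_space \<Rightarrow> 'e \<Rightarrow> real"
  assumes Q: "inner_product Q"
  obtains c where "c > 0" "\<And>X. norm X ^ 2 \<le> c * Q X X"
proof -
  interpret bounded_bilinear Q
    using inner_product_bilinear[OF Q] bilinear_conv_bounded_bilinear by blast
  have "continuous_on (sphere 0 1) (\<lambda>X. Q X X)" by (intro continuous_on continuous_on_id)
  then obtain X0 where X0: "X0 \<in> sphere 0 1" "\<And>X. X \<in> sphere 0 1 \<Longrightarrow> Q X0 X0 \<le> Q X X"
    using continuous_attains_inf[of "sphere 0 1" "\<lambda>X. Q X X"] by (auto simp: compact_sphere)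
  define c where "c = Q X0 X0"
  have c: "c > 0" using Q X0(1) unfolding c_def inner_product_def by (metis norm_zero mem_sphere_0 zero_neq_one)
  have "norm X ^ 2 \<le> (1 / c) * Q X X" for X
  proof (cases "X = 0")
    case False
    have "c \<le> Q (X /\<^sub>R norm X) (X /\<^sub>R norm X)" unfolding c_def using False by (intro X0(2)) simp
    also have "\<dots> = Q X X / norm X ^ 2" by (simp add: scaleR_left scaleR_right power2_eq_square divide_inverse)
    finally show ?thesis using c False by (simp add: field_simps)
  qed (simp add: zero_left)
  then show thesis using c that[of "1 / c"] by simp
qed

locale biinvariant_chart = lie_group_chart +
  fixes Q :: "'b \<Rightarrow> 'b \<Rightarrow> real"
  assumes inner: "inner_product Q"
    and Ad_isometry: "g \<in> carrier G \<Longrightarrow> Q (Ad_map G U \<phi> g X) (Ad_map G U \<phi> g Y) = Q X Y"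
begin

text \<open>The value of \<open>Q\<close> on \<open>Ad g Y\<close> is the same for all
  \<open>g\<close>, and \<open>Q\<close> controls the norm. This uniformity in \<open>g\<close> is
  the starting point for all regularity of \<open>Ad\<close> in the group variable.\<close>

lemma Ad_bounded: obtains C where "\<And>g. g \<in> carrier G \<Longrightarrow> norm (Ad g Y) \<le> C"
proof -
  obtain c where c: "c > 0" "\<And>X. norm X ^ 2 \<le> c * Q X X"
    using inner_product_bounds_norm[OF inner] by blast
  have "norm (Ad g Y) \<le> sqrt (c * Q Y Y)" if "g \<in> carrier G" for g
    using c(2)[of "Ad g Y"] Ad_isometry[OF that] by (simp add: real_le_rsqrt)
  then show thesis by (rule that)
qed

text \<open>In the chart, \<open>g h = (g h g\<^sup>-\<^sup>1) g\<close> differentiated in \<open>h\<close> gives \<open>D\<^sub>1 m(e, u) (Ad u Y) = D\<^sub>2 m(u, e) Y\<close>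
  for the multiplication \<open>m\<close>; boundedness of \<open>Ad u\<close> lets one differentiate this at \<open>u = e\<close>.\<close>

lemma Ad_derivative_bracket:
  "((\<lambda>u. Ad (\<psi> u) Y) has_derivative (\<lambda>X. br X Y)) (at e)"
proof -
  obtain m W where m: "open W" "smooth_on m W"
    "\<And>u. u \<in> \<phi> ` U \<Longrightarrow> (u, e) \<in> W" "\<And>u. u \<in> \<phi> ` U \<Longrightarrow> (e, u) \<in> W"
    "\<And>u. u \<in> \<phi> ` U \<Longrightarrow> m (u, e) = u" "\<And>u. u \<in> \<phi> ` U \<Longrightarrow> m (e, u) = u"
    "\<And>a b. a \<in> U \<Longrightarrow> b \<in> U \<Longrightarrow> m (\<phi> a, \<phi> b) = \<phi> (a \<otimes>\<^bsub>G\<^esub> b)"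
    "\<And>z. z \<in> W \<Longrightarrow> (m has_derivative frechet_derivative m (at z)) (at z)"
    "\<And>z v. z \<in> W \<Longrightarrow> ((\<lambda>z. frechet_derivative m (at z) v) has_derivative
        frechet_derivative (\<lambda>z. frechet_derivative m (at z) v) (at z)) (at z)"
    by (rule obtain_mult) blast
  define D where "D z = frechet_derivative m (at z)" for z
  \<comment> \<open>\<open>DD v w\<close> is the second derivative of \<open>m\<close> at
    \<open>(e, e)\<close>; only its mixed part, with one direction in each factor, enters the
    bracket.\<close>
  define DD where "DD v = frechet_derivative (\<lambda>z. D z v) (at (e, e))" for v
  have D: "(m has_derivative D z) (at z)" if "z \<in> W" for z
    using m(8)[OF that] by (simp add: D_def)
  have linD: "linear (D z)" if "z \<in> W" for z
    using D[OF that] by (rule has_derivative_linear)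
  have DD: "((\<lambda>z. D z v) has_derivative DD v) (at (e, e))" for v
    using m(9)[of "(e, e)" v] m(3) by (simp add: D_def DD_def)
  have linDD: "linear (DD v)" for v
    using DD by (rule has_derivative_linear)
  have sym: "DD v w = DD w v" for v w
    unfolding DD_def D_def
    by (rule mixed_derivatives_commute[OF m(1) _ smooth_onD(3)[OF m(2)]]) (rule m(3)[OF e_in])+
  have D2: "((\<lambda>v. m (u, v)) has_derivative (\<lambda>Y. D (u, e) (0, Y))) (at e)" if "u \<in> \<phi> ` U" for u
    by (rule has_derivative_compose[of "\<lambda>v. (u, v)" _ _ _ m])
       (use D m(3) that in \<open>auto intro!: derivative_eq_intros\<close>)
  have D1: "((\<lambda>v. m (v, u)) has_derivative (\<lambda>Y. D (e, u) (Y, 0))) (at e)" if "u \<in> \<phi> ` U" for u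
    by (rule has_derivative_compose[of "\<lambda>v. (v, u)" _ _ _ m])
       (use D m(4) that in \<open>auto intro!: derivative_eq_intros\<close>)
  have l_eq: "left_inv_field G U \<phi> Y u = D (u, e) (0, Y)" if "u \<in> \<phi> ` U" for u Y
  proof -
    have "\<forall>\<^sub>F v in nhds e. m (u, v) = \<phi> (\<psi> u \<otimes>\<^bsub>G\<^esub> \<psi> v)"
      using eventually_in_chart m(7)[of "\<psi> u"] that by (auto elim: eventually_mono)
    with D2[OF that] have "((\<lambda>v. \<phi> (\<psi> u \<otimes>\<^bsub>G\<^esub> \<psi> v)) has_derivative (\<lambda>Y. D (u, e) (0, Y))) (at e)"
      by (rule has_derivative_eventually_eq)
    then show ?thesis unfolding left_inv_field_def by (metis frechet_derivative_at)
  qed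
  have dl: "((\<lambda>u. D (u, e) (0, Y)) has_derivative (\<lambda>X. DD (0, Y) (X, 0))) (at e)" for Y
    by (rule has_derivative_compose[of "\<lambda>u. (u, e)" _ _ _ "\<lambda>z. D z (0, Y)"])
       (use DD in \<open>auto intro!: derivative_eq_intros\<close>)
  have dR: "((\<lambda>u. D (e, u) (b, 0)) has_derivative (\<lambda>X. DD (b, 0) (0, X))) (at e)" for b
    by (rule has_derivative_compose[of "\<lambda>u. (e, u)" _ _ _ "\<lambda>z. D z (b, 0)"])
       (use DD in \<open>auto intro!: derivative_eq_intros\<close>)
  \<comment> \<open>A left-invariant field is the derivative of \<open>m\<close> in the second
    factor at \<open>(u, e)\<close>, so its own derivative at \<open>e\<close> is a mixed second
    derivative of \<open>m\<close>.\<close>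
  have br_eq: "br X Y = DD (0, Y) (X, 0) - DD (0, X) (Y, 0)" for X Y
  proof -
    have "(left_inv_field G U \<phi> Y has_derivative (\<lambda>X. DD (0, Y) (X, 0))) (at e)" for Y
      using dl[of Y]
    proof (rule has_derivative_eventually_eq)
      show "\<forall>\<^sub>F u in nhds e. D (u, e) (0, Y) = left_inv_field G U \<phi> Y u"
        using eventually_in_chart by (rule eventually_mono) (simp add: l_eq)
    qed
    then show ?thesis unfolding lie_bracket_def by (metis frechet_derivative_at)
  qed
  define a where "a u = Ad (\<psi> u) Y" for u
  have R: "D (e, u) (a u, 0) = D (u, e) (0, Y)" if u: "u \<in> \<phi> ` U" for u
  proof -
    have g: "\<psi> u \<in> carrier G" using u U_carrier by simp
    have "((\<lambda>v. m (conj_chart (\<psi> u) v, u)) has_derivative (\<lambda>Y. D (e, u) (Ad (\<psi> u) Y, 0))) (at e)"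
      by (rule has_derivative_compose[of "conj_chart (\<psi> u)" _ _ _ "\<lambda>v. m (v, u)"])
         (use g u D1 Ad_has_derivative[of "\<psi> u"] in auto)
    moreover have "\<forall>\<^sub>F v in nhds e. m (conj_chart (\<psi> u) v, u) = m (u, v)"
      using eventually_conj_chart[OF g]
    proof (rule eventually_mono)
      fix v assume v: "v \<in> \<phi> ` U \<and> \<psi> u \<otimes>\<^bsub>G\<^esub> \<psi> v \<otimes>\<^bsub>G\<^esub> inv\<^bsub>G\<^esub> \<psi> u \<in> U"
      then have "\<psi> v \<in> carrier G" using U_carrier by simp
      then show "m (conj_chart (\<psi> u) v, u) = m (u, v)"
        using m(7)[of "\<psi> u \<otimes>\<^bsub>G\<^esub> \<psi> v \<otimes>\<^bsub>G\<^esub> inv\<^bsub>G\<^esub> \<psi> u" "\<psi> u"] m(7)[of "\<psi> u" "\<psi> v"] u v g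
        by (simp add: conj_chart_def m_assoc)
    qed
    ultimately have "((\<lambda>v. m (u, v)) has_derivative (\<lambda>Y. D (e, u) (Ad (\<psi> u) Y, 0))) (at e)"
      by (rule has_derivative_eventually_eq)
    from has_derivative_unique[OF this D2[OF u]] show ?thesis by (simp add: a_def fun_eq_iff)
  qed
  have De: "D (e, e) (X, 0) = X" for X
    using mult_derivative_e[OF m(5,6) D[OF m(3)]] by simp
  \<comment> \<open>For \<open>u\<close> in the chart, \<open>s u\<close> is
    \<open>D (e, u) (a u, 0) - a u\<close>, written so that each summand is a coordinate of the
    unknown \<open>a u\<close> times a known function vanishing at \<open>e\<close>.\<close>
  define s where "s u = (\<Sum>b\<in>Basis. (a u \<bullet> b) *\<^sub>R (D (e, u) (b, 0) - b))" for u
  have a_eq: "a u = D (u, e) (0, Y) - s u" if u: "u \<in> \<phi> ` U" for u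
  proof -
    interpret linear "D (e, u)" using linD m(4) u by blast
    have "D (e, u) (a u, 0) = D (e, u) (\<Sum>b\<in>Basis. (a u \<bullet> b) *\<^sub>R (b, 0))"
      by (simp add: sum_prod fst_sum snd_sum prod_eq_iff euclidean_representation)
    also have "\<dots> = (\<Sum>b\<in>Basis. (a u \<bullet> b) *\<^sub>R D (e, u) (b, 0))"
      by (simp only: sum scale)
    finally have "s u = D (u, e) (0, Y) - a u"
      unfolding s_def R[OF u]
      by (simp add: scaleR_right_diff_distrib sum_subtractf euclidean_representation)
    then show ?thesis by simp
  qed
  have ae: "a e = Y" by (simp add: a_def Ad_one)
  obtain C where C: "\<And>g. g \<in> carrier G \<Longrightarrow> norm (Ad g Y) \<le> C" by (rule Ad_bounded[of Y]) blast
  \<comment> \<open>Boundedness of the coordinates of \<open>a\<close> suffices here, because the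
    other factor tends to 0.\<close>
  have s0: "(s \<longlongrightarrow> 0) (at e)"
    unfolding s_def
  proof (rule tendsto_null_sum)
    fix b :: 'b assume b: "b \<in> Basis"
    have lim: "((\<lambda>u. C * norm (D (e, u) (b, 0) - b)) \<longlongrightarrow> 0) (at e)"
    proof -
      have "((\<lambda>u. D (e, u) (b, 0)) \<longlongrightarrow> D (e, e) (b, 0)) (at e)"
        using has_derivative_continuous[OF dR] by (simp add: continuous_within)
      then have "((\<lambda>u. C * norm (D (e, u) (b, 0) - b)) \<longlongrightarrow> C * norm (D (e, e) (b, 0) - b)) (at e)"
        by (intro tendsto_intros)
      then show ?thesis by (simp add: De)
    qed
    show "((\<lambda>u. (a u \<bullet> b) *\<^sub>R (D (e, u) (b, 0) - b)) \<longlongrightarrow> 0) (at e)"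
    proof (rule Lim_null_comparison[OF _ lim])
      have "norm ((a u \<bullet> b) *\<^sub>R (D (e, u) (b, 0) - b)) \<le> C * norm (D (e, u) (b, 0) - b)" if "u \<in> \<phi> ` U" for u
      proof -
        have "\<bar>a u \<bullet> b\<bar> \<le> norm (a u)" using Basis_le_norm[OF b] by simp
        also have "\<dots> \<le> C" unfolding a_def using C U_carrier that by simp
        finally show ?thesis by (simp add: mult_right_mono)
      qed
      moreover have "\<forall>\<^sub>F u in at e. u \<in> \<phi> ` U"
        using eventually_in_chart by (simp add: eventually_nhds_conv_at)
      ultimately show "\<forall>\<^sub>F u in at e. norm ((a u \<bullet> b) *\<^sub>R (D (e, u) (b, 0) - b)) \<le> C * norm (D (e, u) (b, 0) - b)"
        by (auto elim: eventually_mono)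
    qed
  qed
  \<comment> \<open>By \<open>a_eq\<close>, \<open>a\<close> is a function continuous at
    \<open>e\<close> minus \<open>s\<close>. Its continuity is what
    \<open>has_derivative_scaleR_vanishing\<close> then asks for in order to differentiate
    \<open>s\<close>.\<close>
  have "isCont a e"
    unfolding isCont_def
  proof (rule Lim_transform_eventually)
    have "((\<lambda>u. D (u, e) (0, Y)) \<longlongrightarrow> D (e, e) (0, Y)) (at e)"
      using has_derivative_continuous[OF dl] by (simp add: continuous_within)
    moreover have "D (e, e) (0, Y) = Y"
      using mult_derivative_e[OF m(5,6) D[OF m(3)]] by simp
    ultimately show "((\<lambda>u. D (u, e) (0, Y) - s u) \<longlongrightarrow> a e) (at e)"
      using tendsto_diff[OF _ s0] ae by fastforce
    show "\<forall>\<^sub>F u in at e. D (u, e) (0, Y) - s u = a u"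
      using eventually_in_chart by (auto simp: eventually_nhds_conv_at a_eq elim: eventually_mono)
  qed
  then have cont: "isCont (\<lambda>u. a u \<bullet> b) e" for b by (intro continuous_intros)
  have "(s has_derivative (\<lambda>X. \<Sum>b\<in>Basis. (a e \<bullet> b) *\<^sub>R DD (b, 0) (0, X))) (at e)"
    unfolding s_def
  proof (rule has_derivative_sum)
    fix b :: 'b
    have "((\<lambda>u. D (e, u) (b, 0) - b) has_derivative (\<lambda>X. DD (b, 0) (0, X) - 0)) (at e)"
      by (intro has_derivative_diff dR has_derivative_const)
    then show "((\<lambda>u. (a u \<bullet> b) *\<^sub>R (D (e, u) (b, 0) - b)) has_derivative
        (\<lambda>X. (a e \<bullet> b) *\<^sub>R DD (b, 0) (0, X))) (at e)"
      by (intro has_derivative_scaleR_vanishing cont) (auto simp: De)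
  qed
  \<comment> \<open>Symmetry of the second derivative moves \<open>b\<close> into the linear slot;
    the sum then reassembles \<open>Y\<close> from its coordinates. This produces the second half of
    \<open>br_eq\<close>.\<close>
  moreover have "(\<Sum>b\<in>Basis. (a e \<bullet> b) *\<^sub>R DD (b, 0) (0, X)) = DD (0, X) (Y, 0)" for X
  proof -
    interpret linear "DD (0, X)" by (rule linDD)
    have "(\<Sum>b\<in>Basis. (a e \<bullet> b) *\<^sub>R DD (b, 0) (0, X)) = (\<Sum>b\<in>Basis. (Y \<bullet> b) *\<^sub>R DD (0, X) (b, 0))"
      unfolding ae using sym by metis
    also have "\<dots> = DD (0, X) (\<Sum>b\<in>Basis. (Y \<bullet> b) *\<^sub>R (b, 0))" by (simp only: sum scale)
    also have "(\<Sum>b\<in>Basis. (Y \<bullet> b) *\<^sub>R (b, 0)) = (Y, 0::'b)"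
      by (simp add: fst_sum snd_sum prod_eq_iff euclidean_representation)
    finally show ?thesis .
  qed
  ultimately have "(s has_derivative (\<lambda>X. DD (0, X) (Y, 0))) (at e)" by simp
  from has_derivative_diff[OF dl[of Y] this]
  have "((\<lambda>u. D (u, e) (0, Y) - s u) has_derivative (\<lambda>X. br X Y)) (at e)"
    by (simp add: br_eq)
  then have "(a has_derivative (\<lambda>X. br X Y)) (at e)"
    by (rule has_derivative_eventually_eq)
       (use eventually_in_chart in \<open>auto simp: a_eq elim: eventually_mono\<close>)
  then show ?thesis unfolding a_def[abs_def] .
qed

lemma bracket_antisym: "br X Y = - br Y X"
  by (simp add: lie_bracket_def)

text \<open>Linearity in the first argument is immediate once the bracket is a derivative evaluated
  at \<open>X\<close>; antisymmetry carries it over to the second.\<close>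

lemma bilinear_bracket: "bilinear br"
proof -
  have 1: "linear (\<lambda>X. br X Y)" for Y
    using Ad_derivative_bracket by (rule has_derivative_linear)
  then have "linear (\<lambda>X. - br X Y)" for Y by (rule linear_compose_neg)
  then have "linear (br Y)" for Y using bracket_antisym by (metis (no_types, lifting) ext)
  with 1 show ?thesis by (simp add: bilinear_def)
qed

lemma bracket_skew: "Q (br X Y) Z = - Q Y (br X Z)"
proof -
  interpret bounded_bilinear Q
    using inner_product_bilinear[OF inner] bilinear_conv_bounded_bilinear by blast
  have "((\<lambda>u. Q (Ad (\<psi> u) Y) (Ad (\<psi> u) Z)) has_derivative
      (\<lambda>X. Q (Ad (\<psi> e) Y) (br X Z) + Q (br X Y) (Ad (\<psi> e) Z))) (at e)"
    by (intro FDERIV Ad_derivative_bracket)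
  moreover have "\<forall>\<^sub>F u in nhds e. Q (Ad (\<psi> u) Y) (Ad (\<psi> u) Z) = Q Y Z"
    using eventually_in_chart by (rule eventually_mono) (simp add: Ad_isometry U_carrier)
  ultimately have "((\<lambda>u. Q Y Z) has_derivative
      (\<lambda>X. Q (Ad (\<psi> e) Y) (br X Z) + Q (br X Y) (Ad (\<psi> e) Z))) (at e)"
    by (rule has_derivative_eventually_eq)
  from has_derivative_unique[OF this has_derivative_const]
  show ?thesis by (simp add: Ad_one fun_eq_iff add_eq_0_iff)
qed

lemma Ad_linear: "g \<in> carrier G \<Longrightarrow> linear (Ad g)"
  using Ad_has_derivative has_derivative_linear by blast

lemma Ad_bracket:
  assumes h: "h \<in> carrier G"
  shows "Ad h (br X Y) = br (Ad h X) (Ad h Y)"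
proof -
  have "((\<lambda>u. Ad (\<psi> (conj_chart h u)) (Ad h Y)) has_derivative (\<lambda>X. br (Ad h X) (Ad h Y))) (at e)"
    by (rule has_derivative_compose[of "conj_chart h" _ _ _ "\<lambda>u. Ad (\<psi> u) (Ad h Y)"])
       (simp_all add: h Ad_has_derivative Ad_derivative_bracket)
  moreover have "\<forall>\<^sub>F u in nhds e. Ad (\<psi> (conj_chart h u)) (Ad h Y) = Ad h (Ad (\<psi> u) Y)"
    using eventually_conj_chart[OF h]
  proof (rule eventually_mono)
    fix u assume u: "u \<in> \<phi> ` U \<and> h \<otimes>\<^bsub>G\<^esub> \<psi> u \<otimes>\<^bsub>G\<^esub> inv\<^bsub>G\<^esub> h \<in> U"
    then have "\<psi> u \<in> carrier G" using U_carrier by simp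
    with u h show "Ad (\<psi> (conj_chart h u)) (Ad h Y) = Ad h (Ad (\<psi> u) Y)"
      by (simp add: conj_chart_def m_assoc flip: Ad_mult)
  qed
  ultimately have "((\<lambda>u. Ad h (Ad (\<psi> u) Y)) has_derivative (\<lambda>X. br (Ad h X) (Ad h Y))) (at e)"
    by (rule has_derivative_eventually_eq)
  moreover have "((\<lambda>u. Ad h (Ad (\<psi> u) Y)) has_derivative (\<lambda>X. Ad h (br X Y))) (at e)"
    using bounded_linear.has_derivative[OF linear_conv_bounded_linear[THEN iffD1, OF Ad_linear[OF h]] Ad_derivative_bracket] .
  ultimately show ?thesis using has_derivative_unique by metis
qed

end

section \<open>The operator \<open>L\<^sub>\<pp>\<close> in an orthonormal basis\<close>

lemma Blinfun_linear [simp]: "linear f \<Longrightarrow> blinfun_apply (Blinfun f) = (f :: 'a::euclidean_space \<Rightarrow> 'b::real_normed_vector)"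
  by (simp add: bounded_linear_Blinfun_apply linear_conv_bounded_linear)

lemma linear_blinfun: "linear (blinfun_apply A)"
  using blinfun.bounded_linear_right bounded_linear.linear by blast

lemma gl_theta_linear:
  assumes "bilinear \<mu>"
  shows "gl_theta (A + B) \<mu> X Y = gl_theta A \<mu> X Y + gl_theta B \<mu> X Y"
    and "gl_theta (c *\<^sub>R A) \<mu> X Y = c *\<^sub>R gl_theta A \<mu> X Y"
  using assms
  by (auto simp: gl_theta_def blinfun.add_left blinfun.scaleR_left bilinear_ladd bilinear_radd
      bilinear_lmul bilinear_rmul algebra_simps)

lemma bilinear_gl_theta:
  assumes "bilinear \<mu>"
  shows "bilinear (gl_theta A \<mu>)"
  using assms unfolding bilinear_def linear_iff gl_theta_def
  by (auto simp: blinfun.add_right blinfun.scaleR_right algebra_simps)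

text \<open>The form \<open>ip\<close> lives on the whole space but vanishes along \<kk>, just as
  the elements of \<open>gl_on\<close> do. Identities between them therefore hold for all vectors,
  without membership conditions, while positivity is confined to \<pp>.\<close>

locale split_metric =
  fixes \<kk> \<pp> :: "'e::euclidean_space set" and ip :: "'e \<Rightarrow> 'e \<Rightarrow> real" and B :: "'e set"
  assumes kk: "subspace \<kk>" and pp: "subspace \<pp>"
    and split: "\<And>X. \<exists>Y\<in>\<pp>. X - Y \<in> \<kk>"
    and bilin: "bilinear ip" and ip_commute: "ip X Y = ip Y X"
    and ip_kk: "X \<in> \<kk> \<Longrightarrow> ip X Y = 0"
    and ip_pos: "X \<in> \<pp> \<Longrightarrow> X \<noteq> 0 \<Longrightarrow> ip X X > 0"
    and onb: "orthonormal_basis ip \<pp> B"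
begin

interpretation ip: bounded_bilinear ip
  using bilin bilinear_conv_bounded_bilinear by blast

lemmas ip_simps = ip.add_left ip.add_right ip.diff_left ip.diff_right ip.scaleR_left ip.scaleR_right
  ip.minus_left ip.minus_right ip.zero_left ip.zero_right ip.sum_left ip.sum_right

lemma finite_B: "finite B"
  using onb independent_imp_finite by (auto simp: orthonormal_basis_def)

lemma B_pp: "p \<in> B \<Longrightarrow> p \<in> \<pp>"
  using onb by (auto simp: orthonormal_basis_def span_base)

lemma ip_B: "p \<in> B \<Longrightarrow> q \<in> B \<Longrightarrow> ip p q = (if p = q then 1 else 0)"
  using onb by (auto simp: orthonormal_basis_def)

lemma ip_kk': "Y \<in> \<kk> \<Longrightarrow> ip X Y = 0"
  using ip_kk ip_commute by metis

lemma pp_expand: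
  assumes "X \<in> \<pp>"
  shows "X = (\<Sum>p\<in>B. ip X p *\<^sub>R p)"
proof -
  have "X \<in> span B" using assms onb by (simp add: orthonormal_basis_def)
  then show ?thesis
  proof (induction rule: span_induct_alt)
    case (step c p Y)
    have "(\<Sum>q\<in>B. (c * ip p q) *\<^sub>R q) = c *\<^sub>R p"
      using step(1) finite_B by (simp add: ip_B if_distrib[of "\<lambda>t. (c * t) *\<^sub>R _"] cong: if_cong)
    then show ?case using step(2) by (simp add: ip_simps scaleR_add_left sum.distrib)
  qed (simp add: ip_simps)
qed

definition pr :: "'e \<Rightarrow> 'e" where "pr X = (\<Sum>p\<in>B. ip X p *\<^sub>R p)"

lemma linear_pr: "linear pr"
  by (auto simp: linear_iff pr_def ip_simps scaleR_add_left sum.distrib scaleR_sum_right)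

lemma pr_pp: "pr X \<in> \<pp>"
  unfolding pr_def by (intro subspace_sum[OF pp] subspace_scale[OF pp] B_pp)

lemma pr_id: "X \<in> \<pp> \<Longrightarrow> pr X = X"
  using pp_expand by (simp add: pr_def)

lemma pr_kk: "X \<in> \<kk> \<Longrightarrow> pr X = 0"
  by (simp add: pr_def ip_kk)

lemma diff_pr: "X - pr X \<in> \<kk>"
proof -
  obtain Y where Y: "Y \<in> \<pp>" "X - Y \<in> \<kk>" using split by blast
  have "pr X = pr (X - Y) + pr Y" using linear_pr by (simp flip: linear_add)
  with Y show ?thesis by (simp add: pr_kk pr_id)
qed

lemma ip_pr: "ip (pr X) Y = ip X Y" "ip X (pr Y) = ip X Y"
  using ip_kk[OF diff_pr, of X Y] ip_kk'[OF diff_pr, of X Y] by (simp_all add: ip_simps)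

lemma proj_along_eq: "proj_along \<pp> \<kk> = pr"
  unfolding proj_along_def
proof (intro ext the_equality conjI pr_pp diff_pr)
  fix X Y assume "Y \<in> \<pp> \<and> X - Y \<in> \<kk>"
  moreover then have "pr X = pr (X - Y) + pr Y" using linear_pr by (simp flip: linear_add)
  ultimately show "Y = pr X" by (simp add: pr_kk pr_id)
qed

lemma parseval: "ip X Y = (\<Sum>p\<in>B. ip X p * ip Y p)"
proof -
  have "ip X Y = ip (pr X) Y" by (simp add: ip_pr)
  also have "\<dots> = (\<Sum>p\<in>B. ip X p * ip Y p)" unfolding pr_def by (simp add: ip_simps ip_commute)
  finally show ?thesis .
qed

lemma pp_eqI:
  assumes "X \<in> \<pp>" "Y \<in> \<pp>" "\<And>p. p \<in> B \<Longrightarrow> ip X p = ip Y p"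
  shows "X = Y"
  using pp_expand[OF assms(1)] pp_expand[OF assms(2)] assms(3) by simp

text \<open>This is the basis independence of the trace of a bilinear form: expand the new basis in
  the old one and contract with Parseval for the new one.\<close>

lemma onb_change:
  assumes f: "bilinear f" and B': "orthonormal_basis ip \<pp> B'"
  shows "(\<Sum>b\<in>B'. f b b) = (\<Sum>p\<in>B. f p p :: real)"
proof -
  interpret f: bounded_bilinear f using f bilinear_conv_bounded_bilinear by blast
  interpret B': split_metric \<kk> \<pp> ip B'
    using kk pp split bilin ip_commute ip_kk ip_pos B' by unfold_locales
  have "(\<Sum>b\<in>B'. f b b) = (\<Sum>b\<in>B'. f (pr b) (pr b))"
    by (simp add: pr_id B'.B_pp)
  also have "\<dots> = (\<Sum>b\<in>B'. \<Sum>p\<in>B. \<Sum>q\<in>B. ip p b * ip q b * f p q)"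
    unfolding pr_def f.sum_left unfolding f.sum_right f.scaleR_left f.scaleR_right
    by (simp add: ip_commute mult_ac)
  also have "\<dots> = (\<Sum>p\<in>B. \<Sum>q\<in>B. \<Sum>b\<in>B'. ip p b * ip q b * f p q)"
    by (simp add: sum.swap[of _ B' B])
  also have "\<dots> = (\<Sum>p\<in>B. \<Sum>q\<in>B. ip p q * f p q)"
    by (simp add: B'.parseval[symmetric] sum_distrib_right[symmetric])
  also have "\<dots> = (\<Sum>p\<in>B. f p p)"
    using finite_B by (simp add: ip_B if_distrib[of "\<lambda>t. t * _"] cong: if_cong)
  finally show ?thesis .
qed

text \<open>The chosen basis \<open>C\<close> need not be orthonormal. Expanding \<open>f c\<close>
  in \<open>B\<close> brings in the \<open>C\<close>-coordinates of each \<open>p\<close> in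
  \<open>B\<close>; after exchanging the sums these recombine to \<open>p\<close> inside
  \<open>f\<close>.\<close>

lemma trace_on_eq:
  assumes f: "linear f" and f_pp: "\<And>X. X \<in> \<pp> \<Longrightarrow> f X \<in> \<pp>"
  shows "trace_on \<pp> f = (\<Sum>p\<in>B. ip (f p) p)"
proof -
  define C where "C = (SOME C. independent C \<and> span C = \<pp>)"
  have "independent C \<and> span C = \<pp>"
    unfolding C_def by (rule someI[of _ B]) (use onb in \<open>simp add: orthonormal_basis_def\<close>)
  then have ind: "independent C" and sp: "span C = \<pp>" by auto
  then have C: "c \<in> C \<Longrightarrow> c \<in> \<pp>" for c using span_base by blast
  have fin: "finite C" using ind independent_imp_finite by blast
  have rep: "representation C (f c) c = (\<Sum>p\<in>B. ip (f c) p * representation C p c)" if "c \<in> C" for c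
  proof -
    have "f c = (\<Sum>p\<in>B. ip (f c) p *\<^sub>R p)" by (rule pp_expand[OF f_pp[OF C[OF that]]])
    then have "representation C (f c) c = representation C (\<Sum>p\<in>B. ip (f c) p *\<^sub>R p) c" by simp
    also have "\<dots> = (\<Sum>p\<in>B. representation C (ip (f c) p *\<^sub>R p) c)"
      using ind by (subst representation_sum) (auto simp: sp B_pp intro!: subspace_scale[OF pp])
    also have "\<dots> = (\<Sum>p\<in>B. ip (f c) p * representation C p c)"
      using ind by (intro sum.cong refl) (simp add: representation_scale sp B_pp)
    finally show ?thesis .
  qed
  have "trace_on \<pp> f = (\<Sum>c\<in>C. representation C (f c) c)"
    by (simp add: trace_on_def C_def Let_def)
  also have "\<dots> = (\<Sum>c\<in>C. \<Sum>p\<in>B. ip (f c) p * representation C p c)"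
    by (simp add: rep)
  also have "\<dots> = (\<Sum>p\<in>B. \<Sum>c\<in>C. ip (f (representation C p c *\<^sub>R c)) p)"
    by (subst sum.swap) (simp add: linear_scale[OF f] ip_simps mult.commute)
  also have "\<dots> = (\<Sum>p\<in>B. ip (f (\<Sum>c\<in>C. representation C p c *\<^sub>R c)) p)"
    by (simp add: linear_sum[OF f] ip_simps)
  also have "\<dots> = (\<Sum>p\<in>B. ip (f p) p)"
    by (intro sum.cong refl, subst sum_representation_eq) (auto simp: ind sp B_pp fin)
  finally show ?thesis .
qed

text \<open>The definition picks an unknown orthonormal basis; \<open>onb_change\<close> replaces it
  in one argument at a time.\<close>

lemma tensor_inner_eq:
  assumes \<eta>: "bilinear \<eta>" and \<nu>: "bilinear \<nu>"
  shows "tensor_inner \<pp> ip \<eta> \<nu> = (\<Sum>p\<in>B. \<Sum>q\<in>B. ip (\<eta> p q) (\<nu> p q))"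
proof -
  interpret \<eta>: bounded_bilinear \<eta> using \<eta> bilinear_conv_bounded_bilinear by blast
  interpret \<nu>: bounded_bilinear \<nu> using \<nu> bilinear_conv_bounded_bilinear by blast
  define C where "C = (SOME C. orthonormal_basis ip \<pp> C)"
  have C: "orthonormal_basis ip \<pp> C" unfolding C_def by (rule someI, rule onb)
  have "tensor_inner \<pp> ip \<eta> \<nu> = (\<Sum>c\<in>C. \<Sum>d\<in>C. ip (\<eta> c d) (\<nu> c d))"
    by (simp add: tensor_inner_def C_def Let_def)
  also have "\<dots> = (\<Sum>c\<in>C. \<Sum>q\<in>B. ip (\<eta> c q) (\<nu> c q))"
    by (intro sum.cong refl onb_change[OF _ C])
       (auto simp: bilinear_def linear_iff ip_simps \<eta>.add_right \<nu>.add_right \<eta>.scaleR_right \<nu>.scaleR_right)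
  also have "\<dots> = (\<Sum>q\<in>B. \<Sum>c\<in>C. ip (\<eta> c q) (\<nu> c q))" by (rule sum.swap)
  also have "\<dots> = (\<Sum>q\<in>B. \<Sum>p\<in>B. ip (\<eta> p q) (\<nu> p q))"
    by (intro sum.cong refl onb_change[OF _ C])
       (auto simp: bilinear_def linear_iff ip_simps \<eta>.add_left \<nu>.add_left \<eta>.scaleR_left \<nu>.scaleR_left)
  also have "\<dots> = (\<Sum>p\<in>B. \<Sum>q\<in>B. ip (\<eta> p q) (\<nu> p q))" by (rule sum.swap)
  finally show ?thesis .
qed

section \<open>Endomorphisms of \<pp>: transposes, the trace inner product, Riesz
  representation\<close>

lemma glD: "A \<in> gl_on \<kk> \<pp> \<Longrightarrow> A X \<in> \<pp>" "A \<in> gl_on \<kk> \<pp> \<Longrightarrow> X \<in> \<kk> \<Longrightarrow> A X = 0"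
  by (auto simp: gl_on_def)

lemma gl_pr: "A \<in> gl_on \<kk> \<pp> \<Longrightarrow> A (pr X) = A X"
  using glD(2)[OF _ diff_pr, of A X] by (simp add: blinfun.diff_right)

lemma gl_on_subspace: "subspace (gl_on \<kk> \<pp>)"
  unfolding subspace_def gl_on_def
  by (auto simp: blinfun.add_left blinfun.scaleR_left subspace_0[OF pp] subspace_add[OF pp] subspace_scale[OF pp])

lemma gl_eqI:
  assumes A: "A \<in> gl_on \<kk> \<pp>" and C: "C \<in> gl_on \<kk> \<pp>"
    and eq: "\<And>p q. p \<in> B \<Longrightarrow> q \<in> B \<Longrightarrow> ip (A p) q = ip (C p) q"
  shows "A = C"
proof (rule blinfun_eqI)
  fix X
  have "A p = C p" if "p \<in> B" for p
    using glD(1)[OF A] glD(1)[OF C] eq[OF that] by (rule pp_eqI)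
  then have "A (pr X) = C (pr X)"
    by (simp add: pr_def blinfun.sum_right blinfun.scaleR_right)
  then show "A X = C X" by (simp add: gl_pr A C)
qed

lemma transp_on_eqI:
  assumes A: "A \<in> gl_on \<kk> \<pp>" and C: "C \<in> gl_on \<kk> \<pp>"
    and eq: "\<And>X Y. X \<in> \<pp> \<Longrightarrow> Y \<in> \<pp> \<Longrightarrow> ip (A X) Y = ip X (C Y)"
  shows "transp_on \<kk> \<pp> ip A = C"
  unfolding transp_on_def
proof (rule the_equality)
  show "C \<in> gl_on \<kk> \<pp> \<and> (\<forall>X\<in>\<pp>. \<forall>Y\<in>\<pp>. ip (A X) Y = ip X (C Y))" using C eq by blast
  fix D assume D: "D \<in> gl_on \<kk> \<pp> \<and> (\<forall>X\<in>\<pp>. \<forall>Y\<in>\<pp>. ip (A X) Y = ip X (D Y))"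
  show "D = C"
  proof (rule gl_eqI)
    fix p q assume "p \<in> B" "q \<in> B"
    then show "ip (D p) q = ip (C p) q"
      using D eq[of q p] B_pp by (metis ip_commute)
  qed (use C D in auto)
qed

text \<open>Existence makes the definite description meaningful. The adjunction extends from \<pp>
  to all vectors because both sides ignore components in \<kk>.\<close>

lemma transp_on_gl:
  assumes A: "A \<in> gl_on \<kk> \<pp>"
  shows "transp_on \<kk> \<pp> ip A \<in> gl_on \<kk> \<pp>" "ip (A X) Y = ip X (transp_on \<kk> \<pp> ip A Y)"
proof -
  define C where "C = Blinfun (\<lambda>Y. \<Sum>p\<in>B. ip (A p) Y *\<^sub>R p)"
  have "linear (\<lambda>Y. \<Sum>p\<in>B. ip (A p) Y *\<^sub>R p)"
    by (auto simp: linear_iff ip_simps scaleR_add_left sum.distrib scaleR_sum_right)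
  then have Ca: "C Y = (\<Sum>p\<in>B. ip (A p) Y *\<^sub>R p)" for Y by (simp add: C_def)
  have C: "C \<in> gl_on \<kk> \<pp>"
    by (auto simp: gl_on_def Ca ip_kk' B_pp intro!: subspace_sum[OF pp] subspace_scale[OF pp])
  have eq: "ip (A X) Y = ip X (C Y)" for X Y
  proof -
    have "ip (A X) Y = ip (A (pr X)) Y" by (simp add: gl_pr A)
    also have "\<dots> = ip X (C Y)"
      by (simp add: pr_def Ca blinfun.sum_right blinfun.scaleR_right ip_simps mult.commute)
    finally show ?thesis .
  qed
  then have t: "transp_on \<kk> \<pp> ip A = C" by (intro transp_on_eqI A C)
  show "transp_on \<kk> \<pp> ip A \<in> gl_on \<kk> \<pp>" "ip (A X) Y = ip X (transp_on \<kk> \<pp> ip A Y)"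
    unfolding t by (fact C eq)+
qed

lemma sym_on_iff:
  "A \<in> sym_on \<kk> \<pp> ip \<longleftrightarrow> A \<in> gl_on \<kk> \<pp> \<and> (\<forall>X Y. ip (A X) Y = ip X (A Y))"
proof
  show "A \<in> gl_on \<kk> \<pp> \<and> (\<forall>X Y. ip (A X) Y = ip X (A Y))" if "A \<in> sym_on \<kk> \<pp> ip"
    using that transp_on_gl(2)[of A] unfolding sym_on_def by auto
  show "A \<in> sym_on \<kk> \<pp> ip" if "A \<in> gl_on \<kk> \<pp> \<and> (\<forall>X Y. ip (A X) Y = ip X (A Y))"
    using that transp_on_eqI[of A A] unfolding sym_on_def by auto
qed

lemma sym_gl: "A \<in> sym_on \<kk> \<pp> ip \<Longrightarrow> A \<in> gl_on \<kk> \<pp>"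
  and sym_ip: "A \<in> sym_on \<kk> \<pp> ip \<Longrightarrow> ip (A X) Y = ip X (A Y)"
  by (auto simp: sym_on_iff)

lemma sym_on_subspace: "subspace (sym_on \<kk> \<pp> ip)"
  using gl_on_subspace unfolding subspace_def
  by (auto simp: sym_on_iff blinfun.add_left blinfun.scaleR_left ip_simps)

text \<open>The trace of \<open>A\<close> after the transpose of \<open>C\<close> becomes a double
  sum of products of matrix entries by Parseval; summing in the other order gives the
  Hilbert-Schmidt form.\<close>

lemma gl_inner_eq:
  assumes A: "A \<in> gl_on \<kk> \<pp>" and C: "C \<in> gl_on \<kk> \<pp>"
  shows "gl_inner \<kk> \<pp> ip A C = (\<Sum>p\<in>B. ip (A p) (C p))"
proof -
  let ?A = "transp_on \<kk> \<pp> ip A" and ?C = "transp_on \<kk> \<pp> ip C"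
  have tA: "ip (?A p) q = ip (A q) p" and tC: "ip (?C p) q = ip (C q) p" for p q
    using transp_on_gl(2)[OF A, of q p] transp_on_gl(2)[OF C, of q p]
      ip_commute[of q "?A p"] ip_commute[of q "?C p"] by simp_all
  have "gl_inner \<kk> \<pp> ip A C = (\<Sum>p\<in>B. ip (A (?C p)) p)"
    unfolding gl_inner_def by (subst trace_on_eq) (auto simp: linear_blinfun glD A)
  also have "\<dots> = (\<Sum>p\<in>B. \<Sum>q\<in>B. ip (?C p) q * ip (?A p) q)"
    by (simp add: transp_on_gl(2)[OF A] flip: parseval)
  also have "\<dots> = (\<Sum>p\<in>B. \<Sum>q\<in>B. ip (A q) p * ip (C q) p)"
    by (simp add: tA tC mult.commute)
  also have "\<dots> = (\<Sum>q\<in>B. ip (A q) (C q))"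
    by (subst sum.swap) (simp flip: parseval)
  finally show ?thesis .
qed

lemma gl_inner_sum_left:
  assumes "\<And>i. i \<in> I \<Longrightarrow> A i \<in> gl_on \<kk> \<pp>" "C \<in> gl_on \<kk> \<pp>"
  shows "gl_inner \<kk> \<pp> ip (\<Sum>i\<in>I. c i *\<^sub>R A i) C = (\<Sum>i\<in>I. c i * gl_inner \<kk> \<pp> ip (A i) C)"
proof -
  have "(\<Sum>i\<in>I. c i *\<^sub>R A i) \<in> gl_on \<kk> \<pp>"
    using assms by (intro subspace_sum[OF gl_on_subspace] subspace_scale[OF gl_on_subspace])
  then have "gl_inner \<kk> \<pp> ip (\<Sum>i\<in>I. c i *\<^sub>R A i) C = (\<Sum>p\<in>B. \<Sum>i\<in>I. c i * ip (A i p) (C p))"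
    using assms by (simp add: gl_inner_eq blinfun.sum_left blinfun.scaleR_left ip_simps)
  also have "\<dots> = (\<Sum>i\<in>I. c i * gl_inner \<kk> \<pp> ip (A i) C)"
    using assms by (subst sum.swap) (simp add: gl_inner_eq sum_distrib_left)
  finally show ?thesis .
qed

lemma gl_orthonormal_independent:
  assumes V: "finite V" "V \<subseteq> gl_on \<kk> \<pp>"
    and on: "\<And>A C. A \<in> V \<Longrightarrow> C \<in> V \<Longrightarrow> gl_inner \<kk> \<pp> ip A C = (if A = C then 1 else 0)"
  shows "independent V"
proof
  assume "dependent V"
  then obtain u C where C: "C \<in> V" "u C \<noteq> 0" "(\<Sum>A\<in>V. u A *\<^sub>R A) = 0"
    using dependent_finite[OF V(1)] by blast
  have "gl_inner \<kk> \<pp> ip (\<Sum>A\<in>V. u A *\<^sub>R A) C = (\<Sum>A\<in>V. u A * gl_inner \<kk> \<pp> ip A C)"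
    using V C by (intro gl_inner_sum_left) auto
  also have "\<dots> = (\<Sum>A\<in>V. if A = C then u A else 0)"
    using C by (intro sum.cong refl) (simp add: on)
  also have "\<dots> = u C" using V C by simp
  finally have "gl_inner \<kk> \<pp> ip 0 C = u C" using C by simp
  moreover have "gl_inner \<kk> \<pp> ip 0 C = 0"
    using V C subspace_0[OF gl_on_subspace] by (subst gl_inner_eq) (auto simp: ip_simps)
  ultimately show False using C by simp
qed

lemma gl_representation:
  assumes V: "finite V" "V \<subseteq> gl_on \<kk> \<pp>" "independent V"
    and on: "\<And>A C. A \<in> V \<Longrightarrow> C \<in> V \<Longrightarrow> gl_inner \<kk> \<pp> ip A C = (if A = C then 1 else 0)"
    and D: "D \<in> span V" and C: "C \<in> V"
  shows "representation V D C = gl_inner \<kk> \<pp> ip D C"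
proof -
  have "gl_inner \<kk> \<pp> ip D C = gl_inner \<kk> \<pp> ip (\<Sum>A\<in>V. representation V D A *\<^sub>R A) C"
    using sum_representation_eq[OF V(3) D V(1) order_refl] by simp
  also have "\<dots> = (\<Sum>A\<in>V. representation V D A * gl_inner \<kk> \<pp> ip A C)"
    using V C by (intro gl_inner_sum_left) auto
  also have "\<dots> = (\<Sum>A\<in>V. if A = C then representation V D A else 0)"
    using C by (intro sum.cong refl) (simp add: on)
  also have "\<dots> = representation V D C" using V C by simp
  finally show ?thesis ..
qed

text \<open>The symmetrised rank-one map. In the trace inner product it represents the functional
  reading off the entry \<open>ip (C X) Y\<close> of a symmetric \<open>C\<close>, see
  \<open>gl_inner_sym_prod\<close>.\<close>

definition sym_prod :: "'e \<Rightarrow> 'e \<Rightarrow> 'e \<Rightarrow>\<^sub>L 'e" where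
  "sym_prod X Y = Blinfun (\<lambda>Z. (1/2) *\<^sub>R (ip Z X *\<^sub>R Y + ip Z Y *\<^sub>R X))"

lemma sym_prod_apply: "sym_prod X Y Z = (1/2) *\<^sub>R (ip Z X *\<^sub>R Y + ip Z Y *\<^sub>R X)"
  unfolding sym_prod_def
  by (subst Blinfun_linear) (auto simp: linear_iff ip_simps add_divide_distrib algebra_simps)

lemma sym_prod_sym: "X \<in> \<pp> \<Longrightarrow> Y \<in> \<pp> \<Longrightarrow> sym_prod X Y \<in> sym_on \<kk> \<pp> ip"
  unfolding sym_on_iff gl_on_def
  by (auto simp: sym_prod_apply ip_kk ip_simps mult.commute ip_commute
      intro!: subspace_scale[OF pp] subspace_add[OF pp])

lemma gl_inner_sym_prod:
  assumes C: "C \<in> sym_on \<kk> \<pp> ip" and X: "X \<in> \<pp>" and Y: "Y \<in> \<pp>"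
  shows "gl_inner \<kk> \<pp> ip C (sym_prod X Y) = ip (C X) Y"
proof -
  have "gl_inner \<kk> \<pp> ip C (sym_prod X Y) = (\<Sum>p\<in>B. ip (C p) (sym_prod X Y p))"
    by (intro gl_inner_eq sym_gl C sym_prod_sym X Y)
  also have "\<dots> = ((\<Sum>p\<in>B. ip X p * ip (C Y) p) + (\<Sum>p\<in>B. ip Y p * ip (C X) p)) / 2"
  proof -
    have "ip (C p) (sym_prod X Y p) = (ip X p * ip (C Y) p + ip Y p * ip (C X) p) / 2" for p
      using sym_ip[OF C, of p X] sym_ip[OF C, of p Y] ip_commute[of p]
      by (simp add: sym_prod_apply ip_simps)
    then show ?thesis by (simp only: sum.distrib sum_divide_distrib[symmetric])
  qed
  also have "\<dots> = ip (C X) Y"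
    unfolding parseval[symmetric] using sym_ip[OF C, of X Y] ip_commute[of Y "C X"] by simp
  finally show ?thesis .
qed

text \<open>For symmetric coefficients, replacing each rank-one map by its symmetrisation does not
  change the sum over all ordered pairs.\<close>

lemma sym_expand:
  assumes A: "A \<in> sym_on \<kk> \<pp> ip"
  shows "A = (\<Sum>p\<in>B. \<Sum>q\<in>B. ip (A p) q *\<^sub>R sym_prod p q)"
proof (rule gl_eqI)
  show "A \<in> gl_on \<kk> \<pp>" by (rule sym_gl[OF A])
  show "(\<Sum>p\<in>B. \<Sum>q\<in>B. ip (A p) q *\<^sub>R sym_prod p q) \<in> gl_on \<kk> \<pp>"
    by (intro subspace_sum[OF gl_on_subspace] subspace_scale[OF gl_on_subspace] sym_gl sym_prod_sym B_pp)
  fix a b assume ab: "a \<in> B" "b \<in> B"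
  have inner: "(\<Sum>q\<in>B. ip (A p) q * ip q c) = ip (A p) c" for p c
    using parseval[of "A p" c] ip_commute[of c] by simp
  have outer: "(\<Sum>p\<in>B. ip c p * ip (A p) d) = ip c (A d)" for c d
    using parseval[of c "A d"] sym_ip[OF A, of _ d] ip_commute[of _ "A d"] by simp
  have "ip ((\<Sum>p\<in>B. \<Sum>q\<in>B. ip (A p) q *\<^sub>R sym_prod p q) a) b =
     (\<Sum>p\<in>B. \<Sum>q\<in>B. ip (A p) q * ((ip a p * ip q b + ip a q * ip p b) / 2))"
    by (simp add: blinfun.sum_left blinfun.scaleR_left sym_prod_apply ip_simps)
  also have "\<dots> = (\<Sum>p\<in>B. ip a p * (\<Sum>q\<in>B. ip (A p) q * ip q b) / 2 +
      ip b p * (\<Sum>q\<in>B. ip (A p) q * ip q a) / 2)"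
    unfolding sum_distrib_left sum_divide_distrib sum.distrib[symmetric]
    by (intro sum.cong refl) (simp only: ip_commute[of a "_ :: 'e"] ip_commute[of b "_ :: 'e"], simp add: field_simps)
  also have "\<dots> = ((\<Sum>p\<in>B. ip a p * ip (A p) b) + (\<Sum>p\<in>B. ip b p * ip (A p) a)) / 2"
    unfolding inner sum_divide_distrib add_divide_distrib sum.distrib ..
  also have "\<dots> = ip (A a) b"
    unfolding outer using sym_ip[OF A, of a b] ip_commute[of b "A a"] by simp
  finally show "ip (A a) b = ip ((\<Sum>p\<in>B. \<Sum>q\<in>B. ip (A p) q *\<^sub>R sym_prod p q) a) b" ..
qed

lemma sym_riesz_unique:
  assumes "C \<in> sym_on \<kk> \<pp> ip" "D \<in> sym_on \<kk> \<pp> ip"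
    and "\<And>A. A \<in> sym_on \<kk> \<pp> ip \<Longrightarrow> gl_inner \<kk> \<pp> ip C A = gl_inner \<kk> \<pp> ip D A"
  shows "C = D"
  using assms sym_prod_sym B_pp gl_inner_sym_prod by (intro gl_eqI sym_gl) metis+

text \<open>Provides the existence behind the definite descriptions \<open>moment_map\<close> and
  \<open>L_op\<close>; uniqueness is \<open>sym_riesz_unique\<close>.\<close>

lemma sym_riesz:
  assumes F: "linear F"
  obtains C where "C \<in> sym_on \<kk> \<pp> ip" "\<And>A. A \<in> sym_on \<kk> \<pp> ip \<Longrightarrow> gl_inner \<kk> \<pp> ip C A = F A"
proof -
  have sym_prod_comm: "sym_prod X Y = sym_prod Y X" for X Y by (simp add: sym_prod_def add.commute)
  \<comment> \<open>The matrix entries of the representer are forced by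
    \<open>gl_inner_sym_prod\<close>: they must be the values of \<open>F\<close> on the symmetrised
    rank-one maps.\<close>
  define C where "C = Blinfun (\<lambda>X. \<Sum>p\<in>B. \<Sum>q\<in>B. (ip X p * F (sym_prod p q)) *\<^sub>R q)"
  have "linear (\<lambda>X. \<Sum>p\<in>B. \<Sum>q\<in>B. (ip X p * F (sym_prod p q)) *\<^sub>R q)"
    by (auto simp: linear_iff ip_simps distrib_right scaleR_add_left sum.distrib scaleR_sum_right mult.assoc)
  then have Ca: "C X = (\<Sum>p\<in>B. \<Sum>q\<in>B. (ip X p * F (sym_prod p q)) *\<^sub>R q)" for X by (simp add: C_def)
  have gl: "C \<in> gl_on \<kk> \<pp>"
    by (auto simp: gl_on_def Ca ip_kk B_pp intro!: subspace_sum[OF pp] subspace_scale[OF pp])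
  have CS: "ip (C p) X = (\<Sum>q\<in>B. F (sym_prod p q) * ip q X)" if "p \<in> B" for p X
  proof -
    have "ip (C p) X = (\<Sum>p'\<in>B. ip p p' * (\<Sum>q\<in>B. F (sym_prod p' q) * ip q X))"
      by (simp add: Ca ip_simps sum_distrib_left mult.assoc)
    also have "\<dots> = (\<Sum>q\<in>B. F (sym_prod p q) * ip q X)"
      using that finite_B by (simp add: ip_B if_distrib[of "\<lambda>t. t * _"] cong: if_cong)
    finally show ?thesis .
  qed
  have sym: "C \<in> sym_on \<kk> \<pp> ip"
    unfolding sym_on_iff
  proof (intro conjI allI gl)
    fix X Y
    have "ip (C X) Y = (\<Sum>p\<in>B. \<Sum>q\<in>B. ip X p * F (sym_prod p q) * ip q Y)" for X Y
      by (simp add: Ca ip_simps)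
    note e = this
    have "ip X (C Y) = (\<Sum>p\<in>B. \<Sum>q\<in>B. ip Y p * F (sym_prod p q) * ip q X)"
      unfolding ip_commute[of X] e ..
    also have "\<dots> = (\<Sum>q\<in>B. \<Sum>p\<in>B. ip Y p * F (sym_prod p q) * ip q X)" by (rule sum.swap)
    also have "\<dots> = ip (C X) Y" unfolding e
    proof (intro sum.cong refl)
      fix p q
      show "ip Y p * F (sym_prod p q) * ip q X = ip X q * F (sym_prod q p) * ip p Y"
        using sym_prod_comm[of p q] ip_commute[of Y p] ip_commute[of q X] by simp
    qed
    finally show "ip (C X) Y = ip X (C Y)" ..
  qed
  have "gl_inner \<kk> \<pp> ip C A = F A" if A: "A \<in> sym_on \<kk> \<pp> ip" for A
  proof -
    have "F A = F (\<Sum>p\<in>B. \<Sum>q\<in>B. ip (A p) q *\<^sub>R sym_prod p q)" using sym_expand[OF A] by simp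
    also have "\<dots> = (\<Sum>p\<in>B. \<Sum>q\<in>B. F (sym_prod p q) * ip q (A p))"
      by (simp add: linear_sum[OF F] linear_scale[OF F] ip_commute mult.commute)
    also have "\<dots> = (\<Sum>p\<in>B. ip (C p) (A p))" by (simp add: CS)
    also have "\<dots> = gl_inner \<kk> \<pp> ip C A" by (simp add: gl_inner_eq gl sym_gl A)
    finally show ?thesis ..
  qed
  with sym show thesis by (rule that)
qed

lemma linear_tensor_inner_theta:
  assumes \<mu>: "bilinear \<mu>" and \<eta>: "bilinear \<eta>"
  shows "linear (\<lambda>A. tensor_inner \<pp> ip \<eta> (gl_theta A \<mu>))"
  by (auto simp: linear_iff tensor_inner_eq[OF \<eta> bilinear_gl_theta[OF \<mu>]] gl_theta_linear[OF \<mu>] ip_simps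
      sum.distrib sum_distrib_left)

lemma tensor_inner_commute:
  assumes "bilinear \<eta>" "bilinear \<nu>"
  shows "tensor_inner \<pp> ip \<eta> \<nu> = tensor_inner \<pp> ip \<nu> \<eta>"
  using assms by (simp add: tensor_inner_eq ip_commute)

text \<open>Contracting \<open>A\<close> with a symmetric form sees only the symmetric part of
  \<open>A\<close>: transposing swaps the two summation indices.\<close>

lemma transp_on_sum:
  assumes A: "A \<in> gl_on \<kk> \<pp>" and f: "bilinear f" and f_commute: "\<And>X Y. f X Y = f Y X"
  shows "(\<Sum>p\<in>B. f (transp_on \<kk> \<pp> ip A p) p) = (\<Sum>p\<in>B. f (A p) p :: real)"
proof -
  interpret f: bounded_bilinear f using f bilinear_conv_bounded_bilinear by blast
  let ?A = "transp_on \<kk> \<pp> ip A"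
  have tA: "ip (?A p) q = ip (A q) p" for p q
    using transp_on_gl(2)[OF A, of q p] ip_commute[of q "?A p"] by simp
  have e: "f (C p) p = (\<Sum>q\<in>B. ip (C p) q * f q p)" if C: "C \<in> gl_on \<kk> \<pp>" for C p
    by (subst pp_expand[OF glD(1)[OF C, of p]]) (simp add: f.sum_left f.scaleR_left)
  have "(\<Sum>p\<in>B. f (?A p) p) = (\<Sum>p\<in>B. \<Sum>q\<in>B. ip (A q) p * f q p)"
    by (simp add: e[OF transp_on_gl(1)[OF A]] tA)
  also have "\<dots> = (\<Sum>q\<in>B. \<Sum>p\<in>B. ip (A q) p * f p q)"
    by (subst sum.swap) (simp add: f_commute)
  also have "\<dots> = (\<Sum>q\<in>B. f (A q) q)" by (simp add: e[OF A])
  finally show ?thesis .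
qed

text \<open>Transposing \<open>A\<close> transposes \<theta>(A), and a quadratic expression does not
  notice. Concretely, each of the three terms of \<theta> contracts \<open>A\<close> with a
  symmetric form.\<close>

lemma tensor_inner_theta_transp:
  assumes \<mu>: "bilinear \<mu>" and A: "A \<in> gl_on \<kk> \<pp>"
  shows "tensor_inner \<pp> ip (gl_theta (transp_on \<kk> \<pp> ip A) \<mu>) \<mu> = tensor_inner \<pp> ip (gl_theta A \<mu>) \<mu>"
proof -
  interpret \<mu>: bounded_bilinear \<mu> using \<mu> bilinear_conv_bounded_bilinear by blast
  let ?A = "transp_on \<kk> \<pp> ip A"
  have e: "tensor_inner \<pp> ip (gl_theta C \<mu>) \<mu> =
     (\<Sum>p\<in>B. \<Sum>q\<in>B. ip (C (\<mu> p q)) (\<mu> p q)) - (\<Sum>p\<in>B. \<Sum>q\<in>B. ip (\<mu> (C p) q) (\<mu> p q))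
      - (\<Sum>q\<in>B. \<Sum>p\<in>B. ip (\<mu> p (C q)) (\<mu> p q))" for C
    by (subst sum.swap[of _ B B]) (simp add: tensor_inner_eq[OF bilinear_gl_theta[OF \<mu>] \<mu>] gl_theta_def ip_simps sum_subtractf)
  have 1: "ip (?A X) X = ip (A X) X" for X
    using transp_on_gl(2)[OF A, of X X] ip_commute[of X] by simp
  have 2: "(\<Sum>p\<in>B. \<Sum>q\<in>B. ip (\<mu> (?A p) q) (\<mu> p q)) = (\<Sum>p\<in>B. \<Sum>q\<in>B. ip (\<mu> (A p) q) (\<mu> p q))"
    by (rule transp_on_sum[OF A, of "\<lambda>X Y. \<Sum>q\<in>B. ip (\<mu> X q) (\<mu> Y q)"])
       (auto simp: bilinear_def linear_iff \<mu>.add_left \<mu>.scaleR_left ip_simps sum.distrib sum_distrib_left ip_commute)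
  have 3: "(\<Sum>p\<in>B. \<Sum>q\<in>B. ip (\<mu> q (?A p)) (\<mu> q p)) = (\<Sum>p\<in>B. \<Sum>q\<in>B. ip (\<mu> q (A p)) (\<mu> q p))"
    by (rule transp_on_sum[OF A, of "\<lambda>X Y. \<Sum>q\<in>B. ip (\<mu> q X) (\<mu> q Y)"])
       (auto simp: bilinear_def linear_iff \<mu>.add_right \<mu>.scaleR_right ip_simps sum.distrib sum_distrib_left ip_commute)
  show ?thesis unfolding e 1 2 3 ..
qed

text \<open>The Riesz theorem tests only against symmetric maps, the definition against all of
  \<open>gl_on\<close>. The sum of \<open>A\<close> and its transpose bridges the gap, since both
  sides take equal values on the two summands.\<close>

lemma moment_map:
  assumes \<mu>: "bilinear \<mu>"
  shows "moment_map \<kk> \<pp> ip \<mu> \<in> sym_on \<kk> \<pp> ip"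
    and "A \<in> gl_on \<kk> \<pp> \<Longrightarrow>
      gl_inner \<kk> \<pp> ip (moment_map \<kk> \<pp> ip \<mu>) A = 1/4 * tensor_inner \<pp> ip (gl_theta A \<mu>) \<mu>"
proof -
  define F where "F A = 1/4 * tensor_inner \<pp> ip (gl_theta A \<mu>) \<mu>" for A
  have F_eq: "F = (\<lambda>A. (1/4) *\<^sub>R tensor_inner \<pp> ip \<mu> (gl_theta A \<mu>))"
    by (simp add: F_def fun_eq_iff tensor_inner_commute \<mu> bilinear_gl_theta)
  have F: "linear F"
    unfolding F_eq by (intro linear_compose_scale_right linear_tensor_inner_theta \<mu>)
  obtain C where C: "C \<in> sym_on \<kk> \<pp> ip" "\<And>A. A \<in> sym_on \<kk> \<pp> ip \<Longrightarrow> gl_inner \<kk> \<pp> ip C A = F A"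
    using sym_riesz[OF F] by blast
  have gl: "gl_inner \<kk> \<pp> ip C A = F A" if A: "A \<in> gl_on \<kk> \<pp>" for A
  proof -
    let ?A = "transp_on \<kk> \<pp> ip A"
    note tA = transp_on_gl[OF A]
    have tA': "ip (?A X) Y = ip X (A Y)" for X Y
      using tA(2)[of Y X] ip_commute[of X] ip_commute[of Y] by simp
    have "A + ?A \<in> sym_on \<kk> \<pp> ip"
      unfolding sym_on_iff
      using subspace_add[OF gl_on_subspace A tA(1)] by (auto simp: blinfun.add_left ip_simps tA(2) tA')
    then have "gl_inner \<kk> \<pp> ip C (A + ?A) = F (A + ?A)" by (rule C(2))
    also have "\<dots> = F A + F ?A" using F by (rule linear_add)
    also have "\<dots> = 2 * F A" using tensor_inner_theta_transp[OF \<mu> A] by (simp add: F_def)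
    finally have "(\<Sum>p\<in>B. ip (C p) (A p)) + (\<Sum>p\<in>B. ip (?A p) (C p)) = 2 * F A"
      using subspace_add[OF gl_on_subspace A tA(1)]
      by (simp add: gl_inner_eq sym_gl[OF C(1)] blinfun.add_left ip_simps sum.distrib ip_commute)
    moreover have "(\<Sum>p\<in>B. ip (?A p) (C p)) = (\<Sum>p\<in>B. ip (A p) (C p))"
      by (rule transp_on_sum[OF A, of "\<lambda>X Y. ip X (C Y)"])
         (auto simp: bilinear_def linear_iff ip_simps blinfun.add_right blinfun.scaleR_right
           sym_ip[OF C(1), symmetric], metis ip_commute sym_ip[OF C(1)])
    ultimately show ?thesis using A by (simp add: gl_inner_eq sym_gl[OF C(1)] ip_commute)
  qed
  have M: "moment_map \<kk> \<pp> ip \<mu> = C"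
    unfolding moment_map_def F_def[symmetric]
  proof (rule the_equality)
    show "C \<in> sym_on \<kk> \<pp> ip \<and> (\<forall>A\<in>gl_on \<kk> \<pp>. gl_inner \<kk> \<pp> ip C A = F A)" using C(1) gl by blast
    fix D assume "D \<in> sym_on \<kk> \<pp> ip \<and> (\<forall>A\<in>gl_on \<kk> \<pp>. gl_inner \<kk> \<pp> ip D A = F A)"
    then show "D = C" using C sym_gl by (intro sym_riesz_unique) auto
  qed
  show "moment_map \<kk> \<pp> ip \<mu> \<in> sym_on \<kk> \<pp> ip" using C(1) M by simp
  show "gl_inner \<kk> \<pp> ip (moment_map \<kk> \<pp> ip \<mu>) A = 1/4 * tensor_inner \<pp> ip (gl_theta A \<mu>) \<mu>"
    if "A \<in> gl_on \<kk> \<pp>" using gl[OF that] M by (simp add: F_def)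
qed

definition L_form :: "('e \<Rightarrow> 'e \<Rightarrow> 'e) \<Rightarrow> ('e \<Rightarrow>\<^sub>L 'e) \<Rightarrow> ('e \<Rightarrow>\<^sub>L 'e) \<Rightarrow> real" where
  "L_form \<mu> A C = 1/2 * tensor_inner \<pp> ip (gl_theta A \<mu>) (gl_theta C \<mu>) +
     2 * trace_on \<pp> (moment_map \<kk> \<pp> ip \<mu> o\<^sub>L A o\<^sub>L C)"

lemma L_op:
  assumes \<mu>: "bilinear \<mu>"
  shows "L_op \<kk> \<pp> ip \<mu> A \<in> sym_on \<kk> \<pp> ip"
    and "C \<in> sym_on \<kk> \<pp> ip \<Longrightarrow> gl_inner \<kk> \<pp> ip (L_op \<kk> \<pp> ip \<mu> A) C = L_form \<mu> A C"
proof -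
  let ?M = "moment_map \<kk> \<pp> ip \<mu>"
  have M: "?M \<in> gl_on \<kk> \<pp>" using moment_map(1)[OF \<mu>] sym_gl by blast
  have tr: "trace_on \<pp> (?M o\<^sub>L A o\<^sub>L C) = (\<Sum>p\<in>B. ip (?M (A (C p))) p)" for C
    by (subst trace_on_eq) (auto simp: linear_blinfun glD M)
  have "linear (\<lambda>C. trace_on \<pp> (?M o\<^sub>L A o\<^sub>L C))"
    unfolding tr by (auto simp: linear_iff blinfun.add_left blinfun.add_right blinfun.scaleR_left
        blinfun.scaleR_right ip_simps sum.distrib sum_distrib_left)
  moreover have "linear (\<lambda>C. tensor_inner \<pp> ip (gl_theta A \<mu>) (gl_theta C \<mu>))"
    by (intro linear_tensor_inner_theta \<mu> bilinear_gl_theta)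
  ultimately have F: "linear (L_form \<mu> A)"
    by (auto simp: linear_iff L_form_def algebra_simps)
  obtain D where D: "D \<in> sym_on \<kk> \<pp> ip" "\<And>C. C \<in> sym_on \<kk> \<pp> ip \<Longrightarrow> gl_inner \<kk> \<pp> ip D C = L_form \<mu> A C"
    using sym_riesz[OF F] by blast
  have L: "L_op \<kk> \<pp> ip \<mu> A = D"
    unfolding L_op_def L_form_def[symmetric]
  proof (rule the_equality)
    show "D \<in> sym_on \<kk> \<pp> ip \<and> (\<forall>C\<in>sym_on \<kk> \<pp> ip. gl_inner \<kk> \<pp> ip D C = L_form \<mu> A C)" using D by blast
    fix D' assume "D' \<in> sym_on \<kk> \<pp> ip \<and> (\<forall>C\<in>sym_on \<kk> \<pp> ip. gl_inner \<kk> \<pp> ip D' C = L_form \<mu> A C)"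
    then show "D' = D" using D by (intro sym_riesz_unique) auto
  qed
  show "L_op \<kk> \<pp> ip \<mu> A \<in> sym_on \<kk> \<pp> ip" using D(1) L by simp
  show "gl_inner \<kk> \<pp> ip (L_op \<kk> \<pp> ip \<mu> A) C = L_form \<mu> A C" if "C \<in> sym_on \<kk> \<pp> ip"
    using D(2)[OF that] L by simp
qed

lemma L_form_scaleR:
  assumes \<mu>: "bilinear \<mu>"
  shows "L_form \<mu> (a *\<^sub>R A) (c *\<^sub>R C) = a * c * L_form \<mu> A C"
proof -
  have M: "moment_map \<kk> \<pp> ip \<mu> \<in> gl_on \<kk> \<pp>" using moment_map(1)[OF \<mu>] sym_gl by blast
  have tr: "trace_on \<pp> (moment_map \<kk> \<pp> ip \<mu> o\<^sub>L A o\<^sub>L C) = (\<Sum>p\<in>B. ip (moment_map \<kk> \<pp> ip \<mu> (A (C p))) p)" for A C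
    by (subst trace_on_eq) (auto simp: linear_blinfun glD M)
  show ?thesis
    unfolding L_form_def tr tensor_inner_eq[OF bilinear_gl_theta[OF \<mu>] bilinear_gl_theta[OF \<mu>]]
    by (simp add: gl_theta_linear[OF \<mu>] ip_simps blinfun.scaleR_left blinfun.scaleR_right
        sum_distrib_left algebra_simps)
qed

end

section \<open>Equivariance of the moment map and of \<open>L_op\<close> under isometries\<close>

locale split_metric_isometry = split_metric +
  fixes \<rho> :: "'a \<Rightarrow> 'a"
  assumes lin: "linear \<rho>" and \<rho>_pp: "X \<in> \<pp> \<Longrightarrow> \<rho> X \<in> \<pp>" and \<rho>_kk: "X \<in> \<kk> \<Longrightarrow> \<rho> X \<in> \<kk>"
    and \<rho>_ip: "ip (\<rho> X) (\<rho> Y) = ip X Y"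
begin

lemma inj_on_pp: "inj_on \<rho> \<pp>"
proof (rule linear_inj_on_iff_eq_0[OF lin pp, THEN iffD2], intro ballI impI)
  fix X assume "X \<in> \<pp>" "\<rho> X = 0"
  then show "X = 0" using \<rho>_ip[of X X] \<rho>_ip[of 0 0] ip_pos[of X] linear_0[OF lin] ip_kk[OF subspace_0[OF kk]] by fastforce
qed

lemma onb_image: "orthonormal_basis ip \<pp> (\<rho> ` B)"
proof -
  have B: "independent B" "span B = \<pp>" using onb by (auto simp: orthonormal_basis_def)
  have "span (\<rho> ` B) = \<rho> ` \<pp>" using linear_span_image[OF lin, of B] B by simp
  also have "\<dots> = \<pp>"
  proof (rule subspace_dim_equal)
    show "dim \<pp> \<le> dim (\<rho> ` \<pp>)"
      using dim_image_eq[OF lin, of \<pp>] inj_on_pp pp by (simp add: span_eq_iff[THEN iffD2])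
  qed (use pp \<rho>_pp linear_subspace_image[OF lin pp] in auto)
  finally have "span (\<rho> ` B) = \<pp>" .
  moreover have "independent (\<rho> ` B)"
    using linear_independent_injective_image[OF lin, of B] B inj_on_pp by simp
  moreover have "ip x y = (if x = y then 1 else 0)" if "x \<in> \<rho> ` B" "y \<in> \<rho> ` B" for x y
    using that inj_on_pp B_pp by (auto simp: \<rho>_ip ip_B inj_on_eq_iff)
  ultimately show ?thesis by (simp add: orthonormal_basis_def)
qed

interpretation image: split_metric \<kk> \<pp> ip "\<rho> ` B"
  using kk pp split bilin ip_commute ip_kk ip_pos onb_image by unfold_locales

lemma inj_on_B: "inj_on \<rho> B"
  using inj_on_pp B_pp by (auto intro: inj_on_subset)

lemma tensor_inner_isometry:
  assumes "bilinear \<eta>" "bilinear \<nu>" "bilinear \<eta>'" "bilinear \<nu>'"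
    and "\<And>X Y. \<eta>' (\<rho> X) (\<rho> Y) = \<rho> (\<eta> X Y)" "\<And>X Y. \<nu>' (\<rho> X) (\<rho> Y) = \<rho> (\<nu> X Y)"
  shows "tensor_inner \<pp> ip \<eta>' \<nu>' = tensor_inner \<pp> ip \<eta> \<nu>"
  using assms
  by (simp add: image.tensor_inner_eq[of \<eta>' \<nu>'] tensor_inner_eq[of \<eta> \<nu>] sum.reindex[OF inj_on_B] \<rho>_ip)

lemma trace_on_isometry:
  assumes "linear f" "linear f'" "\<And>X. f X \<in> \<pp>" "\<And>X. f' X \<in> \<pp>" "\<And>X. f' (\<rho> X) = \<rho> (f X)"
  shows "trace_on \<pp> f' = trace_on \<pp> f"
  using assms
  by (simp add: image.trace_on_eq[of f'] trace_on_eq[of f] sum.reindex[OF inj_on_B] \<rho>_ip)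

lemma gl_theta_isometry:
  fixes A A' :: "'a \<Rightarrow>\<^sub>L 'a"
  assumes "\<And>X Y. \<mu> (\<rho> X) (\<rho> Y) = \<rho> (\<mu> X Y)" "\<And>X. A' (\<rho> X) = \<rho> (A X)"
  shows "gl_theta A' \<mu> (\<rho> X) (\<rho> Y) = \<rho> (gl_theta A \<mu> X Y)"
  using assms by (simp add: gl_theta_def linear_diff[OF lin])

lemma sym_prod_isometry: "sym_prod (\<rho> X) (\<rho> Y) (\<rho> Z) = \<rho> (sym_prod X Y Z)"
  by (simp add: sym_prod_apply \<rho>_ip linear_add[OF lin] linear_scale[OF lin])

text \<open>The representer of an invariant functional is equivariant: its matrix entries are values
  of \<open>F\<close> on \<open>sym_prod\<close>, and \<rho> carries \<open>sym_prod X Y\<close> to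
  \<open>sym_prod (\<rho> X) (\<rho> Y)\<close>. Phrasing invariance through pairs \<open>A\<close>,
  \<open>A'\<close> intertwined by \<rho> avoids the inverse of \<rho>.\<close>

lemma commute_isometryI:
  fixes C :: "'a \<Rightarrow>\<^sub>L 'a"
  assumes C: "C \<in> sym_on \<kk> \<pp> ip"
    and F: "\<And>A. A \<in> sym_on \<kk> \<pp> ip \<Longrightarrow> gl_inner \<kk> \<pp> ip C A = F A"
    and inv: "\<And>A A'. A \<in> sym_on \<kk> \<pp> ip \<Longrightarrow> A' \<in> sym_on \<kk> \<pp> ip \<Longrightarrow> (\<And>X. blinfun_apply A' (\<rho> X) = \<rho> (A X)) \<Longrightarrow> F A' = F A"
  shows "C (\<rho> X) = \<rho> (C X)"
proof -
  have ip: "ip (C (\<rho> X)) (\<rho> Y) = ip (C X) Y" if "X \<in> \<pp>" "Y \<in> \<pp>" for X Y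
  proof -
    have "F (sym_prod (\<rho> X) (\<rho> Y)) = F (sym_prod X Y)" using that by (intro inv sym_prod_sym sym_prod_isometry \<rho>_pp)
    then show ?thesis
      using F sym_prod_sym gl_inner_sym_prod[OF C] that \<rho>_pp by metis
  qed
  have "C (\<rho> (pr X)) = \<rho> (C (pr X))"
  proof (rule image.pp_eqI)
    fix q assume "q \<in> \<rho> ` B"
    then show "ip (C (\<rho> (pr X))) q = ip (\<rho> (C (pr X))) q"
      using ip[OF pr_pp] B_pp \<rho>_ip by auto
  qed (use glD(1)[OF sym_gl[OF C]] \<rho>_pp in auto)
  moreover have "C (\<rho> (X - pr X)) = 0"
    using glD(2)[OF sym_gl[OF C]] \<rho>_kk diff_pr by blast
  ultimately show ?thesis
    by (simp add: linear_diff[OF lin] blinfun.diff_right gl_pr[OF sym_gl[OF C]])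
qed

text \<open>\<open>commute_isometryI\<close> serves twice: for the moment map, which enters the
  trace term of \<open>L_form\<close>, and then for \<open>L_op\<close> itself.\<close>

lemma L_op_commute_isometry:
  fixes A :: "'a \<Rightarrow>\<^sub>L 'a"
  assumes \<mu>: "bilinear \<mu>" and \<rho>_\<mu>: "\<And>X Y. \<mu> (\<rho> X) (\<rho> Y) = \<rho> (\<mu> X Y)"
    and A: "\<And>X. A (\<rho> X) = \<rho> (A X)"
  shows "L_op \<kk> \<pp> ip \<mu> A (\<rho> X) = \<rho> (L_op \<kk> \<pp> ip \<mu> A X)"
proof (rule commute_isometryI[where F="L_form \<mu> A"])
  let ?M = "moment_map \<kk> \<pp> ip \<mu>"
  have M: "?M (\<rho> X) = \<rho> (?M X)" for X
  proof (rule commute_isometryI[where F="\<lambda>A. 1/4 * tensor_inner \<pp> ip (gl_theta A \<mu>) \<mu>"])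
    show "1/4 * tensor_inner \<pp> ip (gl_theta C' \<mu>) \<mu> = 1/4 * tensor_inner \<pp> ip (gl_theta C \<mu>) \<mu>"
      if "\<And>X. C' (\<rho> X) = \<rho> (C X)" for C C' :: "'a \<Rightarrow>\<^sub>L 'a"
      by (intro arg_cong[where f="\<lambda>t. 1/4 * t"] tensor_inner_isometry bilinear_gl_theta gl_theta_isometry
          \<mu> \<rho>_\<mu> that)
  qed (use moment_map[OF \<mu>] sym_gl in auto)
  have M_gl: "?M \<in> gl_on \<kk> \<pp>" using moment_map(1)[OF \<mu>] sym_gl by blast
  show "L_form \<mu> A C' = L_form \<mu> A C" if "\<And>X. C' (\<rho> X) = \<rho> (C X)" for C C' :: "'a \<Rightarrow>\<^sub>L 'a"
  proof -
    have "tensor_inner \<pp> ip (gl_theta A \<mu>) (gl_theta C' \<mu>) = tensor_inner \<pp> ip (gl_theta A \<mu>) (gl_theta C \<mu>)"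
      using \<mu> \<rho>_\<mu> A that by (intro tensor_inner_isometry bilinear_gl_theta gl_theta_isometry)
    moreover have "trace_on \<pp> (?M o\<^sub>L A o\<^sub>L C') = trace_on \<pp> (?M o\<^sub>L A o\<^sub>L C)"
      by (intro trace_on_isometry linear_blinfun) (auto simp: glD[OF M_gl] M A that)
    ultimately show ?thesis by (simp add: L_form_def)
  qed
qed (use L_op[OF \<mu>] in auto)

end

section \<open>Diagonal metrics\<close>

text \<open>A maximiser of the Rayleigh quotient is an eigenvector. The quotient is invariant under
  scaling, so the Euclidean sphere serves as compact domain although symmetry is with respect to
  \<open>Q\<close>. The form \<open>g\<close> is nonnegative on \<open>V\<close> and vanishes at
  \<open>v\<close>, which puts \<open>v\<close> in its radical.\<close>

lemma self_adjoint_eigenvector: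
  fixes T :: "'e::euclidean_space \<Rightarrow> 'e"
  assumes Q: "inner_product Q" and V: "subspace V" "V \<noteq> {0}"
    and T: "linear T" and TV: "\<And>X. X \<in> V \<Longrightarrow> T X \<in> V"
    and sym: "\<And>X Y. X \<in> V \<Longrightarrow> Y \<in> V \<Longrightarrow> Q (T X) Y = Q X (T Y)"
  obtains \<kappa> v where "v \<in> V" "v \<noteq> 0" "T v = \<kappa> *\<^sub>R v"
proof -
  interpret Q: bounded_bilinear Q
    using inner_product_bilinear[OF Q] bilinear_conv_bounded_bilinear by blast
  interpret T: bounded_linear T using T by (simp add: linear_conv_bounded_linear)
  note Q_simps = Q.add_left Q.add_right Q.scaleR_left Q.scaleR_right Q.diff_left Q.diff_right
    Q.zero_left Q.zero_right T.add T.scaleR T.diff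
  have Q_commute: "Q X Y = Q Y X" and Q_pos: "X \<noteq> 0 \<Longrightarrow> Q X X > 0" for X Y
    using Q by (auto simp: inner_product_def)
  let ?K = "V \<inter> sphere 0 1"
  have "compact ?K" using V(1) by (intro closed_Int_compact closed_subspace) (auto simp: compact_sphere)
  moreover have "?K \<noteq> {}"
  proof -
    obtain w where "w \<in> V" "w \<noteq> 0" using V subspace_0 by blast
    then have "w /\<^sub>R norm w \<in> ?K" using V(1) by (auto intro: subspace_scale)
    then show ?thesis by blast
  qed
  moreover have "continuous_on ?K (\<lambda>X. Q (T X) X / Q X X)"
    using Q_pos by (intro continuous_on_divide Q.continuous_on T.continuous_on continuous_on_id)
      (metis IntD2 less_irrefl mem_sphere_0 norm_zero zero_neq_one)
  ultimately obtain v where v: "v \<in> ?K" "\<And>X. X \<in> ?K \<Longrightarrow> Q (T X) X / Q X X \<le> Q (T v) v / Q v v"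
    using continuous_attains_sup[of ?K "\<lambda>X. Q (T X) X / Q X X"] by blast
  define \<kappa> where "\<kappa> = Q (T v) v / Q v v"
  have v0: "v \<noteq> 0" "v \<in> V" using v(1) by auto
  define g where "g X Y = \<kappa> * Q X Y - Q (T X) Y" for X Y
  have g_pos: "g X X \<ge> 0" if X: "X \<in> V" for X
  proof (cases "X = 0")
    case False
    let ?X = "X /\<^sub>R norm X"
    have "?X \<in> ?K" using X False V(1) by (auto intro: subspace_scale)
    then have "Q (T ?X) ?X / Q ?X ?X \<le> \<kappa>" unfolding \<kappa>_def by (rule v(2))
    also have "Q (T ?X) ?X / Q ?X ?X = Q (T X) X / Q X X" using False by (simp add: Q_simps)
    finally show ?thesis using Q_pos[OF False] by (simp add: g_def field_simps)
  qed (simp add: g_def Q_simps)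
  have gv: "g v v = 0" using Q_pos[OF v0(1)] by (simp add: g_def \<kappa>_def)
  have g0: "g v Y = 0" if Y: "Y \<in> V" for Y
  proof (rule ccontr)
    assume a: "g v Y \<noteq> 0"
    \<comment> \<open>If \<open>g v Y\<close> were nonzero, a small multiple of \<open>Y\<close>
      added to \<open>v\<close> would make \<open>g\<close> negative. The summand 1 keeps the
      denominator of \<open>t\<close> positive even if \<open>g Y Y = 0\<close>.\<close>
    define c where "c = g Y Y + 1"
    define t where "t = - g v Y / c"
    have c: "c > 0" and gYY: "g Y Y = c - 1" using g_pos[OF Y] by (simp_all add: c_def)
    have gY: "g Y v = g v Y" using sym[OF Y v0(2)] Q_commute[of Y] by (simp add: g_def)
    have "g (v + t *\<^sub>R Y) (v + t *\<^sub>R Y) = g v v + t * g v Y + t * g Y v + t\<^sup>2 * g Y Y"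
      by (simp add: g_def Q_simps algebra_simps power2_eq_square)
    also have "\<dots> = 2 * t * g v Y + t\<^sup>2 * g Y Y" using gv gY by simp
    also have "\<dots> = - ((g v Y)\<^sup>2 / c\<^sup>2) * (c + 1)"
      unfolding gYY using c by (simp add: t_def field_simps power2_eq_square)
    also have "\<dots> < 0" using a c by (intro mult_neg_pos) auto
    finally show False using g_pos[of "v + t *\<^sub>R Y"] v0 Y V(1)
      by (simp add: subspace_add subspace_scale)
  qed
  have "Q (\<kappa> *\<^sub>R v - T v) (\<kappa> *\<^sub>R v - T v) = 0"
    using g0[of "\<kappa> *\<^sub>R v - T v"] v0 V(1) TV Q_commute[of v "T v"]
    by (simp add: g_def Q_simps subspace_diff subspace_scale)
  then have "T v = \<kappa> *\<^sub>R v" using Q_pos[of "\<kappa> *\<^sub>R v - T v"] by fastforce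
  with v0 show thesis using that by blast
qed

text \<open>The Gram operator \<open>S\<close> turns the \<open>Q\<close>-complement of
  \<open>K\<close> into the Euclidean complement of its image under \<open>S\<close>, whose
  dimension is known. Positivity makes the intersection with \<open>K\<close> trivial, so the
  dimensions fill the whole space.\<close>

lemma orthogonal_complement_splits:
  fixes Q :: "'e::euclidean_space \<Rightarrow> 'e \<Rightarrow> real"
  assumes Q: "inner_product Q" and K: "subspace K"
  shows "\<exists>Y. (\<forall>Z\<in>K. Q Y Z = 0) \<and> X - Y \<in> K"
proof -
  have lin: "linear (\<lambda>X. Q X Y)" "linear (Q Y)" for Y
    using inner_product_bilinear[OF Q] by (auto simp: bilinear_def)
  let ?P = "{Y. \<forall>Z\<in>K. Q Y Z = 0}"
  define S where "S Y = (\<Sum>b\<in>Basis. Q b Y *\<^sub>R b)" for Y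
  have S: "X \<bullet> S Y = Q X Y" for X Y
  proof -
    have "Q X Y = Q (\<Sum>b\<in>Basis. (X \<bullet> b) *\<^sub>R b) Y" by (simp add: euclidean_representation)
    also have "\<dots> = X \<bullet> S Y" by (simp add: linear_sum[OF lin(1)] linear_scale[OF lin(1)] S_def inner_sum_right mult.commute)
    finally show ?thesis ..
  qed
  have linS: "linear S"
    by (auto simp: linear_iff S_def linear_add[OF lin(2)] linear_scale[OF lin(2)] scaleR_add_left
        sum.distrib scaleR_sum_right)
  have injS: "inj S"
  proof (rule linear_injective_0[OF linS, THEN iffD2], intro allI impI)
    fix Y assume "S Y = 0"
    then have "Q Y Y = 0" using S[of Y Y] by simp
    then show "Y = 0" using Q unfolding inner_product_def by (metis less_irrefl)
  qed
  have P: "subspace ?P"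
    by (auto simp: subspace_def linear_add[OF lin(1)] linear_scale[OF lin(1)] linear_0[OF lin(1)])
  have eq: "?P = {Y \<in> UNIV. \<forall>Z\<in>S ` K. orthogonal Z Y}"
    using S by (auto simp: orthogonal_def inner_commute)
  have "dim {Y \<in> UNIV. \<forall>Z\<in>S ` K. orthogonal Z Y} + dim (S ` K) = dim (UNIV :: 'e set)"
    by (rule dim_subspace_orthogonal_to_vectors) (auto intro: linear_subspace_image linS K)
  then have "dim ?P + dim (S ` K) = DIM('e)" unfolding eq by simp
  moreover have "dim (S ` K) = dim K"
    using injS by (intro dim_image_eq linS) (auto intro: inj_on_subset)
  moreover have "?P \<inter> K = {0}"
    using Q K subspace_0[OF P] unfolding inner_product_def by (fastforce simp: subspace_0)
  then have "dim (?P \<inter> K) = 0" by simp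
  ultimately have "dim {y + z |y z. y \<in> ?P \<and> z \<in> K} = DIM('e)"
    using dim_sums_Int[OF P K] by linarith
  then have "{y + z |y z. y \<in> ?P \<and> z \<in> K} = UNIV"
    by (intro subspace_dim_equal subspace_sums[OF P K] subspace_UNIV) auto
  then obtain y z where "X = y + z" "y \<in> ?P" "z \<in> K" by blast
  then show ?thesis by auto
qed

section \<open>The metric with weights \<open>x k\<close> on the blocks, and its adapted orthonormal
  frame\<close>

locale diagonal_metric =
  fixes \<kk> \<pp> :: "'e::euclidean_space set" and Q :: "'e \<Rightarrow> 'e \<Rightarrow> real"
    and r :: nat and P E :: "nat \<Rightarrow> 'e set" and x :: "nat \<Rightarrow> real"
  assumes Q: "inner_product Q" and kk: "subspace \<kk>" and pp_def: "\<pp> = {X. \<forall>Y\<in>\<kk>. Q X Y = 0}"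
    and decomposition: "orthogonal_decomposition Q \<pp> r P"
    and E: "\<And>k. k \<in> {1..r} \<Longrightarrow> orthonormal_basis Q (P k) (E k)"
    and x_pos: "\<And>k. k \<in> {1..r} \<Longrightarrow> x k > 0"
begin

sublocale Q: bounded_bilinear Q
  using inner_product_bilinear[OF Q] bilinear_conv_bounded_bilinear by blast

lemmas Q_simps = Q.add_left Q.add_right Q.scaleR_left Q.scaleR_right Q.diff_left Q.diff_right
    Q.zero_left Q.zero_right Q.sum_left Q.sum_right

lemma Q_commute: "Q X Y = Q Y X" and Q_pos: "X \<noteq> 0 \<Longrightarrow> Q X X > 0"
  using Q by (auto simp: inner_product_def)

lemma Q_nonneg: "Q X X \<ge> 0"
  using Q_pos[of X] by (cases "X = 0") (auto simp: Q_simps)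

lemma P_subspace: "k \<in> {1..r} \<Longrightarrow> subspace (P k)"
  and P_span: "span (\<Union>k\<in>{1..r}. P k) = \<pp>"
  and P_orth: "i \<in> {1..r} \<Longrightarrow> j \<in> {1..r} \<Longrightarrow> i \<noteq> j \<Longrightarrow> X \<in> P i \<Longrightarrow> Y \<in> P j \<Longrightarrow> Q X Y = 0"
  using decomposition by (auto simp: orthogonal_decomposition_def)

lemma P_pp: "k \<in> {1..r} \<Longrightarrow> X \<in> P k \<Longrightarrow> X \<in> \<pp>"
  unfolding P_span[symmetric] by (rule span_base) blast

lemma pp_kk: "X \<in> \<pp> \<Longrightarrow> Y \<in> \<kk> \<Longrightarrow> Q X Y = 0"
  by (simp add: pp_def)

lemma finite_E: "k \<in> {1..r} \<Longrightarrow> finite (E k)"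
  by (meson E independent_imp_finite orthonormal_basis_def)

lemma E_P: "k \<in> {1..r} \<Longrightarrow> e \<in> E k \<Longrightarrow> e \<in> P k"
  by (metis E orthonormal_basis_def span_base)

lemma Q_E: "k \<in> {1..r} \<Longrightarrow> e \<in> E k \<Longrightarrow> f \<in> E k \<Longrightarrow> Q e f = (if e = f then 1 else 0)"
  using E by (auto simp: orthonormal_basis_def)

lemma card_E: "k \<in> {1..r} \<Longrightarrow> card (E k) = dim (P k)"
  using E by (metis dim_span dim_eq_card_independent orthonormal_basis_def)

definition proj :: "nat \<Rightarrow> 'e \<Rightarrow> 'e" where "proj k X = (\<Sum>e\<in>E k. Q X e *\<^sub>R e)"

lemma linear_proj: "linear (proj k)"
  by (auto simp: linear_iff proj_def Q_simps scaleR_add_left sum.distrib scaleR_sum_right)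

lemma proj_P: "k \<in> {1..r} \<Longrightarrow> proj k X \<in> P k"
  unfolding proj_def by (intro subspace_sum P_subspace subspace_scale E_P)

lemma proj_id:
  assumes k: "k \<in> {1..r}" and X: "X \<in> P k"
  shows "proj k X = X"
proof -
  have "X \<in> span (E k)" using E[OF k] X by (simp add: orthonormal_basis_def)
  then show ?thesis
  proof (induction rule: span_induct_alt)
    case base
    show ?case by (rule linear_0[OF linear_proj])
  next
    case (step c e Y)
    have "proj k e = (\<Sum>f\<in>E k. if e = f then f else 0)"
      unfolding proj_def using step(1) k by (intro sum.cong refl) (simp add: Q_E)
    then have "proj k e = e" using step(1) finite_E[OF k] by simp
    then show ?case using step(2) by (simp add: linear_add[OF linear_proj] linear_scale[OF linear_proj])
  qed
qed

lemma proj_other: "i \<in> {1..r} \<Longrightarrow> k \<in> {1..r} \<Longrightarrow> i \<noteq> k \<Longrightarrow> X \<in> P i \<Longrightarrow> proj k X = 0"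
  unfolding proj_def by (intro sum.neutral) (auto simp: P_orth[of i k] E_P)

lemma proj_kk: "k \<in> {1..r} \<Longrightarrow> X \<in> \<kk> \<Longrightarrow> proj k X = 0"
  unfolding proj_def using pp_kk[of _ X] P_pp E_P Q_commute[of X]
  by (intro sum.neutral ballI) (metis scaleR_zero_left)

lemma proj_proj: "i \<in> {1..r} \<Longrightarrow> k \<in> {1..r} \<Longrightarrow> proj i (proj k X) = (if i = k then proj k X else 0)"
  by (simp add: proj_id proj_P proj_other[of k i])

lemma sum_proj:
  assumes "X \<in> \<pp>"
  shows "X = (\<Sum>k\<in>{1..r}. proj k X)"
proof -
  have "X \<in> span (\<Union>k\<in>{1..r}. P k)" using assms P_span by simp
  then show ?thesis
  proof (induction rule: span_induct_alt)
    case base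
    show ?case by (simp add: linear_0[OF linear_proj])
  next
    case (step c Y Z)
    then obtain j where j: "j \<in> {1..r}" "Y \<in> P j" by blast
    then have "(\<Sum>k\<in>{1..r}. proj k Y) = (\<Sum>k\<in>{1..r}. if k = j then Y else 0)"
      by (intro sum.cong refl) (auto simp: proj_id proj_other)
    also have "\<dots> = Y" using j by simp
    finally show ?case using step(2)
      by (simp add: linear_add[OF linear_proj] linear_scale[OF linear_proj] sum.distrib flip: scaleR_sum_right)
  qed
qed

lemma Q_proj: "Q (proj k X) Y = Q X (proj k Y)"
  by (simp add: proj_def Q_simps Q_commute mult.commute)

lemma subspace_pp: "subspace \<pp>"
  using P_span by (metis subspace_span)

text \<open>Uniqueness holds because \<kk> and the blocks together span the model space.\<close>

lemma block_id_eq: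
  assumes k: "k \<in> {1..r}"
  shows "block_id \<kk> \<pp> r P k = Blinfun (proj k)"
  unfolding block_id_def
proof (rule the_equality)
  show "Blinfun (proj k) \<in> gl_on \<kk> \<pp> \<and> (\<forall>X\<in>P k. Blinfun (proj k) X = X) \<and>
     (\<forall>i\<in>{1..r}. i \<noteq> k \<longrightarrow> (\<forall>X\<in>P i. Blinfun (proj k) X = 0))"
    using k by (auto simp: gl_on_def linear_proj P_pp proj_P proj_kk proj_id proj_other)
  fix A assume A: "A \<in> gl_on \<kk> \<pp> \<and> (\<forall>X\<in>P k. blinfun_apply A X = X) \<and>
     (\<forall>i\<in>{1..r}. i \<noteq> k \<longrightarrow> (\<forall>X\<in>P i. A X = 0))"
  show "A = Blinfun (proj k)"
  proof (rule blinfun_eqI)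
    fix X
    obtain Y where "\<forall>Z\<in>\<kk>. Q Y Z = 0" and XY: "X - Y \<in> \<kk>"
      using orthogonal_complement_splits[OF Q kk] by blast
    then have Y: "Y \<in> \<pp>" by (simp add: pp_def)
    have "A (X - Y) = 0" using A XY unfolding gl_on_def by blast
    then have "A X = A Y" by (simp add: blinfun.diff_right)
    also have "\<dots> = A (\<Sum>j\<in>{1..r}. proj j Y)" using sum_proj[OF Y] by simp
    also have "\<dots> = (\<Sum>j\<in>{1..r}. if j = k then proj k Y else 0)"
      unfolding blinfun.sum_right using A k by (intro sum.cong refl) (auto simp: proj_P)
    also have "\<dots> = proj k Y" using k by simp
    also have "\<dots> = proj k X"
      using proj_kk[OF k XY] by (simp add: linear_diff[OF linear_proj])
    finally show "A X = Blinfun (proj k) X" by (simp add: linear_proj)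
  qed
qed

lemma block_id_apply: "k \<in> {1..r} \<Longrightarrow> block_id \<kk> \<pp> r P k X = proj k X"
  by (simp add: block_id_eq linear_proj)

abbreviation ip :: "'e \<Rightarrow> 'e \<Rightarrow> real" where "ip \<equiv> diag_metric \<kk> \<pp> r P Q x"

lemma ip_eq: "ip X Y = (\<Sum>k\<in>{1..r}. x k * Q (proj k X) (proj k Y))"
  by (simp add: diag_metric_def block_id_apply)

lemma ip_P:
  assumes k: "k \<in> {1..r}" and Y: "Y \<in> P k"
  shows "ip X Y = x k * Q X Y"
proof -
  have "ip X Y = (\<Sum>i\<in>{1..r}. if i = k then x k * Q (proj k X) Y else 0)"
    unfolding ip_eq using k Y by (intro sum.cong refl) (auto simp: proj_id proj_other[of k] Q_simps)
  also have "\<dots> = x k * Q X Y" using k Y by (simp add: Q_proj proj_id)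
  finally show ?thesis .
qed

lemma frame_P: "k \<in> {1..r} \<Longrightarrow> e \<in> E k \<Longrightarrow> (1 / sqrt (x k)) *\<^sub>R e \<in> P k"
  by (intro subspace_scale P_subspace E_P)

definition frame :: "'e set" where
  "frame = (\<Union>k\<in>{1..r}. (\<lambda>e. (1 / sqrt (x k)) *\<^sub>R e) ` E k)"

lemma frame_disjoint:
  assumes "i \<in> {1..r}" "j \<in> {1..r}" "i \<noteq> j"
  shows "(\<lambda>e. (1 / sqrt (x i)) *\<^sub>R e) ` E i \<inter> (\<lambda>e. (1 / sqrt (x j)) *\<^sub>R e) ` E j = {}"
proof -
  have False if "e \<in> E i" "f \<in> E j" "(1 / sqrt (x i)) *\<^sub>R e = (1 / sqrt (x j)) *\<^sub>R f" for e f
  proof -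
    have "Q ((1 / sqrt (x i)) *\<^sub>R e) ((1 / sqrt (x i)) *\<^sub>R e) = 0"
      using frame_P[OF assms(1) that(1)] frame_P[OF assms(2) that(2)]
      by (metis P_orth assms that(3))
    then have "Q e e = 0" using x_pos[OF assms(1)] by (simp add: Q_simps)
    then show False using Q_E[OF assms(1) that(1,1)] by simp
  qed
  then show ?thesis by blast
qed

lemma sum_frame: "(\<Sum>p\<in>frame. f p) = (\<Sum>k\<in>{1..r}. \<Sum>e\<in>E k. f ((1 / sqrt (x k)) *\<^sub>R e))"
proof -
  have "(\<Sum>p\<in>frame. f p) = (\<Sum>k\<in>{1..r}. \<Sum>p\<in>(\<lambda>e. (1 / sqrt (x k)) *\<^sub>R e) ` E k. f p)"
    unfolding frame_def using finite_E frame_disjoint by (intro sum.UNION_disjoint) auto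
  also have "\<dots> = (\<Sum>k\<in>{1..r}. \<Sum>e\<in>E k. f ((1 / sqrt (x k)) *\<^sub>R e))"
  proof (rule sum.cong[OF refl])
    fix k assume "k \<in> {1..r}"
    then have "inj_on (\<lambda>e. (1 / sqrt (x k)) *\<^sub>R e) (E k)"
      using x_pos[of k] by (auto intro!: inj_onI)
    then show "(\<Sum>p\<in>(\<lambda>e. (1 / sqrt (x k)) *\<^sub>R e) ` E k. f p) = (\<Sum>e\<in>E k. f ((1 / sqrt (x k)) *\<^sub>R e))"
      by (simp add: sum.reindex)
  qed
  finally show ?thesis .
qed

lemma frame_orthonormal:
  assumes "p \<in> frame" "q \<in> frame"
  shows "ip p q = (if p = q then 1 else 0)"
proof -
  obtain i e where p: "i \<in> {1..r}" "e \<in> E i" "p = (1 / sqrt (x i)) *\<^sub>R e" using assms(1) by (auto simp: frame_def)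
  obtain j f where q: "j \<in> {1..r}" "f \<in> E j" "q = (1 / sqrt (x j)) *\<^sub>R f" using assms(2) by (auto simp: frame_def)
  have "ip p q = x j * Q p q" unfolding q(3) by (rule ip_P[OF q(1) frame_P[OF q(1,2)]])
  also have "\<dots> = (if p = q then 1 else 0)"
  proof (cases "i = j")
    case True
    then have "p = q \<longleftrightarrow> e = f" using p q x_pos[of i] by simp
    moreover have "x j * Q p q = Q e f" using p q True x_pos[of j] by (simp add: Q_simps)
    ultimately show ?thesis using p q True by (simp add: Q_E)
  next
    case False
    then have "p \<noteq> q" using frame_disjoint[OF p(1) q(1)] p q by blast
    then show ?thesis using False p q P_orth[of i j e f] E_P by (simp add: Q_simps)
  qed
  finally show ?thesis .
qed

lemma bilinear_ip: "bilinear ip"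
  by (auto simp: bilinear_def linear_iff ip_eq linear_add[OF linear_proj] linear_scale[OF linear_proj]
      Q_simps sum.distrib sum_distrib_left algebra_simps)

lemma orthonormal_basis_frame: "orthonormal_basis ip \<pp> frame"
proof -
  have fin: "finite frame" using finite_E by (auto simp: frame_def)
  interpret ip: bounded_bilinear ip using bilinear_ip bilinear_conv_bounded_bilinear by blast
  have "independent frame"
  proof
    assume "dependent frame"
    then obtain u p where p: "p \<in> frame" "u p \<noteq> 0" "(\<Sum>q\<in>frame. u q *\<^sub>R q) = 0"
      using dependent_finite[OF fin] by blast
    have "0 = ip (\<Sum>q\<in>frame. u q *\<^sub>R q) p" using p by (simp add: ip.zero_left)
    also have "\<dots> = (\<Sum>q\<in>frame. if q = p then u q else 0)"
      unfolding ip.sum_left using p by (intro sum.cong refl) (simp add: ip.scaleR_left frame_orthonormal)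
    also have "\<dots> = u p" using p fin by simp
    finally show False using p by simp
  qed
  moreover have "span frame = \<pp>"
  proof
    show "span frame \<subseteq> \<pp>"
      using frame_P P_pp by (intro span_minimal subspace_pp) (auto simp: frame_def)
    have "P k \<subseteq> span frame" if k: "k \<in> {1..r}" for k
    proof
      fix X assume "X \<in> P k"
      then have "X = (\<Sum>e\<in>E k. Q X e *\<^sub>R e)" using proj_id[OF k] by (simp add: proj_def)
      also have "\<dots> = (\<Sum>e\<in>E k. (Q X e * sqrt (x k)) *\<^sub>R ((1 / sqrt (x k)) *\<^sub>R e))"
        using x_pos[OF k] by simp
      also have "\<dots> \<in> span frame"
        using k by (intro span_sum span_scale span_base) (auto simp: frame_def)
      finally show "X \<in> span frame" .
    qed
    then show "\<pp> \<subseteq> span frame" unfolding P_span[symmetric] by (intro span_minimal subspace_span) blast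
  qed
  ultimately show ?thesis by (simp add: orthonormal_basis_def frame_orthonormal)
qed

lemma split_pp: "\<exists>Y\<in>\<pp>. X - Y \<in> \<kk>"
  using orthogonal_complement_splits[OF Q kk, of X] by (auto simp: pp_def)

sublocale split_metric \<kk> \<pp> ip frame
proof
  show "ip X Y = ip Y X" for X Y by (simp add: ip_eq Q_commute)
  show "ip X Y = 0" if "X \<in> \<kk>" for X Y using that by (simp add: ip_eq proj_kk Q_simps)
  show "0 < ip X X" if X: "X \<in> \<pp>" "X \<noteq> 0" for X
  proof -
    obtain k where k: "k \<in> {1..r}" "proj k X \<noteq> 0"
      using sum_proj[OF X(1)] X(2) by (metis sum.neutral)
    show ?thesis
      unfolding ip_eq
    proof (rule sum_pos2[OF _ k(1)])
      show "0 < x k * Q (proj k X) (proj k X)" using x_pos[OF k(1)] Q_pos[OF k(2)] by simp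
      show "0 \<le> x i * Q (proj i X) (proj i X)" if "i \<in> {1..r}" for i
        using x_pos[OF that] Q_nonneg[of "proj i X"] by simp
    qed simp
  qed
qed (fact kk subspace_pp split_pp bilinear_ip orthonormal_basis_frame)+

lemma block_id_sym: "k \<in> {1..r} \<Longrightarrow> block_id \<kk> \<pp> r P k \<in> sym_on \<kk> \<pp> ip"
proof -
  assume k: "k \<in> {1..r}"
  have "ip (proj k X) Y = ip X (proj k Y)" for X Y
    unfolding ip_eq using k by (intro sum.cong refl) (simp add: proj_proj Q_proj Q_simps linear_0[OF linear_proj])
  then show ?thesis
    using k P_pp[OF k proj_P[OF k]] proj_kk[OF k] by (auto simp: sym_on_iff gl_on_def block_id_apply)
qed

lemma gl_inner_block_id:
  assumes "i \<in> {1..r}" "k \<in> {1..r}"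
  shows "gl_inner \<kk> \<pp> ip (block_id \<kk> \<pp> r P i) (block_id \<kk> \<pp> r P k) = (if i = k then real (dim (P k)) else 0)"
proof -
  have "gl_inner \<kk> \<pp> ip (block_id \<kk> \<pp> r P i) (block_id \<kk> \<pp> r P k) =
      (\<Sum>p\<in>frame. ip (proj i p) (proj k p))"
    using assms by (simp add: gl_inner_eq sym_gl block_id_sym block_id_apply)
  also have "\<dots> = (\<Sum>j\<in>{1..r}. \<Sum>e\<in>E j. if i = j \<and> k = j then 1 else 0)"
    unfolding sum_frame
  proof (intro sum.cong refl)
    fix j e assume j: "j \<in> {1..r}" and e: "e \<in> E j"
    let ?p = "(1 / sqrt (x j)) *\<^sub>R e"
    have "?p \<in> frame" using j e by (auto simp: frame_def)
    then have "ip ?p ?p = 1" by (simp add: frame_orthonormal)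
    moreover have "proj l ?p = (if l = j then ?p else 0)" if "l \<in> {1..r}" for l
      using that j frame_P[OF j e] by (simp add: proj_id proj_other[of j])
    ultimately show "ip (proj i ?p) (proj k ?p) = (if i = j \<and> k = j then 1 else 0)"
      using assms by (simp add: ip_kk ip_kk' subspace_0 kk)
  qed
  also have "\<dots> = (\<Sum>j\<in>{1..r}. if j = k then (if i = k then real (card (E k)) else 0) else 0)"
    by (intro sum.cong refl) auto
  also have "\<dots> = (if i = k then real (dim (P k)) else 0)" using assms by (simp add: card_E)
  finally show ?thesis .
qed

text \<open>The component of \<open>X\<close> in \<pp> is orthogonal to itself. Thus \<kk> is
  recovered as the \<open>Q\<close>-complement of \<pp>.\<close>

lemma pp_orth_kk:
  assumes "\<And>Y. Y \<in> \<pp> \<Longrightarrow> Q X Y = 0"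
  shows "X \<in> \<kk>"
proof -
  obtain Y where Y: "Y \<in> \<pp>" "X - Y \<in> \<kk>" using split_pp by blast
  have "Q Y Y = Q X Y - Q (X - Y) Y" by (simp add: Q_simps)
  also have "\<dots> = 0" using assms[OF Y(1)] pp_kk[OF Y] Q_commute[of Y "X - Y"] by simp
  finally have "Y = 0" using Q_pos by (metis less_irrefl)
  with Y show ?thesis by simp
qed

end

section \<open>Pairwise inequivalent irreducible summands\<close>

locale multiplicity_free_metric = diagonal_metric +
  fixes \<rho> :: "'h \<Rightarrow> 'a \<Rightarrow> 'a" and H :: "'h set"
  assumes \<rho>_linear: "h \<in> H \<Longrightarrow> linear (\<rho> h)"
    and \<rho>_isometry: "h \<in> H \<Longrightarrow> Q (\<rho> h X) (\<rho> h Y) = Q X Y"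
    and P_invariant: "k \<in> {1..r} \<Longrightarrow> invariant_under \<rho> H (P k)"
    and P_irreducible: "k \<in> {1..r} \<Longrightarrow> irreducible_under \<rho> H (P k)"
    and P_inequivalent: "i \<in> {1..r} \<Longrightarrow> j \<in> {1..r} \<Longrightarrow> i \<noteq> j \<Longrightarrow> \<not> equivalent_under \<rho> H (P i) (P j)"
begin

lemma \<rho>_P: "h \<in> H \<Longrightarrow> k \<in> {1..r} \<Longrightarrow> X \<in> P k \<Longrightarrow> \<rho> h X \<in> P k"
  using P_invariant unfolding invariant_under_def by blast

lemma \<rho>_pp:
  assumes h: "h \<in> H" and X: "X \<in> \<pp>"
  shows "\<rho> h X \<in> \<pp>"
proof -
  have "\<rho> h X = (\<Sum>k\<in>{1..r}. \<rho> h (proj k X))"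
    using sum_proj[OF X] linear_sum[OF \<rho>_linear[OF h]] by metis
  also have "\<dots> \<in> \<pp>"
    using P_pp \<rho>_P[OF h] proj_P by (intro subspace_sum subspace_pp) blast
  finally show ?thesis .
qed

lemma proj_\<rho>_pp:
  assumes h: "h \<in> H" and k: "k \<in> {1..r}" and X: "X \<in> \<pp>"
  shows "proj k (\<rho> h X) = \<rho> h (proj k X)"
proof -
  have "proj k (\<rho> h X) = (\<Sum>j\<in>{1..r}. proj k (\<rho> h (proj j X)))"
    using sum_proj[OF X] linear_sum[OF \<rho>_linear[OF h]] linear_sum[OF linear_proj] by metis
  also have "\<dots> = (\<Sum>j\<in>{1..r}. if j = k then \<rho> h (proj k X) else 0)"
    using h k by (intro sum.cong refl) (auto simp: proj_id proj_other[of _ k] \<rho>_P proj_P)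
  also have "\<dots> = \<rho> h (proj k X)" using k by simp
  finally show ?thesis .
qed

lemma \<rho>_surj_pp:
  assumes h: "h \<in> H"
  shows "\<rho> h ` \<pp> = \<pp>"
proof (rule subspace_dim_equal)
  have "inj_on (\<rho> h) \<pp>"
  proof (rule linear_inj_on_iff_eq_0[OF \<rho>_linear[OF h] subspace_pp, THEN iffD2], intro ballI impI)
    fix X assume "\<rho> h X = 0"
    then show "X = 0" using \<rho>_isometry[OF h, of X X] Q_pos[of X] by (force simp: Q_simps)
  qed
  then show "dim \<pp> \<le> dim (\<rho> h ` \<pp>)"
    using dim_image_eq[OF \<rho>_linear[OF h], of \<pp>] span_eq_iff[THEN iffD2, OF subspace_pp] by simp
qed (use subspace_pp \<rho>_pp[OF h] linear_subspace_image[OF \<rho>_linear[OF h] subspace_pp] in auto)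

text \<open>An isometry of \<open>Q\<close> that maps \<pp> onto itself preserves the complement of
  \<pp>, which is \<kk>.\<close>

lemma \<rho>_kk:
  assumes h: "h \<in> H" and X: "X \<in> \<kk>"
  shows "\<rho> h X \<in> \<kk>"
proof (rule pp_orth_kk)
  fix Y assume "Y \<in> \<pp>"
  then obtain Z where "Z \<in> \<pp>" "Y = \<rho> h Z" using \<rho>_surj_pp[OF h] by blast
  then show "Q (\<rho> h X) Y = 0" using \<rho>_isometry[OF h] pp_kk[of Z X] X Q_commute[of X Z] by simp
qed

lemma proj_\<rho>:
  assumes h: "h \<in> H" and k: "k \<in> {1..r}"
  shows "proj k (\<rho> h X) = \<rho> h (proj k X)"
proof -
  obtain Y where Y: "Y \<in> \<pp>" "X - Y \<in> \<kk>" using split_pp by blast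
  have "proj k X = proj k Y" using proj_kk[OF k Y(2)] by (simp add: linear_diff[OF linear_proj])
  moreover have "proj k (\<rho> h X) = proj k (\<rho> h Y)"
    using proj_kk[OF k \<rho>_kk[OF h Y(2)]] by (simp add: linear_diff[OF linear_proj] linear_diff[OF \<rho>_linear[OF h]])
  ultimately show ?thesis using proj_\<rho>_pp[OF h k Y(1)] by simp
qed

lemma ip_\<rho>: "h \<in> H \<Longrightarrow> ip (\<rho> h X) (\<rho> h Y) = ip X Y"
  unfolding ip_eq by (intro sum.cong refl) (simp add: proj_\<rho> \<rho>_isometry)

lemma isometry: "h \<in> H \<Longrightarrow> split_metric_isometry \<kk> \<pp> ip frame (\<rho> h)"
  by (intro split_metric_isometry.intro split_metric_axioms split_metric_isometry_axioms.intro
      \<rho>_linear \<rho>_pp \<rho>_kk ip_\<rho>)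

abbreviation symH :: "('a \<Rightarrow>\<^sub>L 'a) set" where "symH \<equiv> sym_inv_on \<kk> \<pp> ip \<rho> H"

text \<open>Commutation on \<pp> extends to all vectors because \<rho> preserves \<kk> and
  \<open>A\<close> vanishes there.\<close>

lemma symH_iff: "A \<in> symH \<longleftrightarrow> A \<in> sym_on \<kk> \<pp> ip \<and> (\<forall>h\<in>H. \<forall>X. A (\<rho> h X) = \<rho> h (A X))"
proof
  assume A: "A \<in> symH"
  then have s: "A \<in> sym_on \<kk> \<pp> ip" and c: "\<And>h X. h \<in> H \<Longrightarrow> X \<in> \<pp> \<Longrightarrow> A (\<rho> h X) = \<rho> h (A X)"
    by (auto simp: sym_inv_on_def)
  have "A (\<rho> h X) = \<rho> h (A X)" if h: "h \<in> H" for h X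
  proof -
    have "A (\<rho> h (X - pr X)) = 0" using glD(2)[OF sym_gl[OF s] \<rho>_kk[OF h diff_pr]] .
    then have "A (\<rho> h X) = A (\<rho> h (pr X))"
      by (simp add: linear_diff[OF \<rho>_linear[OF h]] blinfun.diff_right)
    then show ?thesis using c[OF h pr_pp] gl_pr[OF sym_gl[OF s]] by simp
  qed
  with s show "A \<in> sym_on \<kk> \<pp> ip \<and> (\<forall>h\<in>H. \<forall>X. A (\<rho> h X) = \<rho> h (A X))" by blast
qed (auto simp: sym_inv_on_def)

abbreviation I :: "nat \<Rightarrow> ('a \<Rightarrow>\<^sub>L 'a)" where "I \<equiv> block_id \<kk> \<pp> r P"

lemma I_symH: "k \<in> {1..r} \<Longrightarrow> I k \<in> symH"
  by (simp add: symH_iff block_id_sym block_id_apply proj_\<rho>)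

text \<open>A block of \<open>A\<close> intertwines two irreducible summands; its kernel and image
  are invariant, so a nonzero block would be an equivalence.\<close>

lemma off_diagonal_block_zero:
  assumes A: "A \<in> symH" and i: "i \<in> {1..r}" and j: "j \<in> {1..r}" and ne: "i \<noteq> j" and X: "X \<in> P j"
  shows "proj i (A X) = 0"
proof (rule ccontr)
  assume nz: "proj i (A X) \<noteq> 0"
  define T where "T X = proj i (A X)" for X
  have T: "linear T"
    by (auto simp: linear_iff T_def blinfun.add_right blinfun.scaleR_right linear_add[OF linear_proj] linear_scale[OF linear_proj])
  have T\<rho>: "T (\<rho> h X) = \<rho> h (T X)" if "h \<in> H" for h X
    using A that i by (simp add: T_def symH_iff proj_\<rho>)
  let ?N = "{X \<in> P j. T X = 0}"
  have "subspace ?N"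
    using P_subspace[OF j] by (auto simp: subspace_def linear_add[OF T] linear_scale[OF T] linear_0[OF T])
  moreover have "invariant_under \<rho> H ?N"
    using \<rho>_P[OF _ j] T\<rho> linear_0[OF \<rho>_linear] by (auto simp: invariant_under_def)
  ultimately have "?N = {0} \<or> ?N = P j"
    using P_irreducible[OF j] unfolding irreducible_under_def by blast
  with X nz have N: "?N = {0}" by (auto simp: T_def)
  have inj: "inj_on T (P j)"
    using N by (subst linear_inj_on_iff_eq_0[OF T P_subspace[OF j]]) blast
  have "subspace (T ` P j)" using T P_subspace[OF j] by (rule linear_subspace_image)
  moreover have sub: "T ` P j \<subseteq> P i" using proj_P[OF i] by (auto simp: T_def)
  moreover have "invariant_under \<rho> H (T ` P j)"
    by (auto simp: invariant_under_def T\<rho>[symmetric] intro!: imageI \<rho>_P[OF _ j])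
  ultimately have "T ` P j = {0} \<or> T ` P j = P i"
    using P_irreducible[OF i] unfolding irreducible_under_def by blast
  moreover have "T ` P j \<noteq> {0}" using X nz by (auto simp: T_def)
  ultimately have "bij_betw T (P j) (P i)" using inj by (simp add: bij_betw_def)
  then have "equivalent_under \<rho> H (P j) (P i)"
    using T T\<rho> unfolding equivalent_under_def by blast
  with P_inequivalent[OF j i] ne show False by simp
qed

text \<open>Over the reals the commutant of an irreducible representation can be complex or
  quaternionic. Symmetry of the block supplies a real eigenvalue, and its eigenspace, being
  invariant and nonzero, is the whole summand.\<close>

lemma diagonal_block_scalar:
  assumes A: "A \<in> symH" and k: "k \<in> {1..r}"
  obtains c where "\<And>X. X \<in> P k \<Longrightarrow> proj k (A X) = c *\<^sub>R X"
proof -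
  define T where "T X = proj k (A X)" for X
  have T: "linear T"
    by (auto simp: linear_iff T_def blinfun.add_right blinfun.scaleR_right linear_add[OF linear_proj] linear_scale[OF linear_proj])
  have T\<rho>: "T (\<rho> h X) = \<rho> h (T X)" if "h \<in> H" for h X
    using A that k by (simp add: T_def symH_iff proj_\<rho>)
  have ne: "P k \<noteq> {0}" using P_irreducible[OF k] by (simp add: irreducible_under_def)
  have sym: "Q (T X) Y = Q X (T Y)" if X: "X \<in> P k" and Y: "Y \<in> P k" for X Y
  proof -
    have s: "A \<in> sym_on \<kk> \<pp> ip" using A by (simp add: symH_iff)
    have "x k * Q (T X) Y = ip (A X) Y"
      by (simp add: ip_P[OF k Y] T_def Q_proj proj_id[OF k Y])
    also have "\<dots> = ip X (A Y)" by (rule sym_ip[OF s])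
    also have "\<dots> = ip (A Y) X" by (rule ip_commute)
    also have "\<dots> = x k * Q (T Y) X"
      by (simp add: ip_P[OF k X] T_def Q_proj proj_id[OF k X])
    finally show ?thesis using x_pos[OF k] Q_commute by simp
  qed
  obtain c v where v: "v \<in> P k" "v \<noteq> 0" "T v = c *\<^sub>R v"
    by (rule self_adjoint_eigenvector[OF Q P_subspace[OF k] ne T _ sym])
       (use proj_P[OF k] in \<open>auto simp: T_def\<close>)
  let ?W = "{X \<in> P k. T X = c *\<^sub>R X}"
  have "subspace ?W"
    using P_subspace[OF k]
    by (auto simp: subspace_def linear_add[OF T] linear_scale[OF T] linear_0[OF T] scaleR_add_right)
  moreover have "invariant_under \<rho> H ?W"
    using \<rho>_P[OF _ k] T\<rho> linear_scale[OF \<rho>_linear] by (auto simp: invariant_under_def)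
  ultimately have "?W = {0} \<or> ?W = P k"
    using P_irreducible[OF k] unfolding irreducible_under_def by blast
  with v have "?W = P k" by blast
  then show thesis using that[of c] unfolding T_def by blast
qed

lemma schur:
  assumes A: "A \<in> symH"
  obtains c where "A = (\<Sum>k\<in>{1..r}. c k *\<^sub>R I k)"
proof -
  have gl: "A \<in> gl_on \<kk> \<pp>" using A sym_gl by (simp add: symH_iff)
  have "\<forall>k\<in>{1..r}. \<exists>c. \<forall>X\<in>P k. proj k (A X) = c *\<^sub>R X"
    using diagonal_block_scalar[OF A] by metis
  then obtain c where c: "\<And>k X. k \<in> {1..r} \<Longrightarrow> X \<in> P k \<Longrightarrow> proj k (A X) = c k *\<^sub>R X" by metis
  have AP: "A X = c k *\<^sub>R X" if k: "k \<in> {1..r}" and X: "X \<in> P k" for k X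
  proof -
    have "A X = (\<Sum>i\<in>{1..r}. proj i (A X))" by (rule sum_proj[OF glD(1)[OF gl]])
    also have "\<dots> = (\<Sum>i\<in>{1..r}. if i = k then c k *\<^sub>R X else 0)"
      using k X off_diagonal_block_zero[OF A _ k] by (intro sum.cong refl) (auto simp: c)
    also have "\<dots> = c k *\<^sub>R X" using k by simp
    finally show ?thesis .
  qed
  have "A = (\<Sum>k\<in>{1..r}. c k *\<^sub>R I k)"
  proof (rule blinfun_eqI)
    fix X
    have "A X = A (pr X)" by (simp add: gl_pr[OF gl])
    also have "\<dots> = A (\<Sum>k\<in>{1..r}. proj k (pr X))" using sum_proj[OF pr_pp] by simp
    also have "\<dots> = (\<Sum>k\<in>{1..r}. c k *\<^sub>R proj k (pr X))"
      unfolding blinfun.sum_right by (intro sum.cong refl AP proj_P)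
    also have "\<dots> = (\<Sum>k\<in>{1..r}. c k *\<^sub>R proj k X)"
    proof (intro sum.cong refl)
      fix k assume k: "k \<in> {1..r}"
      show "c k *\<^sub>R proj k (pr X) = c k *\<^sub>R proj k X"
        using proj_kk[OF k diff_pr[of X]] by (simp add: linear_diff[OF linear_proj])
    qed
    also have "\<dots> = (\<Sum>k\<in>{1..r}. c k *\<^sub>R I k) X"
      by (simp add: blinfun.sum_left blinfun.scaleR_left block_id_apply)
    finally show "A X = (\<Sum>k\<in>{1..r}. c k *\<^sub>R I k) X" .
  qed
  then show thesis by (rule that)
qed

lemma symH_subspace: "subspace symH"
  using sym_on_subspace unfolding subspace_def
  by (auto simp: symH_iff blinfun.add_left blinfun.scaleR_left linear_0[OF \<rho>_linear]
      linear_add[OF \<rho>_linear] linear_scale[OF \<rho>_linear])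

definition unit_block :: "nat \<Rightarrow> ('a \<Rightarrow>\<^sub>L 'a)" where "unit_block k = (1 / sqrt (real (dim (P k)))) *\<^sub>R I k"

lemma dim_P_nonzero: "k \<in> {1..r} \<Longrightarrow> dim (P k) \<noteq> 0"
  using P_irreducible[of k] P_subspace[of k] subspace_0[of "P k"]
  by (auto simp: irreducible_under_def)

lemma unit_block_symH: "k \<in> {1..r} \<Longrightarrow> unit_block k \<in> symH"
  unfolding unit_block_def using symH_subspace I_symH by (simp add: subspace_scale)

lemma symH_gl: "A \<in> symH \<Longrightarrow> A \<in> gl_on \<kk> \<pp>"
  by (simp add: symH_iff sym_gl)

lemma gl_inner_unit_block:
  assumes i: "i \<in> {1..r}" and k: "k \<in> {1..r}"
  shows "gl_inner \<kk> \<pp> ip (unit_block i) (unit_block k) = (if i = k then 1 else 0)"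
proof -
  have "gl_inner \<kk> \<pp> ip (unit_block i) (unit_block k) =
      1 / sqrt (real (dim (P i))) * (1 / sqrt (real (dim (P k)))) * gl_inner \<kk> \<pp> ip (I i) (I k)"
    using symH_gl[OF unit_block_symH[OF i]] symH_gl[OF unit_block_symH[OF k]] symH_gl[OF I_symH[OF i]] symH_gl[OF I_symH[OF k]]
    by (simp add: gl_inner_eq) (simp add: unit_block_def blinfun.scaleR_left ip_simps sum_distrib_left sum_divide_distrib mult_ac)
  then show ?thesis using dim_P_nonzero[OF k] gl_inner_block_id[OF i k] by simp
qed

lemma inj_unit_block: "inj_on unit_block {1..r}"
  using gl_inner_unit_block by (metis inj_onI zero_neq_one)

lemma unit_block_orthonormal: "orthonormal_basis (gl_inner \<kk> \<pp> ip) symH (unit_block ` {1..r})"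
proof -
  have on: "gl_inner \<kk> \<pp> ip A C = (if A = C then 1 else 0)" if "A \<in> unit_block ` {1..r}" "C \<in> unit_block ` {1..r}" for A C
    using that inj_unit_block gl_inner_unit_block by (auto simp: inj_on_eq_iff simp del: atLeastAtMost_iff)
  have "span (unit_block ` {1..r}) = symH"
  proof
    show "span (unit_block ` {1..r}) \<subseteq> symH"
      using unit_block_symH by (intro span_minimal symH_subspace) blast
    show "symH \<subseteq> span (unit_block ` {1..r})"
    proof
      fix A assume "A \<in> symH"
      then obtain c where "A = (\<Sum>k\<in>{1..r}. c k *\<^sub>R I k)" by (rule schur)
      also have "\<dots> = (\<Sum>k\<in>{1..r}. (c k * sqrt (real (dim (P k)))) *\<^sub>R unit_block k)"
      proof (intro sum.cong refl)
        fix k assume "k \<in> {1..r}"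
        then have "sqrt (real (dim (P k))) \<noteq> 0" using dim_P_nonzero[of k] by simp
        then show "c k *\<^sub>R I k = (c k * sqrt (real (dim (P k)))) *\<^sub>R unit_block k"
          by (simp add: unit_block_def)
      qed
      also have "\<dots> \<in> span (unit_block ` {1..r})"
        by (intro span_sum span_scale span_base) blast
      finally show "A \<in> span (unit_block ` {1..r})" .
    qed
  qed
  moreover have "independent (unit_block ` {1..r})"
    using unit_block_symH symH_gl by (intro gl_orthonormal_independent on) auto
  ultimately show ?thesis using on by (auto simp: orthonormal_basis_def)
qed

text \<open>Coordinates in an orthonormal basis are inner products; this leads from the
  \<open>representation\<close> in \<open>op_matrix\<close> to the form that defines
  \<open>L_op\<close>.\<close>

lemma op_matrix_eq:
  assumes F: "F (unit_block m) \<in> symH" and k: "k \<in> {1..r}"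
  shows "op_matrix r unit_block F k m = gl_inner \<kk> \<pp> ip (F (unit_block m)) (unit_block k)"
  unfolding op_matrix_def
proof (rule gl_representation)
  show "F (unit_block m) \<in> span (unit_block ` {1..r})" "independent (unit_block ` {1..r})"
    and "\<And>A C. A \<in> unit_block ` {1..r} \<Longrightarrow> C \<in> unit_block ` {1..r} \<Longrightarrow> gl_inner \<kk> \<pp> ip A C = (if A = C then 1 else 0)"
    using unit_block_orthonormal F by (auto simp: orthonormal_basis_def simp del: atLeastAtMost_iff)
qed (use k unit_block_symH symH_gl in auto)

end

text \<open>The eigenvalue of \<open>\<theta>(I\<^sub>k)\<close> on the component of \<open>\<Lambda>\<^sup>2\<pp>\<^sup>* \<otimes> \<pp>\<close> mapping \<open>\<pp>\<^sub>a \<times> \<pp>\<^sub>b\<close> to \<open>\<pp>\<^sub>c\<close>.\<close>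

definition theta_weight :: "nat \<Rightarrow> nat \<Rightarrow> nat \<Rightarrow> nat \<Rightarrow> real" where
  "theta_weight k a b c = of_bool (c = k) - of_bool (a = k) - of_bool (b = k)"

section \<open>Evaluation of the weighted sums over block triples\<close>

lemma sum_if_const: "(\<Sum>i\<in>A. if b then f i else 0) = (if b then sum f A else 0)"
  by simp

text \<open>For distinct \<open>k\<close> and \<open>m\<close> the product of weights is a sum of
  six products of Kronecker deltas: positive where \<open>k\<close> and \<open>m\<close> are the two
  inputs, negative where one of them is the output. Symmetry of \<open>s\<close> merges them in
  pairs, which cancels the factor 1/2, and the three remaining quotients have the common denominator
  \<open>x i * x k * x m\<close>.\<close>

lemma theta_weight_sum_off_diagonal:
  fixes s :: "nat \<Rightarrow> nat \<Rightarrow> nat \<Rightarrow> real" and R :: "nat set"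
  assumes R: "finite R" "k \<in> R" "m \<in> R" and km: "k \<noteq> m"
    and s12: "\<And>a b c. a \<in> R \<Longrightarrow> b \<in> R \<Longrightarrow> c \<in> R \<Longrightarrow> s a b c = s b a c"
    and s23: "\<And>a b c. a \<in> R \<Longrightarrow> b \<in> R \<Longrightarrow> c \<in> R \<Longrightarrow> s a b c = s a c b"
    and x: "\<And>i. i \<in> R \<Longrightarrow> x i > 0"
  shows "1/2 * (\<Sum>a\<in>R. \<Sum>b\<in>R. \<Sum>c\<in>R. theta_weight m a b c * theta_weight k a b c * (x c / (x a * x b) * s a b c))
     = (\<Sum>i\<in>R. ((x i)\<^sup>2 - (x k)\<^sup>2 - (x m)\<^sup>2) / (x i * x k * x m) * s i k m)"
proof -
  define w where "w a b c = x c / (x a * x b) * s a b c" for a b c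
  have "theta_weight m a b c * theta_weight k a b c * w a b c =
      (if a = k then if b = m then w a b c else 0 else 0) + (if a = m then if b = k then w a b c else 0 else 0)
      - (if a = k then if c = m then w a b c else 0 else 0) - (if a = m then if c = k then w a b c else 0 else 0)
      - (if b = k then if c = m then w a b c else 0 else 0) - (if b = m then if c = k then w a b c else 0 else 0)" for a b c
    using km by (auto simp: theta_weight_def)
  then have "(\<Sum>a\<in>R. \<Sum>b\<in>R. \<Sum>c\<in>R. theta_weight m a b c * theta_weight k a b c * w a b c) =
      (\<Sum>i\<in>R. w k m i) + (\<Sum>i\<in>R. w m k i) - (\<Sum>i\<in>R. w k i m) - (\<Sum>i\<in>R. w m i k)
       - (\<Sum>i\<in>R. w i k m) - (\<Sum>i\<in>R. w i m k)"
    using R by (simp add: sum.distrib sum_subtractf sum_if_const)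
  also have "\<dots> = (\<Sum>i\<in>R. 2 * (((x i)\<^sup>2 - (x k)\<^sup>2 - (x m)\<^sup>2) / (x i * x k * x m) * s i k m))"
    unfolding sum.distrib[symmetric] sum_subtractf[symmetric]
  proof (intro sum.cong refl)
    fix i assume i: "i \<in> R"
    have s: "s k m i = s i k m" "s m k i = s i k m" "s k i m = s i k m" "s m i k = s i k m" "s i m k = s i k m"
      using s12 s23 R i by metis+
    show "w k m i + w m k i - w k i m - w m i k - w i k m - w i m k =
        2 * (((x i)\<^sup>2 - (x k)\<^sup>2 - (x m)\<^sup>2) / (x i * x k * x m) * s i k m)"
      unfolding w_def s using x[OF i] x[OF R(2)] x[OF R(3)]
      by (simp add: field_simps power2_eq_square)
  qed
  also have "\<dots> = 2 * (\<Sum>i\<in>R. ((x i)\<^sup>2 - (x k)\<^sup>2 - (x m)\<^sup>2) / (x i * x k * x m) * s i k m)"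
    by (rule sum_distrib_left[symmetric])
  finally show ?thesis unfolding w_def[symmetric] by linarith
qed

text \<open>Half of the squared weight plus half of the weight is 1 exactly for weight 1, where
  \<open>k\<close> is the output only, and for weight -2, where \<open>k\<close> is both inputs but
  not the output; it is 0 otherwise. These two cases are the two sums, and the triple
  \<open>(k, k, k)\<close>, of weight -1, drops out.\<close>

lemma theta_weight_sum_diagonal:
  fixes s :: "nat \<Rightarrow> nat \<Rightarrow> nat \<Rightarrow> real" and R :: "nat set"
  assumes R: "finite R" "k \<in> R"
    and s12: "\<And>a b c. a \<in> R \<Longrightarrow> b \<in> R \<Longrightarrow> c \<in> R \<Longrightarrow> s a b c = s b a c"
    and s23: "\<And>a b c. a \<in> R \<Longrightarrow> b \<in> R \<Longrightarrow> c \<in> R \<Longrightarrow> s a b c = s a c b"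
  shows "1/2 * (\<Sum>a\<in>R. \<Sum>b\<in>R. \<Sum>c\<in>R. theta_weight k a b c * theta_weight k a b c * (x c / (x a * x b) * s a b c))
     + 1/2 * (\<Sum>a\<in>R. \<Sum>b\<in>R. \<Sum>c\<in>R. theta_weight k a b c * (x c / (x a * x b) * s a b c))
     = (\<Sum>i\<in>R - {k}. \<Sum>j\<in>R - {k}. x k / (x i * x j) * s i j k) + (\<Sum>i\<in>R - {k}. x i / (x k)\<^sup>2 * s i k k)"
proof -
  define w where "w a b c = x c / (x a * x b) * s a b c" for a b c
  have minus: "(\<Sum>i\<in>R - {k}. f i) = (\<Sum>i\<in>R. if i = k then 0 else f i)" for f :: "nat \<Rightarrow> real"
    using R by (intro sum.mono_neutral_cong_left) auto
  have "1/2 * (theta_weight k a b c * theta_weight k a b c * w a b c) + 1/2 * (theta_weight k a b c * w a b c) =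
      (if a = k then 0 else if b = k then 0 else if c = k then w a b c else 0) +
      (if a = k then if b = k then if c = k then 0 else w a b c else 0 else 0)" for a b c
    by (auto simp: theta_weight_def)
  then have "1/2 * (\<Sum>a\<in>R. \<Sum>b\<in>R. \<Sum>c\<in>R. theta_weight k a b c * theta_weight k a b c * w a b c)
     + 1/2 * (\<Sum>a\<in>R. \<Sum>b\<in>R. \<Sum>c\<in>R. theta_weight k a b c * w a b c) =
      (\<Sum>a\<in>R. \<Sum>b\<in>R. \<Sum>c\<in>R. (if a = k then 0 else if b = k then 0 else if c = k then w a b c else 0) +
      (if a = k then if b = k then if c = k then 0 else w a b c else 0 else 0))"
    by (simp only: sum_distrib_left sum.distrib[symmetric])
  also have "\<dots> = (\<Sum>a\<in>R. if a = k then 0 else \<Sum>b\<in>R. if b = k then 0 else w a b k) +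
      (\<Sum>c\<in>R. if c = k then 0 else w k k c)"
  proof -
    have "(\<Sum>a\<in>R. \<Sum>b\<in>R. \<Sum>c\<in>R. if a = k then 0 else if b = k then 0 else if c = k then w a b c else 0) =
        (\<Sum>a\<in>R. if a = k then 0 else \<Sum>b\<in>R. if b = k then 0 else w a b k)"
      using R by (intro sum.cong refl) (auto intro!: sum.cong)
    moreover have "(\<Sum>a\<in>R. \<Sum>b\<in>R. \<Sum>c\<in>R. if a = k then if b = k then if c = k then 0 else w a b c else 0 else 0) =
        (\<Sum>c\<in>R. if c = k then 0 else w k k c)"
      using R by (simp add: sum_if_const)
    ultimately show ?thesis by (simp only: sum.distrib)
  qed
  also have "\<dots> = (\<Sum>i\<in>R - {k}. \<Sum>j\<in>R - {k}. w i j k) + (\<Sum>i\<in>R - {k}. w k k i)"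
    unfolding minus ..
  also have "(\<Sum>i\<in>R - {k}. w k k i) = (\<Sum>i\<in>R - {k}. x i / (x k)\<^sup>2 * s i k k)"
  proof (intro sum.cong refl)
    fix i assume "i \<in> R - {k}"
    then have "s k k i = s i k k" using s12 s23 R by (metis DiffD1)
    then show "w k k i = x i / (x k)\<^sup>2 * s i k k" by (simp add: w_def power2_eq_square)
  qed
  finally show ?thesis unfolding w_def .
qed

section \<open>Structural constants and the matrix entries of \<open>L_op\<close>\<close>

locale multiplicity_free_bracket = multiplicity_free_metric +
  fixes br :: "'a \<Rightarrow> 'a \<Rightarrow> 'a"
  assumes bilinear_br: "bilinear br" and br_antisym: "br X Y = - br Y X"
    and br_skew: "Q (br X Y) Z = - Q Y (br X Z)"
    and \<rho>_br: "h \<in> H \<Longrightarrow> \<rho> h (br X Y) = br (\<rho> h X) (\<rho> h Y)"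
begin

definition \<mu> :: "'a \<Rightarrow> 'a \<Rightarrow> 'a" where "\<mu> X Y = proj_along \<pp> \<kk> (br X Y)"

abbreviation sc :: "nat \<Rightarrow> nat \<Rightarrow> nat \<Rightarrow> real" where "sc \<equiv> struct_const Q br E"

lemma \<mu>_eq: "\<mu> X Y = pr (br X Y)"
  by (simp add: \<mu>_def proj_along_eq)

lemma bilinear_\<mu>: "bilinear \<mu>"
  using bilinear_br linear_pr unfolding bilinear_def linear_iff by (simp add: \<mu>_eq)

lemma \<rho>_pr:
  assumes h: "h \<in> H"
  shows "\<rho> h (pr X) = pr (\<rho> h X)"
proof -
  have "pr (\<rho> h (X - pr X)) = 0" by (rule pr_kk[OF \<rho>_kk[OF h diff_pr]])
  then have "pr (\<rho> h X) = pr (\<rho> h (pr X))"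
    by (simp add: linear_diff[OF linear_pr] linear_diff[OF \<rho>_linear[OF h]])
  also have "\<dots> = \<rho> h (pr X)" by (rule pr_id[OF \<rho>_pp[OF h pr_pp]])
  finally show ?thesis ..
qed

lemma \<rho>_\<mu>: "h \<in> H \<Longrightarrow> \<mu> (\<rho> h X) (\<rho> h Y) = \<rho> h (\<mu> X Y)"
  by (simp add: \<mu>_eq \<rho>_pr \<rho>_br)

lemma L_op_symH:
  assumes A: "A \<in> symH"
  shows "L_op \<kk> \<pp> ip \<mu> A \<in> symH"
  unfolding symH_iff
proof (intro conjI ballI allI L_op(1) bilinear_\<mu>)
  fix h X assume h: "h \<in> H"
  interpret split_metric_isometry \<kk> \<pp> ip frame "\<rho> h" using h by (rule isometry)
  show "L_op \<kk> \<pp> ip \<mu> A (\<rho> h X) = \<rho> h (L_op \<kk> \<pp> ip \<mu> A X)"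
    using A h by (intro L_op_commute_isometry bilinear_\<mu> \<rho>_\<mu>) (auto simp: symH_iff)
qed

lemma sc_swap12: "sc i j k = sc j i k"
proof -
  have "(Q (br X Y) Z)\<^sup>2 = (Q (br Y X) Z)\<^sup>2" for X Y Z
    by (subst br_antisym) (simp add: Q.minus_left)
  then show ?thesis unfolding struct_const_def by (subst sum.swap[of _ "E i"]) simp
qed

text \<open>Skewness of the bracket with respect to \<open>Q\<close> changes only a sign, lost in
  the square. With \<open>sc_swap12\<close> this generates all permutations of the indices.\<close>

lemma sc_swap23: "sc i j k = sc i k j"
proof -
  have "(Q (br X Y) Z)\<^sup>2 = (Q (br X Z) Y)\<^sup>2" for X Y Z
    using br_skew[of X Y Z] Q_commute[of Y "br X Z"] by simp
  then show ?thesis unfolding struct_const_def by (subst sum.swap[of _ "E k"]) simp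
qed

text \<open>Symmetry of \<open>I m\<close> moves it from the value of \<mu> onto \<open>Z\<close>.
  It then acts on each of the three vectors as a Kronecker delta, so \<mu> never has to be split
  into components.\<close>

lemma pairing_eigen:
  assumes m: "m \<in> {1..r}"
    and a: "a \<in> {1..r}" "X \<in> P a" and b: "b \<in> {1..r}" "Y \<in> P b" and c: "c \<in> {1..r}" "Z \<in> P c"
  shows "ip (gl_theta (I m) \<mu> X Y) Z = theta_weight m a b c * ip (\<mu> X Y) Z"
proof -
  have I_P: "I m V = of_bool (i = m) *\<^sub>R V" if "i \<in> {1..r}" "V \<in> P i" for i V
    using that m proj_id proj_other[of i m] by (auto simp: block_id_apply)
  have "ip (I m (\<mu> X Y)) Z = ip (\<mu> X Y) (I m Z)" by (rule sym_ip[OF block_id_sym[OF m]])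
  then show ?thesis
    using bilinear_lmul[OF bilinear_\<mu>] bilinear_rmul[OF bilinear_\<mu>]
    by (simp only: gl_theta_def I_P[OF a] I_P[OF b] I_P[OF c] ip_simps theta_weight_def left_diff_distrib real_scaleR_def)
qed

text \<open>Pairing with block \<open>c\<close> contributes \<open>x c\<close>, hence its square
  after squaring; the three frame vectors contribute \<open>1 / (x a * x b * x c)\<close>.\<close>

lemma ip_\<mu>_frame:
  assumes a: "a \<in> {1..r}" and b: "b \<in> {1..r}" and c: "c \<in> {1..r}" and Z: "Z \<in> E c"
  shows "(ip (\<mu> ((1 / sqrt (x a)) *\<^sub>R X) ((1 / sqrt (x b)) *\<^sub>R Y)) ((1 / sqrt (x c)) *\<^sub>R Z))\<^sup>2
    = x c / (x a * x b) * (Q (br X Y) Z)\<^sup>2"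
proof -
  have "ip (\<mu> X Y) Z = x c * Q (br X Y) Z"
    using ip_P[OF c E_P[OF c Z], of "br X Y"] by (simp add: \<mu>_eq ip_pr)
  then have "ip (\<mu> ((1 / sqrt (x a)) *\<^sub>R X) ((1 / sqrt (x b)) *\<^sub>R Y)) ((1 / sqrt (x c)) *\<^sub>R Z)
     = x c * Q (br X Y) Z / (sqrt (x a) * sqrt (x b) * sqrt (x c))"
    by (simp add: bilinear_lmul[OF bilinear_\<mu>] bilinear_rmul[OF bilinear_\<mu>] ip_simps mult_ac)
  then show ?thesis
    using x_pos[OF a] x_pos[OF b] x_pos[OF c]
    by (simp add: power_divide power_mult_distrib) (simp add: power2_eq_square field_simps)
qed

text \<open>The passage from frame vectors to block triples: \<open>t\<close> is instantiated once
  with a product of two weights and once with a single weight. After the frame is resolved, only the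
  order of summation changes.\<close>

lemma sum_frame_weights:
  fixes f :: "'a \<Rightarrow> 'a \<Rightarrow> 'a \<Rightarrow> real"
  assumes f: "\<And>a b c X Y Z. a \<in> {1..r} \<Longrightarrow> b \<in> {1..r} \<Longrightarrow> c \<in> {1..r} \<Longrightarrow> X \<in> P a \<Longrightarrow> Y \<in> P b \<Longrightarrow> Z \<in> P c \<Longrightarrow>
     f X Y Z = t a b c * (ip (\<mu> X Y) Z)\<^sup>2"
  shows "(\<Sum>X\<in>frame. \<Sum>Y\<in>frame. \<Sum>Z\<in>frame. f X Y Z) =
    (\<Sum>a\<in>{1..r}. \<Sum>b\<in>{1..r}. \<Sum>c\<in>{1..r}. t a b c * (x c / (x a * x b) * sc a b c))"
proof -
  have "(\<Sum>X\<in>frame. \<Sum>Y\<in>frame. \<Sum>Z\<in>frame. f X Y Z) =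
    (\<Sum>a\<in>{1..r}. \<Sum>X\<in>E a. \<Sum>b\<in>{1..r}. \<Sum>Y\<in>E b. \<Sum>c\<in>{1..r}. \<Sum>Z\<in>E c. t a b c * (x c / (x a * x b) * (Q (br X Y) Z)\<^sup>2))"
    unfolding sum_frame
    by (intro sum.cong refl) (simp only: f frame_P ip_\<mu>_frame)
  also have "\<dots> = (\<Sum>a\<in>{1..r}. \<Sum>b\<in>{1..r}. \<Sum>X\<in>E a. \<Sum>Y\<in>E b. \<Sum>c\<in>{1..r}. \<Sum>Z\<in>E c. t a b c * (x c / (x a * x b) * (Q (br X Y) Z)\<^sup>2))"
    by (rule sum.cong[OF refl], rule sum.swap)
  also have "\<dots> = (\<Sum>a\<in>{1..r}. \<Sum>b\<in>{1..r}. \<Sum>X\<in>E a. \<Sum>c\<in>{1..r}. \<Sum>Y\<in>E b. \<Sum>Z\<in>E c. t a b c * (x c / (x a * x b) * (Q (br X Y) Z)\<^sup>2))"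
    by (rule sum.cong[OF refl], rule sum.cong[OF refl], rule sum.cong[OF refl], rule sum.swap)
  also have "\<dots> = (\<Sum>a\<in>{1..r}. \<Sum>b\<in>{1..r}. \<Sum>c\<in>{1..r}. \<Sum>X\<in>E a. \<Sum>Y\<in>E b. \<Sum>Z\<in>E c. t a b c * (x c / (x a * x b) * (Q (br X Y) Z)\<^sup>2))"
    by (rule sum.cong[OF refl], rule sum.cong[OF refl], rule sum.swap)
  also have "\<dots> = (\<Sum>a\<in>{1..r}. \<Sum>b\<in>{1..r}. \<Sum>c\<in>{1..r}. t a b c * (x c / (x a * x b) * sc a b c))"
    by (simp only: struct_const_def sum_distrib_left)
  finally show ?thesis .
qed

lemma tensor_inner_theta_theta:
  assumes m: "m \<in> {1..r}" and k: "k \<in> {1..r}"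
  shows "tensor_inner \<pp> ip (gl_theta (I m) \<mu>) (gl_theta (I k) \<mu>) =
    (\<Sum>a\<in>{1..r}. \<Sum>b\<in>{1..r}. \<Sum>c\<in>{1..r}. theta_weight m a b c * theta_weight k a b c * (x c / (x a * x b) * sc a b c))"
proof -
  have "tensor_inner \<pp> ip (gl_theta (I m) \<mu>) (gl_theta (I k) \<mu>) =
    (\<Sum>X\<in>frame. \<Sum>Y\<in>frame. \<Sum>Z\<in>frame. ip (gl_theta (I m) \<mu> X Y) Z * ip (gl_theta (I k) \<mu> X Y) Z)"
    by (simp add: tensor_inner_eq bilinear_gl_theta bilinear_\<mu> flip: parseval)
  also have "\<dots> = (\<Sum>a\<in>{1..r}. \<Sum>b\<in>{1..r}. \<Sum>c\<in>{1..r}. theta_weight m a b c * theta_weight k a b c * (x c / (x a * x b) * sc a b c))"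
    by (rule sum_frame_weights) (simp only: pairing_eigen[OF m] pairing_eigen[OF k] power2_eq_square mult_ac)
  finally show ?thesis .
qed

lemma tensor_inner_theta:
  assumes k: "k \<in> {1..r}"
  shows "tensor_inner \<pp> ip (gl_theta (I k) \<mu>) \<mu> =
    (\<Sum>a\<in>{1..r}. \<Sum>b\<in>{1..r}. \<Sum>c\<in>{1..r}. theta_weight k a b c * (x c / (x a * x b) * sc a b c))"
proof -
  have "tensor_inner \<pp> ip (gl_theta (I k) \<mu>) \<mu> =
    (\<Sum>X\<in>frame. \<Sum>Y\<in>frame. \<Sum>Z\<in>frame. ip (gl_theta (I k) \<mu> X Y) Z * ip (\<mu> X Y) Z)"
    by (simp add: tensor_inner_eq bilinear_gl_theta bilinear_\<mu> flip: parseval)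
  also have "\<dots> = (\<Sum>a\<in>{1..r}. \<Sum>b\<in>{1..r}. \<Sum>c\<in>{1..r}. theta_weight k a b c * (x c / (x a * x b) * sc a b c))"
    by (rule sum_frame_weights) (simp only: pairing_eigen[OF k] power2_eq_square mult_ac)
  finally show ?thesis .
qed

text \<open>The blocks are orthogonal idempotents, so the composition with the moment map reduces to
  \<open>I k\<close> or to 0, and the defining property of the moment map applies. With the factor 2
  in \<open>L_form\<close> this is the source of the linear half of the diagonal weight.\<close>

lemma trace_moment_map_block_id:
  assumes m: "m \<in> {1..r}" and k: "k \<in> {1..r}"
  shows "trace_on \<pp> (moment_map \<kk> \<pp> ip \<mu> o\<^sub>L I m o\<^sub>L I k) =
    (if m = k then 1/4 * tensor_inner \<pp> ip (gl_theta (I k) \<mu>) \<mu> else 0)"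
proof -
  let ?M = "moment_map \<kk> \<pp> ip \<mu>"
  have M: "?M \<in> sym_on \<kk> \<pp> ip" by (rule moment_map(1)[OF bilinear_\<mu>])
  have Ik: "I k \<in> gl_on \<kk> \<pp>" by (rule sym_gl[OF block_id_sym[OF k]])
  have "trace_on \<pp> (?M o\<^sub>L I m o\<^sub>L I k) = (\<Sum>p\<in>frame. ip (?M (I m (I k p))) p)"
    by (subst trace_on_eq) (auto simp: linear_blinfun glD sym_gl M)
  also have "\<dots> = (\<Sum>p\<in>frame. ip (?M p) (if m = k then I k p else 0))"
  proof (intro sum.cong refl)
    fix p
    have "I m (I k p) = (if m = k then I k p else 0)"
      unfolding block_id_apply[OF m] block_id_apply[OF k] by (rule proj_proj[OF m k])
    then show "ip (?M (I m (I k p))) p = ip (?M p) (if m = k then I k p else 0)"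
      using sym_ip[OF M, of p] ip_commute[of p] by (simp add: ip_simps)
  qed
  also have "\<dots> = (if m = k then gl_inner \<kk> \<pp> ip ?M (I k) else 0)"
    by (simp add: gl_inner_eq sym_gl[OF M] Ik ip_simps)
  finally show ?thesis using moment_map(2)[OF bilinear_\<mu> Ik] by simp
qed

lemma op_matrix_L:
  assumes k: "k \<in> {1..r}" and m: "m \<in> {1..r}"
  shows "op_matrix r unit_block (L_op \<kk> \<pp> ip \<mu>) k m =
    1 / (sqrt (real (dim (P k))) * sqrt (real (dim (P m)))) * L_form \<mu> (I m) (I k)"
proof -
  have "op_matrix r unit_block (L_op \<kk> \<pp> ip \<mu>) k m = gl_inner \<kk> \<pp> ip (L_op \<kk> \<pp> ip \<mu> (unit_block m)) (unit_block k)"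
    by (intro op_matrix_eq L_op_symH unit_block_symH m k)
  also have "\<dots> = L_form \<mu> (unit_block m) (unit_block k)"
    using unit_block_symH[OF k] by (intro L_op(2) bilinear_\<mu>) (simp add: symH_iff)
  finally show ?thesis unfolding unit_block_def L_form_scaleR[OF bilinear_\<mu>] by (simp add: mult.commute)
qed

lemma op_matrix_diagonal:
  assumes k: "k \<in> {1..r}"
  shows "op_matrix r unit_block (L_op \<kk> \<pp> ip \<mu>) k k =
    1 / real (dim (P k)) * (\<Sum>i\<in>{1..r} - {k}. \<Sum>j\<in>{1..r} - {k}. x k / (x i * x j) * sc i j k) +
    1 / real (dim (P k)) * (\<Sum>i\<in>{1..r} - {k}. x i / (x k)\<^sup>2 * sc i k k)"
proof -
  have "L_form \<mu> (I k) (I k) = (\<Sum>i\<in>{1..r} - {k}. \<Sum>j\<in>{1..r} - {k}. x k / (x i * x j) * sc i j k) +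
      (\<Sum>i\<in>{1..r} - {k}. x i / (x k)\<^sup>2 * sc i k k)"
    unfolding L_form_def trace_moment_map_block_id[OF k k] tensor_inner_theta_theta[OF k k] tensor_inner_theta[OF k]
    using theta_weight_sum_diagonal[of "{1..r}" k sc x, OF _ k sc_swap12 sc_swap23] by simp
  then show ?thesis unfolding op_matrix_L[OF k k] by (simp add: distrib_left)
qed

lemma op_matrix_off_diagonal:
  assumes k: "k \<in> {1..r}" and m: "m \<in> {1..r}" and km: "k \<noteq> m"
  shows "op_matrix r unit_block (L_op \<kk> \<pp> ip \<mu>) k m =
    1 / (sqrt (real (dim (P k))) * sqrt (real (dim (P m)))) *
      (\<Sum>i=1..r. ((x i)\<^sup>2 - (x k)\<^sup>2 - (x m)\<^sup>2) / (x i * x k * x m) * sc i k m)"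
proof -
  have "L_form \<mu> (I m) (I k) = (\<Sum>i=1..r. ((x i)\<^sup>2 - (x k)\<^sup>2 - (x m)\<^sup>2) / (x i * x k * x m) * sc i k m)"
    unfolding L_form_def trace_moment_map_block_id[OF m k] tensor_inner_theta_theta[OF m k]
    using theta_weight_sum_off_diagonal[of "{1..r}" k m sc x, OF _ k m km sc_swap12 sc_swap23 x_pos] km by simp
  then show ?thesis unfolding op_matrix_L[OF k m] by simp
qed

end

theorem theorem3p1:
  fixes G :: "'g monoid" and TG :: "'g topology" and AG :: "('g, 'e::euclidean_space) atlas"
    and TM :: "'m topology" and AM :: "('m, 'f::euclidean_space) atlas"
    and act :: "'g \<Rightarrow> 'm \<Rightarrow> 'm" and pt :: 'm
    and K H U :: "'g set" and \<phi> :: "'g \<Rightarrow> 'e"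
    and Ad :: "'g \<Rightarrow> 'e \<Rightarrow> 'e" and br :: "'e \<Rightarrow> 'e \<Rightarrow> 'e" and \<kk> \<pp> :: "'e set"
    and Q ip :: "'e \<Rightarrow> 'e \<Rightarrow> real"
    and r :: nat and P E :: "nat \<Rightarrow> 'e set" and x :: "nat \<Rightarrow> real" and d :: "nat \<Rightarrow> nat"
    and \<mu> :: "'e \<Rightarrow> 'e \<Rightarrow> 'e" and symH :: "('e \<Rightarrow>\<^sub>L 'e) set"
    and b :: "nat \<Rightarrow> 'e \<Rightarrow>\<^sub>L 'e" and L :: "('e \<Rightarrow>\<^sub>L 'e) \<Rightarrow> ('e \<Rightarrow>\<^sub>L 'e)"
    and sc :: "nat \<Rightarrow> nat \<Rightarrow> nat \<Rightarrow> real"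
  assumes "lie_group G TG AG" and "compact_space TG"
    and "smooth_manifold TM AM" and "compact_space TM" and "connected_space TM"
    and "smooth_transitive_action G TG AG TM AM act" and "almost_effective G TG TM act"
    and "pt \<in> topspace TM" and "K = stabilizer G act pt"
    and "(U, \<phi>) \<in> AG" and "\<one>\<^bsub>G\<^esub> \<in> U"
    and "Ad = Ad_map G U \<phi>" and "br = lie_bracket G U \<phi>"
    and "inner_product Q" and "\<And>g X Y. g \<in> carrier G \<Longrightarrow> Q (Ad g X) (Ad g Y) = Q X Y"
    and "\<kk> = subgroup_lie_algebra G U \<phi> K" and "\<pp> = {X. \<forall>Y\<in>\<kk>. Q X Y = 0}"
    and "orthogonal_decomposition Q \<pp> r P"
    and "subgroup H G" and "K \<subseteq> H" and "H \<subseteq> normalizer G K"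
    and "\<And>k. k \<in> {1..r} \<Longrightarrow> invariant_under Ad H (P k)"
    and "\<And>k. k \<in> {1..r} \<Longrightarrow> irreducible_under Ad H (P k)"
    and "\<And>i j. i \<in> {1..r} \<Longrightarrow> j \<in> {1..r} \<Longrightarrow> i \<noteq> j \<Longrightarrow> \<not> equivalent_under Ad H (P i) (P j)"
    and "\<And>k. k \<in> {1..r} \<Longrightarrow> x k > 0"
    and "ip = diag_metric \<kk> \<pp> r P Q x"
    and "\<mu> = (\<lambda>X Y. proj_along \<pp> \<kk> (br X Y))"
    and "symH = sym_inv_on \<kk> \<pp> ip Ad H"
    and "L = L_op \<kk> \<pp> ip \<mu>"
    and "d = (\<lambda>k. dim (P k))"
    and "b = (\<lambda>k. (1 / sqrt (real (d k))) *\<^sub>R block_id \<kk> \<pp> r P k)"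
    and "\<And>k. k \<in> {1..r} \<Longrightarrow> orthonormal_basis Q (P k) (E k)"
    and "sc = struct_const Q br E"
  shows "(inj_on b {1..r} \<and> orthonormal_basis (gl_inner \<kk> \<pp> ip) symH (b ` {1..r})) \<and>
         (\<forall>A\<in>symH. L A \<in> symH) \<and>
         (\<forall>k\<in>{1..r}. op_matrix r b L k k =
           1 / real (d k) * (\<Sum>i\<in>{1..r} - {k}. \<Sum>j\<in>{1..r} - {k}. x k / (x i * x j) * sc i j k) +
           1 / real (d k) * (\<Sum>i\<in>{1..r} - {k}. x i / (x k)\<^sup>2 * sc i k k)) \<and>
         (\<forall>k\<in>{1..r}. \<forall>m\<in>{1..r}. k \<noteq> m \<longrightarrow> op_matrix r b L k m =
           1 / (sqrt (real (d k)) * sqrt (real (d m))) *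
           (\<Sum>i=1..r. ((x i)\<^sup>2 - (x k)\<^sup>2 - (x m)\<^sup>2) / (x i * x k * x m) * sc i k m))"
proof -
  note hyps = assms
  have act: "transitive_action G (topspace TM) act"
    using hyps(6) by (simp add: smooth_transitive_action_def)
  then interpret group_action G "topspace TM" act by (rule transitive_action.axioms)
  \<comment> \<open>Closure of the stabiliser under products is what makes \<kk> a linear
    subspace.\<close>
  have K: "subgroup K G" using stabilizer_subgroup[OF hyps(8)] hyps(9) by simp
  interpret lie: biinvariant_chart G TG AG U \<phi> Q
    using hyps(1,10,11,14,15) unfolding hyps(12) by unfold_locales
  have H: "h \<in> carrier G" if "h \<in> H" for h
    using subgroup.mem_carrier[OF hyps(19) that] .
  \<comment> \<open>From here on only linear data remain: a subspace \<kk>, an isometric action of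
    \<open>H\<close> respecting the blocks and the bracket, and a bracket skew with respect to
    \<open>Q\<close>.\<close>
  interpret mf: multiplicity_free_bracket \<kk> \<pp> Q r P E x Ad H br
  proof (intro multiplicity_free_bracket.intro multiplicity_free_bracket_axioms.intro
      multiplicity_free_metric.intro multiplicity_free_metric_axioms.intro diagonal_metric.intro)
    show "subspace \<kk>" unfolding hyps(16) by (rule lie.subgroup_lie_algebra_subspace[OF K])
    show "bilinear br" unfolding hyps(13) by (rule lie.bilinear_bracket)
    show "br X Y = - br Y X" for X Y unfolding hyps(13) by (rule lie.bracket_antisym)
    show "Q (br X Y) Z = - Q Y (br X Z)" for X Y Z unfolding hyps(13) by (rule lie.bracket_skew)
    show "Ad h (br X Y) = br (Ad h X) (Ad h Y)" if "h \<in> H" for h X Y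
      unfolding hyps(12,13) by (rule lie.Ad_bracket[OF H[OF that]])
    show "Q (Ad h X) (Ad h Y) = Q X Y" if "h \<in> H" for h X Y by (rule hyps(15)[OF H[OF that]])
    show "linear (Ad h)" if "h \<in> H" for h unfolding hyps(12) by (rule lie.Ad_linear[OF H[OF that]])
  qed (rule hyps(14,17,18,22,23,24,25,32); assumption)+
  have ip: "ip = mf.ip" by (rule hyps(26))
  have \<mu>: "\<mu> = mf.\<mu>" unfolding hyps(27) mf.\<mu>_def[abs_def] ..
  have L: "L = L_op \<kk> \<pp> mf.ip mf.\<mu>" unfolding hyps(29) ip \<mu> ..
  have sym: "symH = mf.symH" unfolding hyps(28) ip ..
  have b: "b = mf.unit_block" unfolding hyps(30,31) mf.unit_block_def[abs_def] ..
  show ?thesis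
    unfolding ip b L sym hyps(30,33)
    by (intro conjI ballI impI mf.inj_unit_block mf.unit_block_orthonormal mf.L_op_symH
        mf.op_matrix_diagonal mf.op_matrix_off_diagonal)
qed

end
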